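(* Let $\mathcal{Z}$ be the zero process of the standard planar Gaussian analytic function and let $\mathcal{D}\subset\mathbb{C}$ be a bounded open set. Then: (i) There is a measurable function $N:\mathcal{S}_{\mathrm{out}}\to\mathbb{N}\cup\{0\}$ such that almost surely the number of points in $\mathcal{Z}_{\mathrm{in}}$ equals $N(\mathcal{Z}_{\mathrm{out}})$. (ii) There is a measurable function $S:\mathcal{S}_{\mathrm{out}}\to\mathbb{C}$ such that almost surely the sum of the points in $\mathcal{Z}_{\mathrm{in}}$ equals $S(\mathcal{Z}_{\mathrm{out}})$.
   Context: The standard planar Gaussian analytic function (GAF) is the random entire function $f(z)=\sum_{k\ge 0}\frac{\xi_k}{\sqrt{k!}}z^k$, where $(\xi_k)_{k\ge 0}$ are i.i.d. standard complex Gaussians; $\mathcal{Z}$ is the point process of its zeroes. $\mathcal{S}$ is the Polish space of locally finite point configurations on $\mathbb{C}$ (topology of weak convergence of the associated counting measures). $\mathcal{S}=\mathcal{S}_{\mathrm{in}}\times\mathcal{S}_{\mathrm{out}}$, where $\mathcal{S}_{\mathrm{in}}$ is the space of finite point configurations on $\mathcal{D}$ and $\mathcal{S}_{\mathrm{out}}$ the space of locally finite point configurations on $\mathcal{D}^c$. $\Pi_{\mathrm{in}}$ and $\Pi_{\mathrm{out}}$ denote the restrictions of a point process $\Pi$ to $\mathcal{D}$ and $\mathcal{D}^c$. *)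

theory Defs
  imports "HOL-Probability.Probability" "HOL-Complex_Analysis.Complex_Analysis"
begin

text \<open>
  A point configuration is encoded by its multiplicity function: \<open>c z\<close> is the number of points
  at \<open>z\<close>, that is, \<open>c\<close> is the mass function of the associated counting measure.
\<close>

type_synonym config = "complex \<Rightarrow> nat"

definition configs :: "complex set \<Rightarrow> config set" where
  "configs A = {c. (\<forall>z. z \<notin> A \<longrightarrow> c z = 0) \<and>
                   (\<forall>K. compact K \<and> K \<subseteq> A \<longrightarrow> finite {z \<in> K. c z \<noteq> 0})}"

definition restrict_config :: "config \<Rightarrow> complex set \<Rightarrow> config" where
  "restrict_config c A = (\<lambda>z. if z \<in> A then c z else 0)"

text \<open>
  Both sums below are over finite sets whenever \<open>c\<close> is a finite configuration; as everywhere in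
  HOL, they are \<open>0\<close> when the configuration is infinite.
\<close>

definition num_points :: "config \<Rightarrow> nat" where
  "num_points c = (\<Sum>z | c z \<noteq> 0. c z)"

definition sum_points :: "config \<Rightarrow> complex" where
  "sum_points c = (\<Sum>z | c z \<noteq> 0. of_nat (c z) * z)"

definition test_functions :: "complex set \<Rightarrow> (complex \<Rightarrow> real) set" where
  "test_functions A = {\<phi>. continuous_on A \<phi> \<and> (\<exists>K. compact K \<and> K \<subseteq> A \<and> (\<forall>z \<in> A - K. \<phi> z = 0))}"

definition counting_measure :: "config \<Rightarrow> complex measure" where
  "counting_measure c = density (count_space UNIV) (\<lambda>z. of_nat (c z))"

text \<open>
  The counting measures are only locally finite, so weak convergence is convergence of the integrals
  of continuous compactly supported functions; the topology is the coarsest one making all these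
  integrals continuous.
\<close>

definition weak_topology :: "complex set \<Rightarrow> config topology" where
  "weak_topology A = topology_generated_by
     {{c \<in> configs A. (\<integral>z. \<phi> z \<partial>counting_measure c) \<in> U} | \<phi> U. \<phi> \<in> test_functions A \<and> open U}"

definition borel_of :: "'a topology \<Rightarrow> 'a measure" where
  "borel_of T = sigma (topspace T) {U. openin T U}"

lemma topspace_weak_topology: "topspace (weak_topology A) = configs A"
proof -
  have 0: "(\<lambda>_. 0) \<in> test_functions A"
    unfolding test_functions_def by (auto intro!: exI[of _ "{}"])
  then have "\<exists>\<phi> U. configs A = {c \<in> configs A. (\<integral>z. \<phi> z \<partial>counting_measure c) \<in> U} \<and>
      \<phi> \<in> test_functions A \<and> open U"
    by (intro exI[of _ "\<lambda>_. 0"] exI[of _ UNIV]) simp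
  then show ?thesis
    unfolding weak_topology_def topology_generated_by_topspace
    by (intro equalityI Union_least Union_upper) (simp_all, auto)
qed

lemma integral_counting_measure:
  assumes c: "c \<in> configs A" and phi: "\<phi> \<in> test_functions A"
  shows "(\<integral>z. \<phi> z \<partial>counting_measure c) = (\<Sum>z | c z \<noteq> 0 \<and> \<phi> z \<noteq> 0. real (c z) * \<phi> z)"
proof -
  have c0: "\<And>z. z \<notin> A \<Longrightarrow> c z = 0"
    and cfin: "\<And>K. compact K \<Longrightarrow> K \<subseteq> A \<Longrightarrow> finite {z \<in> K. c z \<noteq> 0}"
    using c by (simp_all add: configs_def)
  obtain K where K: "compact K" "K \<subseteq> A" and K0: "\<forall>z \<in> A - K. \<phi> z = 0"
    using phi by (auto simp: test_functions_def)
  have "{z. c z \<noteq> 0 \<and> \<phi> z \<noteq> 0} \<subseteq> {z \<in> K. c z \<noteq> 0}"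
  proof
    fix z assume z: "z \<in> {z. c z \<noteq> 0 \<and> \<phi> z \<noteq> 0}"
    then have "z \<in> A" using c0[of z] by auto
    with z K0 show "z \<in> {z \<in> K. c z \<noteq> 0}" by auto
  qed
  then have fin: "finite {z \<in> UNIV. real (c z) * \<phi> z \<noteq> 0}"
    using finite_subset[OF _ cfin[OF K]] by simp
  have "(\<integral>z. \<phi> z \<partial>counting_measure c) = (\<integral>z. real (c z) * \<phi> z \<partial>count_space UNIV)"
    unfolding counting_measure_def ennreal_of_nat_eq_real_of_nat
    by (rule integral_real_density) simp_all
  also have "\<dots> = (\<Sum>z | z \<in> UNIV \<and> real (c z) * \<phi> z \<noteq> 0. real (c z) * \<phi> z)"
    by (rule lebesgue_integral_count_space_finite_support[OF fin])
  finally show ?thesis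
    by simp
qed

text \<open>Independent real and imaginary parts of variance \<open>1/2\<close>, so that the second absolute moment is \<open>1\<close>.\<close>

definition std_complex_normal_density :: "complex \<Rightarrow> real" where
  "std_complex_normal_density z = exp (- (cmod z)\<^sup>2) / pi"

definition gaf :: "(nat \<Rightarrow> complex) \<Rightarrow> complex \<Rightarrow> complex" where
  "gaf a z = (\<Sum>k. a k / of_real (sqrt (fact k)) * z ^ k)"

text \<open>
  Zeros are counted with multiplicity. The value is meaningful when \<open>f\<close> is entire and not identically
  zero, which holds almost surely for the Gaussian analytic function.
\<close>

definition zero_config :: "(complex \<Rightarrow> complex) \<Rightarrow> config" where
  "zero_config f = (\<lambda>z. if f z = 0 then nat (zorder f z) else 0)"

end

theory Submission
  imports Defs
begin

text \<open>
  Write \<open>F\<close> for the Gaussian analytic function. If \<open>\<Sum> c\<^sub>k = 0\<close>, Jensen's formula turns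
  \<open>\<Sum> c\<^sub>k log |F|\<close>, averaged over the circles of radius \<open>k\<close>, into a sum over the zeros of a continuous
  compactly supported radial function; for \<open>\<Sum> k c\<^sub>k = 0\<close> the first Fourier coefficients of \<open>log |F|\<close> on
  these circles give a sum of \<open>a \<phi>(|a|)\<close> over the zeros \<open>a\<close>. The coefficients can be chosen such that
  the radial function is \<open>1\<close> on \<open>D\<close>. The number (the sum) of the zeros in \<open>D\<close> is then the circle
  average minus the contribution of the zeros outside \<open>D\<close>, so it remains to make the variance of the
  circle average small.

  The values of \<open>F(z) exp (-|z|\<^sup>2/2)\<close> at \<open>z\<close> and \<open>w\<close> are jointly Gaussian with squared correlation
  \<open>exp (-|z-w|\<^sup>2)\<close>. Frullani's formula expresses the logarithm by exponentials \<open>exp (-s |F|\<^sup>2)\<close>, whose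
  covariances are explicit, and bounds the variance by the energy
  \<open>\<Sum> |c\<^sub>k c\<^sub>l| exp (-(k-l)\<^sup>2) / sqrt (k l)\<close>. For the number of zeros two circles of large radius suffice.
  For the sum of the zeros one spreads the mass over all radii between \<open>m\<close> and \<open>2\<^sup>q m\<close>, and the energy is
  of order \<open>1/q\<close>.
\<close>

section \<open>Circle means of the logarithm of an entire function\<close>

text \<open>Multiplied by \<open>exp (-|z|^2/2)\<close>, the modulus of \<open>F\<close> has the
  same law at every point. A combination of logarithms therefore has mean zero as soon as
  \<open>\<Sum> c_k = 0\<close> or the angular weight has mean zero, and only covariances remain.
  Two points on circles of radius about \<open>k\<close> are correlated only along an arc of length
  O(1), a fraction of order \<open>1/k\<close> of the circle; hence the factor
  \<open>1 / sqrt (k l)\<close>. The normalization on \<open>D\<close> decides how small the energy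
  can be. For the number it is \<open>\<Sum> c_k ln k = 1\<close>, which (as
  \<open>\<Sum> c_k = 0\<close>) is invariant under scaling of the radii, so bounded coefficients on
  two far circles suffice. For the sum it is \<open>\<Sum> c_k / k = 1\<close>; the diagonal part of
  the energy is \<open>\<Sum> c_k^2 / k\<close>, which by Cauchy-Schwarz is at least
  \<open>1 / (\<Sum> 1/k)\<close>. So radii of bounded ratio cannot work, and constant coefficients
  over many dyadic scales have the optimal order. The energies are taken below \<open>2^-j\<close>,
  hence summable, and the circle averages tend to 0 almost surely. All radii are integers: only
  countably many circles must be free of zeros.\<close>

abbreviation ucirc :: "real \<Rightarrow> complex" where
  "ucirc t \<equiv> cis (2 * pi * t)"

lemma has_contour_integral_circlepath_cis:
  "(g has_contour_integral I) (circlepath 0 r) \<longleftrightarrow>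
     ((\<lambda>t. g (of_real r * ucirc t) * (2 * of_real pi * \<i> * of_real r * ucirc t)) has_integral I) {0..1}"
  unfolding has_contour_integral vector_derivative_circlepath
  by (simp add: circlepath cis_conv_exp algebra_simps)

text \<open>Fourier coefficients of order 0, 1 and -1 on the circle: Cauchy's formula for
  \<open>H 0\<close> and \<open>deriv H 0\<close>, and for the function \<open>u * H u\<close>,
  which vanishes at 0.\<close>

lemma circle_mean_holomorphic:
  fixes H :: "complex \<Rightarrow> complex"
  assumes H: "H holomorphic_on S" and S: "open S" "cball 0 r \<subseteq> S" and r: "r > 0"
  shows "((\<lambda>t. H (of_real r * ucirc t)) has_integral H 0) {0..1}"
    and "((\<lambda>t. H (of_real r * ucirc t) * cnj (ucirc t)) has_integral of_real r * deriv H 0) {0..1}"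
    and "((\<lambda>t. H (of_real r * ucirc t) * ucirc t) has_integral 0) {0..1}"
proof -
  have Hc: "continuous_on (cball 0 r) H" and Hb: "H holomorphic_on ball 0 r"
    using S(2) ball_subset_cball[of 0 r]
    by (blast intro: holomorphic_on_imp_continuous_on holomorphic_on_subset[OF H])+
  have nz: "2 * of_real pi * \<i> \<noteq> (0::complex)" by simp
  have inv: "1 / ucirc t = cnj (ucirc t)" for t
    by (simp add: cis_cnj cis_inverse divide_inverse)
  have "((\<lambda>u. H u / u) has_contour_integral (2 * of_real pi * \<i>) * H 0) (circlepath 0 r)"
    using Cauchy_has_contour_integral_higher_derivative_circlepath[OF Hc Hb, of 0 0] r by simp
  from has_integral_mult_right[OF this[unfolded has_contour_integral_circlepath_cis],
        of "1 / (2 * of_real pi * \<i>)"]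
  show "((\<lambda>t. H (of_real r * ucirc t)) has_integral H 0) {0..1}"
    using r nz by (simp add: field_simps)
  have "((\<lambda>u. H u / u^2) has_contour_integral (2 * of_real pi * \<i>) * deriv H 0) (circlepath 0 r)"
    using Cauchy_has_contour_integral_higher_derivative_circlepath[OF Hc Hb, of 0 1] r
    by (simp add: power2_eq_square)
  from has_integral_mult_right[OF this[unfolded has_contour_integral_circlepath_cis],
        of "of_real r / (2 * of_real pi * \<i>)"]
  have "((\<lambda>t. H (of_real r * ucirc t) / ucirc t) has_integral of_real r * deriv H 0) {0..1}"
    using r nz by (simp add: field_simps power2_eq_square)
  then show "((\<lambda>t. H (of_real r * ucirc t) * cnj (ucirc t)) has_integral of_real r * deriv H 0) {0..1}"
    unfolding inv[symmetric] by simp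
  have "((\<lambda>u. (u * H u) / u) has_contour_integral 0) (circlepath 0 r)"
  proof -
    have "continuous_on (cball 0 r) (\<lambda>u. u * H u)" "(\<lambda>u. u * H u) holomorphic_on ball 0 r"
      using Hb Hc by (auto intro!: continuous_intros holomorphic_intros)
    from Cauchy_has_contour_integral_higher_derivative_circlepath[OF this, of 0 0] r
    show ?thesis by simp
  qed
  from has_integral_mult_right[OF this[unfolded has_contour_integral_circlepath_cis],
        of "1 / (2 * of_real pi * \<i> * of_real r)"]
  show "((\<lambda>t. H (of_real r * ucirc t) * ucirc t) has_integral 0) {0..1}"
    using r nz by (simp add: field_simps)
qed

text \<open>Write the real part as half of \<open>H + cnj H\<close>. Against \<open>ucirc\<close>,
  the term \<open>H\<close> integrates to 0 and \<open>cnj H\<close> gives the conjugate of the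
  coefficient of order 1.\<close>

lemma circle_mean_Re_holomorphic:
  fixes H :: "complex \<Rightarrow> complex"
  assumes H: "H holomorphic_on S" and S: "open S" "cball 0 r \<subseteq> S" and r: "r > 0"
  shows "((\<lambda>t. Re (H (of_real r * ucirc t))) has_integral Re (H 0)) {0..1}"
    and "((\<lambda>t. of_real (Re (H (of_real r * ucirc t))) * ucirc t)
            has_integral of_real r * cnj (deriv H 0) / 2) {0..1}"
proof -
  note m = circle_mean_holomorphic[OF assms]
  show "((\<lambda>t. Re (H (of_real r * ucirc t))) has_integral Re (H 0)) {0..1}"
    using has_integral_linear[OF m(1) bounded_linear_Re] by (simp add: o_def)
  have "((\<lambda>t. cnj (H (of_real r * ucirc t)) * ucirc t) has_integral of_real r * cnj (deriv H 0)) {0..1}"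
    using has_integral_linear[OF m(2) bounded_linear_cnj] by (simp add: o_def)
  from has_integral_mult_right[OF has_integral_add[OF m(3) this], of "1/2"]
  show "((\<lambda>t. of_real (Re (H (of_real r * ucirc t))) * ucirc t)
            has_integral of_real r * cnj (deriv H 0) / 2) {0..1}"
    by (simp add: complex_add_cnj ring_distribs[symmetric])
qed

lemma has_integral_ucirc: "(ucirc has_integral 0) {0..1}"
  using circle_mean_holomorphic(3)[of "\<lambda>_. 1" UNIV 1] by simp

text \<open>For \<open>a\<close> inside the circle the first mean is constant in \<open>a\<close>
  and the second is linear in \<open>a\<close>. This is why the means of order 0 see the number of
  zeros and those of order 1 see their sum.\<close>

lemma circle_mean_log_linear:
  fixes a :: complex
  assumes r: "r > 0" and a: "cmod a \<noteq> r"
  shows "((\<lambda>t. ln (cmod (of_real r * ucirc t - a))) has_integral ln (max r (cmod a))) {0..1}"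
    and "((\<lambda>t. of_real (ln (cmod (of_real r * ucirc t - a))) * ucirc t)
            has_integral - (of_real r * a / (2 * of_real (max r (cmod a))^2))) {0..1}"
proof -
  \<comment> \<open>On the circle, \<open>|z - a|\<close> equals \<open>m |1 - q z|\<close> with \<open>|q| r < 1\<close>: reflect \<open>a\<close> if it is inside.\<close>
  define m where "m = max r (cmod a)"
  define q where "q = cnj a / of_real (m^2)"
  define H where "H = (\<lambda>z. Ln (1 - q * z))"
  define S where "S = {z. 0 < Re (1 - q * z)}"
  have m: "m > 0" "m^2 > 0" using r by (auto simp: m_def)
  have q: "cmod q * r < 1"
  proof -
    have "cmod a * r < m * m"
      using a r unfolding m_def max_def
      by (cases "r \<le> cmod a") (auto intro!: mult_strict_right_mono mult_strict_left_mono)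
    then show ?thesis
      using m by (simp add: q_def norm_divide norm_mult power2_eq_square field_simps)
  qed
  have S: "open S" unfolding S_def by (intro open_Collect_less continuous_intros)
  have sub: "cball 0 r \<subseteq> S"
  proof
    fix z assume "z \<in> cball (0::complex) r"
    then have "cmod (q * z) < 1"
      using q by (simp add: norm_mult) (meson le_less_trans mult_left_mono norm_ge_zero)
    then show "z \<in> S" using complex_Re_le_cmod[of "q * z"] by (simp add: S_def)
  qed
  have holo: "H holomorphic_on S"
    unfolding H_def S_def by (intro holomorphic_intros) (auto simp: complex_nonpos_Reals_iff)
  have der: "deriv H 0 = - q"
    unfolding H_def by (rule DERIV_imp_deriv) (auto intro!: derivative_eq_intros)
  have key: "ln (cmod (of_real r * ucirc t - a)) = ln m + Re (H (of_real r * ucirc t))" for t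
  proof -
    let ?z = "of_real r * ucirc t"
    have "?z \<in> S" using sub r by (auto simp: norm_mult)
    then have nz: "1 - q * ?z \<noteq> 0" unfolding S_def by fastforce
    have zz: "?z * cnj ?z = of_real (r^2)"
      by (simp add: complex_norm_square[symmetric] norm_mult power2_eq_square)
    have "cmod (?z - a) = m * cmod (1 - q * ?z)"
    proof (cases "cmod a < r")
      case True
      then have [simp]: "m = r" by (simp add: m_def)
      have "of_real (r^2) * q = cnj a"
        using r by (simp add: q_def)
      then have "of_real (r^2) * (1 - q * ?z) = of_real (r^2) - cnj a * ?z"
        by (simp add: right_diff_distrib mult.assoc[symmetric])
      also have "\<dots> = ?z * cnj (?z - a)"
        unfolding zz[symmetric] by (simp add: right_diff_distrib mult.commute)
      finally have "of_real (r^2) * (1 - q * ?z) = ?z * cnj (?z - a)" .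
      then have "r^2 * cmod (1 - q * ?z) = r * cmod (?z - a)"
        using r by (metis (no_types, lifting) abs_of_pos complex_mod_cnj m(2) \<open>m = r\<close> mult.right_neutral
            norm_cis norm_mult norm_of_real)
      then show ?thesis using r by (simp add: power2_eq_square)
    next
      case False
      then have [simp]: "m = cmod a" using a by (simp add: m_def)
      have a0: "a \<noteq> 0" using m by auto
      have "a * q = 1"
        using a0 by (simp add: q_def complex_norm_square del: of_real_power)
      then have "a * (1 - q * ?z) = a - ?z" by (simp add: algebra_simps)
      then show ?thesis by (metis \<open>m = cmod a\<close> norm_minus_commute norm_mult)
    qed
    then show ?thesis using nz m by (simp add: H_def ln_mult Re_Ln)
  qed
  note c = circle_mean_Re_holomorphic[OF holo S sub r]
  have "((\<lambda>t. ln m) has_integral ln m) {0..1::real}"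
    using has_integral_const_real[of "ln m" 0 1] by simp
  from has_integral_add[OF this c(1)]
  show "((\<lambda>t. ln (cmod (of_real r * ucirc t - a))) has_integral ln (max r (cmod a))) {0..1}"
    unfolding key by (simp add: H_def m_def)
  have "of_real r * cnj (deriv H 0) / 2 = - (of_real r * a / (2 * of_real m^2))"
    unfolding der by (simp add: q_def)
  with has_integral_add[OF has_integral_mult_right[OF has_integral_ucirc, of "of_real (ln m)"] c(2)]
  show "((\<lambda>t. of_real (ln (cmod (of_real r * ucirc t - a))) * ucirc t)
            has_integral - (of_real r * a / (2 * of_real (max r (cmod a))^2))) {0..1}"
    unfolding key m_def[symmetric] by (simp add: algebra_simps)
qed

lemma finite_zeros_entire:
  assumes f: "f holomorphic_on UNIV" and nz: "f z0 \<noteq> 0" and S: "bounded S"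
  shows "finite {a \<in> S. f a = 0}"
proof (cases "f constant_on UNIV")
  case True
  then show ?thesis using nz unfolding constant_on_def by fastforce
next
  case False
  then have "finite {a \<in> closure S. f a = 0}"
    using S by (intro holomorphic_compact_finite_zeros[OF f]) auto
  then show ?thesis by (rule rev_finite_subset) (use closure_subset in auto)
qed

text \<open>The polynomial has the same order as \<open>f\<close> at every point of the disc,
  including order 0 off the zeros. The quotient is thus free of zeros and, the disc being
  contractible, has a holomorphic logarithm.\<close>

lemma entire_zero_factorization:
  assumes f: "f holomorphic_on UNIV" and nz: "f z0 \<noteq> 0" and R: "R > 0"
  obtains Z h where "Z = {a \<in> ball 0 R. f a = 0}" "finite Z" "h holomorphic_on ball 0 R"
    "\<And>z. z \<in> ball 0 R \<Longrightarrow> f z = exp (h z) * (\<Prod>a\<in>Z. (z - a) ^ zero_config f a)"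
proof -
  define Z where "Z = {a \<in> ball 0 R. f a = 0}"
  define n where "n = zero_config f"
  define P where "P = (\<lambda>z. \<Prod>a\<in>Z. (z - a) ^ n a)"
  have finZ: "finite Z" unfolding Z_def by (rule finite_zeros_entire[OF f nz bounded_ball])
  have ord: "zorder f a > 0 \<and> int (n a) = zorder f a" if "f a = 0" for a
  proof -
    have "\<exists>w\<in>UNIV. f w \<noteq> 0" using nz by auto
    from zorder_exist_zero[OF f open_UNIV connected_UNIV _ this, of a]
    have "zorder f a > 0" using that by (auto split: if_splits)
    with that show ?thesis by (simp add: n_def zero_config_def)
  qed
  have fP: "f z = 0 \<longleftrightarrow> P z = 0" if "z \<in> ball 0 R" for z
  proof -
    have "P z = 0 \<longleftrightarrow> (\<exists>a\<in>Z. z = a \<and> n a > 0)"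
      using finZ by (auto simp: P_def)
    also have "\<dots> \<longleftrightarrow> f z = 0" using that ord[of z] by (auto simp: Z_def)
    finally show ?thesis by simp
  qed
  have holP: "P holomorphic_on S" for S unfolding P_def by (intro holomorphic_intros)
  have zo: "zorder P z = zorder f z" if z: "z \<in> ball 0 R" for z
  proof (cases "f z = 0")
    case True
    then have zZ: "z \<in> Z" using z by (simp add: Z_def)
    let ?g = "\<lambda>w. \<Prod>a\<in>Z - {z}. (w - a) ^ n a"
    have "zorder P z = int (n z)"
    proof (rule zorder_eqI[of UNIV _ ?g])
      show "?g holomorphic_on UNIV" by (intro holomorphic_intros)
      show "?g z \<noteq> 0" using finZ by auto
      show "P w = ?g w * (w - z) powi int (n z)" for w
        using prod.remove[OF finZ zZ, of "\<lambda>a. (w - a) ^ n a"] by (simp add: P_def)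
    qed auto
    then show ?thesis using ord[OF True] by simp
  next
    case False
    have "zorder g z = 0" if "g holomorphic_on ball 0 R" "g z \<noteq> 0" for g :: "complex \<Rightarrow> complex"
      by (rule zorder_eqI[of "ball 0 R" _ g]) (use z that in auto)
    then show ?thesis using False fP[OF z] holP holomorphic_on_subset[OF f] by auto
  qed
  obtain g where g: "g holomorphic_on ball 0 R" "\<And>z. z \<in> ball 0 R \<Longrightarrow> g z \<noteq> 0"
      "\<And>z. z \<in> ball 0 R \<Longrightarrow> f z = g z * P z"
    using holomorphic_zorder_factorization[of f "ball 0 R" P] fP zo holP holomorphic_on_subset[OF f]
    by (metis connected_ball open_ball subset_UNIV)
  obtain h where h: "h holomorphic_on ball 0 R" "\<And>z. z \<in> ball 0 R \<Longrightarrow> g z = exp (h z)"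
    using contractible_imp_holomorphic_log[OF g(1) _ g(2)] R
    by (metis convex_ball convex_imp_contractible)
  show ?thesis
  proof (rule that[OF Z_def finZ h(1)])
    show "f z = exp (h z) * (\<Prod>a\<in>Z. (z - a) ^ zero_config f a)" if "z \<in> ball 0 R" for z
      using g(3)[OF that] h(2)[OF that] by (simp add: P_def n_def)
  qed
qed

text \<open>The unknown factor \<open>exp h\<close> enters only through \<open>u\<close> and
  \<open>v\<close>, which are chosen before the radius. Being common to all circles inside the disc,
  they can be eliminated by linear conditions on the coefficients.\<close>

lemma circle_mean_log_entire:
  assumes f: "f holomorphic_on UNIV" and nz: "f z0 \<noteq> 0" and R: "R > 0"
  defines "Z \<equiv> {a \<in> ball 0 R. f a = 0}"
  obtains u :: real and v :: complex where
    "\<And>r. 0 < r \<Longrightarrow> r < R \<Longrightarrow> \<forall>z. cmod z = r \<longrightarrow> f z \<noteq> 0 \<Longrightarrow>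
       ((\<lambda>t. ln (cmod (f (of_real r * ucirc t)))) has_integral
          u + (\<Sum>a\<in>Z. real (zero_config f a) * ln (max r (cmod a)))) {0..1}"
    "\<And>r. 0 < r \<Longrightarrow> r < R \<Longrightarrow> \<forall>z. cmod z = r \<longrightarrow> f z \<noteq> 0 \<Longrightarrow>
       ((\<lambda>t. of_real (ln (cmod (f (of_real r * ucirc t)))) * ucirc t) has_integral
          of_real r * v - (\<Sum>a\<in>Z. of_nat (zero_config f a) *
             (of_real r * a / (2 * of_real (max r (cmod a))^2)))) {0..1}"
proof -
  obtain h where finZ: "finite Z" and h: "h holomorphic_on ball 0 R"
      and fac: "\<And>z. z \<in> ball 0 R \<Longrightarrow> f z = exp (h z) * (\<Prod>a\<in>Z. (z - a) ^ zero_config f a)"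
    by (metis Z_def entire_zero_factorization[OF f nz R])
  have key: "ln (cmod (f (of_real r * ucirc t))) = Re (h (of_real r * ucirc t)) +
          (\<Sum>a\<in>Z. real (zero_config f a) * ln (cmod (of_real r * ucirc t - a)))"
    if r: "0 < r" "r < R" and nzr: "\<forall>z. cmod z = r \<longrightarrow> f z \<noteq> 0" for r t
  proof -
    let ?z = "of_real r * ucirc t"
    have z: "cmod ?z = r" using r by (simp add: norm_mult)
    have "f ?z \<noteq> 0" using nzr z by blast
    then have nz': "?z \<noteq> a" if "a \<in> Z" for a using that by (auto simp: Z_def)
    have "ln (cmod (f ?z)) = ln (exp (Re (h ?z)) * (\<Prod>a\<in>Z. cmod (?z - a) ^ zero_config f a))"
      using fac[of ?z] z r by (simp add: norm_mult prod_norm[symmetric] norm_power)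
    also have "\<dots> = Re (h ?z) + ln (\<Prod>a\<in>Z. cmod (?z - a) ^ zero_config f a)"
    proof -
      have "(\<Prod>a\<in>Z. cmod (?z - a) ^ zero_config f a) > 0"
        by (intro prod_pos) (auto simp: nz')
      then show ?thesis by (simp add: ln_mult)
    qed
    also have "ln (\<Prod>a\<in>Z. cmod (?z - a) ^ zero_config f a) = (\<Sum>a\<in>Z. ln (cmod (?z - a) ^ zero_config f a))"
      by (rule ln_prod) (use finZ nz' in auto)
    also have "\<dots> = (\<Sum>a\<in>Z. real (zero_config f a) * ln (cmod (?z - a)))"
      by (intro sum.cong refl) (simp add: ln_realpow nz')
    finally show ?thesis .
  qed
  have ne: "cmod a \<noteq> r" if "\<forall>z. cmod z = r \<longrightarrow> f z \<noteq> 0" "a \<in> Z" for a r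
    using that by (auto simp: Z_def)
  have sub: "cball 0 r \<subseteq> ball (0::complex) R" if "r < R" for r using that by auto
  show ?thesis
  proof (rule that[of "Re (h 0)" "cnj (deriv h 0) / 2"])
    fix r assume r: "0 < r" "r < R" and nzr: "\<forall>z. cmod z = r \<longrightarrow> f z \<noteq> 0"
    note c = circle_mean_Re_holomorphic[OF h open_ball sub[OF r(2)] r(1)]
    note l = circle_mean_log_linear[OF r(1) ne[OF nzr]]
    show "((\<lambda>t. ln (cmod (f (of_real r * ucirc t)))) has_integral
          Re (h 0) + (\<Sum>a\<in>Z. real (zero_config f a) * ln (max r (cmod a)))) {0..1}"
      unfolding key[OF r nzr]
      by (intro has_integral_add c has_integral_sum finZ has_integral_mult_right l)
    have "((\<lambda>t. of_real (Re (h (of_real r * ucirc t))) * ucirc t +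
           (\<Sum>a\<in>Z. of_nat (zero_config f a) * (of_real (ln (cmod (of_real r * ucirc t - a))) * ucirc t)))
         has_integral of_real r * cnj (deriv h 0) / 2 +
           (\<Sum>a\<in>Z. of_nat (zero_config f a) * (- (of_real r * a / (2 * of_real (max r (cmod a))^2))))) {0..1}"
      by (intro has_integral_add c has_integral_sum finZ has_integral_mult_right l)
    then show "((\<lambda>t. of_real (ln (cmod (f (of_real r * ucirc t)))) * ucirc t) has_integral
          of_real r * (cnj (deriv h 0) / 2) - (\<Sum>a\<in>Z. of_nat (zero_config f a) *
             (of_real r * a / (2 * of_real (max r (cmod a))^2)))) {0..1}"
      unfolding key[OF r nzr]
      by (simp add: sum_negf distrib_right sum_distrib_right mult.assoc)
  qed
qed

text \<open>\<open>\<Sum> c k = 0\<close> eliminates the constant \<open>u\<close>, and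
  \<open>\<Sum> c k * k = 0\<close> eliminates the term \<open>r * v\<close>. The radius
  \<open>L + 1\<close> leaves all circles strictly inside the disc of the factorization.\<close>

lemma circle_mean_log_combination:
  fixes c :: "nat \<Rightarrow> real"
  assumes f: "f holomorphic_on UNIV" and nz: "f z0 \<noteq> 0"
    and K: "finite K" "K \<subseteq> {0<..L}"
    and nzK: "\<And>k z. k \<in> K \<Longrightarrow> cmod z = real k \<Longrightarrow> f z \<noteq> 0"
  defines "Z \<equiv> {a \<in> ball 0 (real L + 1). f a = 0}"
  shows "(\<Sum>k\<in>K. c k) = 0 \<Longrightarrow>
     ((\<lambda>t. \<Sum>k\<in>K. c k * ln (cmod (f (of_nat k * ucirc t)))) has_integral
       (\<Sum>a\<in>Z. real (zero_config f a) * (\<Sum>k\<in>K. c k * ln (max (real k) (cmod a))))) {0..1}"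
    and "(\<Sum>k\<in>K. c k * k) = 0 \<Longrightarrow>
     ((\<lambda>t. (\<Sum>k\<in>K. of_real (c k * ln (cmod (f (of_nat k * ucirc t))))) * ucirc t) has_integral
       - (\<Sum>a\<in>Z. of_nat (zero_config f a) * (a * of_real (\<Sum>k\<in>K. c k * k / (max (real k) (cmod a))^2))) / 2) {0..1}"
proof -
  obtain u :: real and v :: complex where
    u: "\<And>r. 0 < r \<Longrightarrow> r < real L + 1 \<Longrightarrow> \<forall>z. cmod z = r \<longrightarrow> f z \<noteq> 0 \<Longrightarrow>
       ((\<lambda>t. ln (cmod (f (of_real r * ucirc t)))) has_integral
          u + (\<Sum>a\<in>Z. real (zero_config f a) * ln (max r (cmod a)))) {0..1}"
    and v: "\<And>r. 0 < r \<Longrightarrow> r < real L + 1 \<Longrightarrow> \<forall>z. cmod z = r \<longrightarrow> f z \<noteq> 0 \<Longrightarrow>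
       ((\<lambda>t. of_real (ln (cmod (f (of_real r * ucirc t)))) * ucirc t) has_integral
          of_real r * v - (\<Sum>a\<in>Z. of_nat (zero_config f a) *
             (of_real r * a / (2 * of_real (max r (cmod a))^2)))) {0..1}"
    by (rule circle_mean_log_entire[OF f nz, of "real L + 1", folded Z_def]) auto
  show "((\<lambda>t. \<Sum>k\<in>K. c k * ln (cmod (f (of_nat k * ucirc t)))) has_integral
       (\<Sum>a\<in>Z. real (zero_config f a) * (\<Sum>k\<in>K. c k * ln (max (real k) (cmod a))))) {0..1}"
    if c: "(\<Sum>k\<in>K. c k) = 0"
  proof -
    have "((\<lambda>t. \<Sum>k\<in>K. c k * ln (cmod (f (of_nat k * ucirc t)))) has_integral
       (\<Sum>k\<in>K. c k * (u + (\<Sum>a\<in>Z. real (zero_config f a) * ln (max (real k) (cmod a)))))) {0..1}"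
      using u[of "real _"] K nzK
      by (intro has_integral_sum K has_integral_mult_right) (auto simp: subset_eq)
    also have "(\<Sum>k\<in>K. c k * (u + (\<Sum>a\<in>Z. real (zero_config f a) * ln (max (real k) (cmod a))))) =
       (\<Sum>k\<in>K. c k) * u + (\<Sum>a\<in>Z. real (zero_config f a) * (\<Sum>k\<in>K. c k * ln (max (real k) (cmod a))))"
      unfolding distrib_left sum.distrib sum_distrib_left sum_distrib_right
      by (subst sum.swap) (simp add: mult_ac)
    finally show ?thesis using c by simp
  qed
  show "((\<lambda>t. (\<Sum>k\<in>K. of_real (c k * ln (cmod (f (of_nat k * ucirc t))))) * ucirc t) has_integral
       - (\<Sum>a\<in>Z. of_nat (zero_config f a) * (a * of_real (\<Sum>k\<in>K. c k * k / (max (real k) (cmod a))^2))) / 2) {0..1}"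
    if c: "(\<Sum>k\<in>K. c k * k) = 0"
  proof -
    have "((\<lambda>t. \<Sum>k\<in>K. of_real (c k) * (of_real (ln (cmod (f (of_nat k * ucirc t)))) * ucirc t)) has_integral
       (\<Sum>k\<in>K. of_real (c k) * (of_nat k * v - (\<Sum>a\<in>Z. of_nat (zero_config f a) *
             (of_nat k * a / (2 * of_real (max (real k) (cmod a))^2)))))) {0..1}"
      using v[of "real _"] K nzK
      by (intro has_integral_sum K has_integral_mult_right) (auto simp: subset_eq)
    also have "(\<Sum>k\<in>K. of_real (c k) * (of_nat k * v - (\<Sum>a\<in>Z. of_nat (zero_config f a) *
             (of_nat k * a / (2 * of_real (max (real k) (cmod a))^2))))) =
       of_real (\<Sum>k\<in>K. c k * k) * v - (\<Sum>a\<in>Z. of_nat (zero_config f a) * (a * of_real (\<Sum>k\<in>K. c k * k / (max (real k) (cmod a))^2))) / 2"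
      unfolding right_diff_distrib sum_subtractf sum_distrib_left sum_distrib_right of_real_sum sum_divide_distrib
      by (subst sum.swap) (simp add: mult_ac)
    finally show ?thesis unfolding c by (simp add: sum_distrib_right mult.assoc)
  qed
qed

section \<open>Gaussian integrals\<close>

lemma lborel_complex: "lborel = distr (lborel \<Otimes>\<^sub>M lborel) borel (\<lambda>(x, y). Complex x y)"
proof (rule lborel_eqI)
  have [measurable]: "(\<lambda>(x, y). Complex x y) \<in> borel_measurable (lborel \<Otimes>\<^sub>M lborel)"
    unfolding Complex_eq by measurable
  fix l u :: complex assume le: "\<And>b. b \<in> Basis \<Longrightarrow> l \<bullet> b \<le> u \<bullet> b"
  have vim: "(\<lambda>(x, y). Complex x y) -` box l u \<inter> space (lborel \<Otimes>\<^sub>M lborel)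
      = {Re l<..<Re u} \<times> {Im l<..<Im u}"
    by (auto simp: space_pair_measure in_box_complex_iff)
  show "emeasure (distr (lborel \<Otimes>\<^sub>M lborel) borel (\<lambda>(x, y). Complex x y)) (box l u)
      = ennreal (\<Prod>b\<in>Basis. (u - l) \<bullet> b)"
    using le[of 1] le[of \<i>]
    by (subst emeasure_distr)
       (auto simp: vim lborel.emeasure_pair_measure_Times Basis_complex_def ennreal_mult inner_complex_def)
qed simp

lemma nn_integral_lborel_complex:
  assumes [measurable]: "f \<in> borel_measurable borel"
  shows "(\<integral>\<^sup>+z. f z \<partial>lborel) = (\<integral>\<^sup>+x. \<integral>\<^sup>+y. f (Complex x y) \<partial>lborel \<partial>lborel)"
proof -
  have [measurable]: "(\<lambda>(x, y). Complex x y) \<in> borel_measurable (lborel \<Otimes>\<^sub>M lborel)"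
    unfolding Complex_eq by measurable
  have m: "(\<lambda>(x, y). f (Complex x y)) \<in> borel_measurable (lborel \<Otimes>\<^sub>M lborel)"
    using measurable_compose[OF \<open>(\<lambda>(x, y). Complex x y) \<in> _\<close> assms] by (simp add: split_beta')
  show ?thesis
    by (subst lborel_complex, subst nn_integral_distr)
       (use lborel.nn_integral_fst[OF m] in \<open>auto simp: split_beta'\<close>)
qed

text \<open>Completing the square: up to a factor the integrand is the normal density with mean
  \<open>b / (2 * a)\<close> and variance \<open>1 / (2 * a)\<close>.\<close>

lemma nn_integral_gaussian:
  fixes a b :: real assumes a: "a > 0"
  shows "(\<integral>\<^sup>+x. ennreal (exp (- a * x\<^sup>2 + b * x)) \<partial>lborel) = ennreal (sqrt (pi / a) * exp (b\<^sup>2 / (4 * a)))"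
proof -
  define \<sigma> where "\<sigma> = 1 / sqrt (2 * a)"
  have \<sigma>: "\<sigma> > 0" "\<sigma>^2 = 1 / (2 * a)" using a by (auto simp: \<sigma>_def power_divide)
  have "exp (- a * x\<^sup>2 + b * x) = (sqrt (pi / a) * exp (b\<^sup>2 / (4 * a))) * normal_density (b / (2 * a)) \<sigma> x" for x
  proof -
    have "- a * x\<^sup>2 + b * x = b\<^sup>2 / (4 * a) + - (x - b / (2 * a))\<^sup>2 / (2 * \<sigma>\<^sup>2)"
    proof -
      have "- (x - b / (2 * a))\<^sup>2 / (2 * \<sigma>\<^sup>2) = - (x - b / (2 * a))\<^sup>2 * a"
        using a by (simp add: \<sigma>(2))
      show ?thesis unfolding \<open>- (x - b / (2 * a))\<^sup>2 / (2 * \<sigma>\<^sup>2) = - (x - b / (2 * a))\<^sup>2 * a\<close>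
        using a by (simp add: power2_eq_square field_simps)
    qed
    then have "exp (- a * x\<^sup>2 + b * x) = exp (b\<^sup>2 / (4 * a)) * exp (- (x - b / (2 * a))\<^sup>2 / (2 * \<sigma>\<^sup>2))"
      by (simp only: exp_add)
    moreover have "sqrt (2 * pi * \<sigma>\<^sup>2) = sqrt (pi / a)" "sqrt (pi / a) > 0"
      using a by (auto simp: \<sigma>(2))
    ultimately show ?thesis using a by (simp add: normal_density_def)
  qed
  then have "(\<integral>\<^sup>+x. ennreal (exp (- a * x\<^sup>2 + b * x)) \<partial>lborel) =
     (\<integral>\<^sup>+x. ennreal (sqrt (pi / a) * exp (b\<^sup>2 / (4 * a))) * ennreal (normal_density (b / (2 * a)) \<sigma> x) \<partial>lborel)"
    using a by (simp add: ennreal_mult)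
  also have "\<dots> = ennreal (sqrt (pi / a) * exp (b\<^sup>2 / (4 * a))) * (\<integral>\<^sup>+x. ennreal (normal_density (b / (2 * a)) \<sigma> x) \<partial>lborel)"
    by (rule nn_integral_cmult) simp
  also have "(\<integral>\<^sup>+x. ennreal (normal_density (b / (2 * a)) \<sigma> x) \<partial>lborel) = 1"
    using \<sigma> by (subst nn_integral_eq_integral) auto
  finally show ?thesis by simp
qed

lemma nn_integral_gaussian_complex:
  fixes a :: real and b :: complex assumes a: "a > 0"
  shows "(\<integral>\<^sup>+z. ennreal (exp (- a * (cmod z)\<^sup>2 + Re (b * z)) / pi) \<partial>lborel) = ennreal (exp ((cmod b)\<^sup>2 / (4 * a)) / a)"
proof -
  have "ennreal (exp (- a * (cmod (Complex x y))\<^sup>2 + Re (b * Complex x y)) / pi)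
      = ennreal (exp (- a * x\<^sup>2 + Re b * x) / pi) * ennreal (exp (- a * y\<^sup>2 + (- Im b) * y))" for x y
    by (subst ennreal_mult[symmetric]) (auto simp: cmod_power2 exp_add[symmetric] algebra_simps)
  then have "(\<integral>\<^sup>+z. ennreal (exp (- a * (cmod z)\<^sup>2 + Re (b * z)) / pi) \<partial>lborel) =
     (\<integral>\<^sup>+x. \<integral>\<^sup>+y. ennreal (exp (- a * x\<^sup>2 + Re b * x) / pi) * ennreal (exp (- a * y\<^sup>2 + (- Im b) * y)) \<partial>lborel \<partial>lborel)"
    by (subst nn_integral_lborel_complex) auto
  also have "\<dots> = (\<integral>\<^sup>+x. ennreal (1 / pi) * ennreal (exp (- a * x\<^sup>2 + Re b * x)) \<partial>lborel) * ennreal (sqrt (pi / a) * exp ((- Im b)\<^sup>2 / (4 * a)))"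
  proof -
    have "(\<integral>\<^sup>+y. ennreal (exp (- a * x\<^sup>2 + Re b * x) / pi) * ennreal (exp (- a * y\<^sup>2 + (- Im b) * y)) \<partial>lborel)
      = ennreal (1 / pi) * ennreal (exp (- a * x\<^sup>2 + Re b * x)) * ennreal (sqrt (pi / a) * exp ((- Im b)\<^sup>2 / (4 * a)))" for x
    proof -
      have "ennreal (exp E / pi) = ennreal (1 / pi) * ennreal (exp E)" for E
        by (simp add: ennreal_mult[symmetric])
      then show ?thesis
        by (subst nn_integral_cmult) (auto simp only: nn_integral_gaussian[OF a], auto)
    qed
    then show ?thesis by (simp only: nn_integral_multc) (subst nn_integral_multc, auto)
  qed
  also have "\<dots> = ennreal (1 / pi) * ennreal (sqrt (pi / a) * exp ((Re b)\<^sup>2 / (4 * a))) * ennreal (sqrt (pi / a) * exp ((- Im b)\<^sup>2 / (4 * a)))"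
    using nn_integral_cmult[of "\<lambda>x. ennreal (exp (- a * x\<^sup>2 + Re b * x))" lborel "ennreal (1 / pi)"]
    by (simp only: nn_integral_gaussian[OF a]) simp
  also have "\<dots> = ennreal (1 / pi * (sqrt (pi / a) * exp ((Re b)\<^sup>2 / (4 * a))) * (sqrt (pi / a) * exp ((- Im b)\<^sup>2 / (4 * a))))"
  proof -
    have "ennreal p * ennreal q * ennreal r = ennreal (p * q * r)" if "p \<ge> 0" "q \<ge> 0" "r \<ge> 0" for p q r :: real
      using that by (simp add: ennreal_mult)
    then show ?thesis using a by simp
  qed
  also have "1 / pi * (sqrt (pi / a) * exp ((Re b)\<^sup>2 / (4 * a))) * (sqrt (pi / a) * exp ((- Im b)\<^sup>2 / (4 * a)))
     = 1 / pi * (sqrt (pi / a) * sqrt (pi / a)) * (exp ((Re b)\<^sup>2 / (4 * a)) * exp ((Im b)\<^sup>2 / (4 * a)))"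
    by (simp only: power2_minus mult_ac)
  also have "\<dots> = exp ((cmod b)\<^sup>2 / (4 * a)) / a"
  proof -
    have "sqrt (pi / a) * sqrt (pi / a) = pi / a" using a by simp
    show ?thesis unfolding \<open>sqrt (pi / a) * sqrt (pi / a) = pi / a\<close>
      by (simp add: exp_add[symmetric] cmod_power2 add_divide_distrib)
  qed
  finally show ?thesis .
qed

section \<open>The standard complex normal law: exponential moments and characteristic
  function\<close>

definition std_complex_normal :: "complex measure" where
  "std_complex_normal = density lborel (\<lambda>z. ennreal (std_complex_normal_density z))"

lemma std_complex_normal_density_measurable [measurable]:
  "std_complex_normal_density \<in> borel_measurable borel"
  unfolding std_complex_normal_density_def[abs_def] by measurable

lemma std_complex_normal_density_nonneg [simp]: "std_complex_normal_density z \<ge> 0"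
  by (simp add: std_complex_normal_density_def)

lemma sets_std_complex_normal [simp, measurable_cong]: "sets std_complex_normal = sets borel"
  by (simp add: std_complex_normal_def)

lemma space_std_complex_normal [simp]: "space std_complex_normal = UNIV"
  by (simp add: std_complex_normal_def)

text \<open>The range \<open>s > -1\<close> includes negative values: \<open>s = -1/2\<close> bounds
  the first absolute moment of the coefficients.\<close>

lemma nn_integral_std_complex_normal_exp:
  fixes b :: complex assumes s: "s > -1"
  shows "(\<integral>\<^sup>+z. ennreal (exp (- s * (cmod z)\<^sup>2 + Re (b * z))) \<partial>std_complex_normal)
    = ennreal (exp ((cmod b)\<^sup>2 / (4 * (1 + s))) / (1 + s))"
proof -
  have "(\<integral>\<^sup>+z. ennreal (exp (- s * (cmod z)\<^sup>2 + Re (b * z))) \<partial>std_complex_normal) =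
     (\<integral>\<^sup>+z. ennreal (exp (- (1 + s) * (cmod z)\<^sup>2 + Re (b * z)) / pi) \<partial>lborel)"
    unfolding std_complex_normal_def
    by (subst nn_integral_density)
       (auto simp: std_complex_normal_density_def ennreal_mult[symmetric] exp_add[symmetric] algebra_simps
          intro!: nn_integral_cong)
  then show ?thesis using nn_integral_gaussian_complex[of "1 + s" b] s by simp
qed

interpretation std_complex_normal: prob_space std_complex_normal
  by (rule prob_spaceI) (use nn_integral_std_complex_normal_exp[of 0 0] in simp)

text \<open>The known characteristic function of the real standard normal law, rescaled by
  \<open>sqrt 2\<close> to variance 1/2.\<close>

lemma integral_iexp_gaussian:
  "(\<integral>x. of_real (exp (- x\<^sup>2) / sqrt pi) * exp (\<i> * of_real (t * x)) \<partial>lborel) = complex_of_real (exp (- t\<^sup>2 / 4))"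
proof -
  have "complex_of_real (exp (- t\<^sup>2 / 4)) = char std_normal_distribution (t / sqrt 2)"
    by (simp add: char_std_normal_distribution power_divide)
  also have "\<dots> = (\<integral>x. std_normal_density x *\<^sub>R exp (\<i> * of_real (t / sqrt 2 * x)) \<partial>lborel)"
    unfolding char_def by (subst integral_density) auto
  also have "\<dots> = (1 / sqrt 2) *\<^sub>R (\<integral>x. of_real (exp (- (x / sqrt 2)\<^sup>2) / sqrt pi) * exp (\<i> * of_real (t * (x / sqrt 2))) \<partial>lborel)"
    unfolding integral_scaleR_right[symmetric]
    by (intro Bochner_Integration.integral_cong refl)
       (simp add: std_normal_density_def scaleR_conv_of_real power_divide real_sqrt_mult field_simps)
  also have "\<dots> = (\<integral>x. of_real (exp (- x\<^sup>2) / sqrt pi) * exp (\<i> * of_real (t * x)) \<partial>lborel)"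
    by (subst (2) lborel_integral_real_affine[where c = "1 / sqrt 2" and t = 0]) auto
  finally show ?thesis by simp
qed

lemma char_std_complex_normal:
  "(\<integral>z. exp (\<i> * of_real (Re (u * z))) \<partial>std_complex_normal) = complex_of_real (exp (- (cmod u)\<^sup>2 / 4))"
proof -
  define F where "F = (\<lambda>t x. complex_of_real (exp (- x\<^sup>2) / sqrt pi) * exp (\<i> * of_real (t * x)))"
  define g where "g = (\<lambda>z. std_complex_normal_density z *\<^sub>R exp (\<i> * of_real (Re (u * z))))"
  have [measurable]: "(\<lambda>(x, y). Complex x y) \<in> borel_measurable (lborel \<Otimes>\<^sub>M lborel)"
    unfolding Complex_eq by measurable
  have [measurable]: "g \<in> borel_measurable borel" unfolding g_def by measurable
  have "integrable std_complex_normal (\<lambda>z. exp (\<i> * of_real (Re (u * z))))"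
    by (rule std_complex_normal.integrable_const_bound[of _ 1]) auto
  then have "integrable lborel g"
    unfolding std_complex_normal_def g_def by (subst (asm) integrable_density) auto
  then have "integrable (distr (lborel \<Otimes>\<^sub>M lborel) borel (\<lambda>(x, y). Complex x y)) g"
    by (subst (asm) lborel_complex)
  then have int: "integrable (lborel \<Otimes>\<^sub>M lborel) (\<lambda>p. g ((\<lambda>(x, y). Complex x y) p))"
    by (subst (asm) integrable_distr_eq) auto
  \<comment> \<open>\<open>Re (u * z) = Re u * x - Im u * y\<close>, so density and phase both
    factor over the two coordinates.\<close>
  have g: "g (Complex x y) = F (Re u) x * F (- Im u) y" for x y
    by (simp add: g_def F_def std_complex_normal_density_def scaleR_conv_of_real cmod_power2
        exp_add[symmetric] exp_of_real[symmetric] algebra_simps flip: of_real_mult)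
  have "(\<integral>z. exp (\<i> * of_real (Re (u * z))) \<partial>std_complex_normal) = (\<integral>z. g z \<partial>lborel)"
    unfolding std_complex_normal_def g_def by (subst integral_density) auto
  also have "\<dots> = (\<integral>p. g ((\<lambda>(x, y). Complex x y) p) \<partial>(lborel \<Otimes>\<^sub>M lborel))"
    by (subst lborel_complex, subst integral_distr) auto
  also have "\<dots> = (\<integral>x. \<integral>y. g (Complex x y) \<partial>lborel \<partial>lborel)"
    using lborel_pair.integral_fst'[OF int] by simp
  also have "\<dots> = (\<integral>x. F (Re u) x \<partial>lborel) * (\<integral>y. F (- Im u) y \<partial>lborel)"
    unfolding g by simp
  also have "\<dots> = complex_of_real (exp (- (Re u)\<^sup>2 / 4)) * of_real (exp (- (- Im u)\<^sup>2 / 4))"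
    unfolding F_def integral_iexp_gaussian ..
  also have "\<dots> = of_real (exp (- (cmod u)\<^sup>2 / 4))"
    by (simp add: cmod_power2 exp_add[symmetric] add_divide_distrib flip: of_real_mult)
  finally show ?thesis .
qed

lemma borel_measurable_cnj [measurable]: "cnj \<in> borel_measurable borel"
  by (intro borel_measurable_continuous_onI continuous_intros)

text \<open>For fixed second component the exponent is quadratic plus linear in the first one, so
  two applications of the one-variable formula suffice.\<close>

lemma gaussian_pair_integral:
  fixes \<rho> :: complex
  assumes s: "s \<ge> 0" and \<rho>: "cmod \<rho> \<le> 1"
  shows "(\<integral>p. exp (- s * ((cmod (fst p))\<^sup>2 + (cmod (snd p))\<^sup>2 + 2 * Re (fst p * cnj (snd p) * \<rho>)))
      \<partial>(std_complex_normal \<Otimes>\<^sub>M std_complex_normal)) = 1 / ((1 + s)\<^sup>2 - s\<^sup>2 * (cmod \<rho>)\<^sup>2)"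
proof -
  let ?\<mu> = std_complex_normal
  define F where "F = (\<lambda>G H. exp (- s * ((cmod G)\<^sup>2 + (cmod H)\<^sup>2 + 2 * Re (G * cnj H * \<rho>))))"
  have [measurable]: "(\<lambda>p. F (fst p) (snd p)) \<in> borel_measurable (?\<mu> \<Otimes>\<^sub>M ?\<mu>)"
    unfolding F_def by measurable
  have m2 [measurable]: "(\<lambda>p. F (snd p) (fst p)) \<in> borel_measurable (?\<mu> \<Otimes>\<^sub>M ?\<mu>)"
    unfolding F_def by measurable
  \<comment> \<open>The exponent left for \<open>H\<close> after \<open>G\<close> has been
    integrated out. It is nonnegative because \<open>cmod \<rho> \<le> 1\<close>, and
    \<open>(1 + s) * (1 + s')\<close> is the denominator in the claim.\<close>
  define s' where "s' = s - s\<^sup>2 * (cmod \<rho>)\<^sup>2 / (1 + s)"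
  have s': "s' \<ge> 0"
  proof -
    have "s\<^sup>2 * (cmod \<rho>)\<^sup>2 \<le> s\<^sup>2 * 1"
      using \<rho> by (intro mult_left_mono power_le_one) auto
    also have "\<dots> \<le> s * (1 + s)" using s by (simp add: power2_eq_square distrib_left)
    finally have "s\<^sup>2 * (cmod \<rho>)\<^sup>2 \<le> s * (1 + s)" .
    then show ?thesis using s by (simp add: s'_def field_simps)
  qed
  have inner: "(\<integral>\<^sup>+G. ennreal (F G H) \<partial>?\<mu>) = ennreal (1 / (1 + s)) * ennreal (exp (- s' * (cmod H)\<^sup>2 + Re (0 * H)))" for H
  proof -
    define b where "b = - 2 * of_real s * \<rho> * cnj H"
    have b: "(cmod b)\<^sup>2 = 4 * s\<^sup>2 * (cmod \<rho>)\<^sup>2 * (cmod H)\<^sup>2"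
      using s by (simp add: b_def norm_mult power_mult_distrib)
    have "F G H = exp (- s * (cmod H)\<^sup>2) * exp (- s * (cmod G)\<^sup>2 + Re (b * G))" for G
      unfolding F_def b_def mult_exp_exp by (simp add: algebra_simps)
    then have "(\<integral>\<^sup>+G. ennreal (F G H) \<partial>?\<mu>) =
        ennreal (exp (- s * (cmod H)\<^sup>2)) * (\<integral>\<^sup>+G. ennreal (exp (- s * (cmod G)\<^sup>2 + Re (b * G))) \<partial>?\<mu>)"
      by (subst nn_integral_cmult[symmetric]) (auto simp: ennreal_mult)
    also have "\<dots> = ennreal (exp (- s * (cmod H)\<^sup>2) * (exp ((cmod b)\<^sup>2 / (4 * (1 + s))) / (1 + s)))"
      using s by (subst nn_integral_std_complex_normal_exp) (auto simp: ennreal_mult[symmetric])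
    also have "exp (- s * (cmod H)\<^sup>2) * (exp ((cmod b)\<^sup>2 / (4 * (1 + s))) / (1 + s)) =
        1 / (1 + s) * exp (- s' * (cmod H)\<^sup>2 + Re (0 * H))"
    proof -
      have "- s * (cmod H)\<^sup>2 + (cmod b)\<^sup>2 / (4 * (1 + s)) = - s' * (cmod H)\<^sup>2 + Re (0 * H)"
        using s by (simp add: b s'_def field_simps)
      then show ?thesis by (simp add: mult_exp_exp[symmetric] flip: times_divide_eq_right) (simp add: mult_exp_exp)
    qed
    finally show ?thesis using s by (simp add: ennreal_mult[symmetric])
  qed
  have "(\<integral>\<^sup>+p. ennreal (F (snd p) (fst p)) \<partial>(?\<mu> \<Otimes>\<^sub>M ?\<mu>)) = (\<integral>\<^sup>+H. \<integral>\<^sup>+G. ennreal (F G H) \<partial>?\<mu> \<partial>?\<mu>)"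
    by (subst std_complex_normal.nn_integral_fst[symmetric]) auto
  also have "\<dots> = ennreal (1 / (1 + s)) * (\<integral>\<^sup>+H. ennreal (exp (- s' * (cmod H)\<^sup>2 + Re (0 * H))) \<partial>?\<mu>)"
    unfolding inner by (rule nn_integral_cmult) auto
  also have "\<dots> = ennreal (1 / (1 + s)) * ennreal (1 / (1 + s'))"
    using s' by (subst nn_integral_std_complex_normal_exp) auto
  also have "\<dots> = ennreal (1 / ((1 + s) * (1 + s')))"
    using s s' by (simp add: ennreal_mult[symmetric])
  also have "(1 + s) * (1 + s') = (1 + s)\<^sup>2 - s\<^sup>2 * (cmod \<rho>)\<^sup>2"
    using s by (simp add: s'_def power2_eq_square field_simps)
  finally have *: "(\<integral>\<^sup>+p. ennreal (F (snd p) (fst p)) \<partial>(?\<mu> \<Otimes>\<^sub>M ?\<mu>)) = ennreal (1 / ((1 + s)\<^sup>2 - s\<^sup>2 * (cmod \<rho>)\<^sup>2))" .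
  \<comment> \<open>The iterated integral had \<open>G\<close> as inner variable and thus as second
    component; swapping the components restores the stated order.\<close>
  interpret P: pair_sigma_finite ?\<mu> ?\<mu> ..
  have "(\<integral>\<^sup>+p. ennreal (F (fst p) (snd p)) \<partial>(?\<mu> \<Otimes>\<^sub>M ?\<mu>)) = (\<integral>\<^sup>+p. ennreal (F (snd p) (fst p)) \<partial>(?\<mu> \<Otimes>\<^sub>M ?\<mu>))"
    by (subst P.distr_pair_swap, subst nn_integral_distr) (auto simp: split_beta')
  with * have "(\<integral>\<^sup>+p. ennreal (F (fst p) (snd p)) \<partial>(?\<mu> \<Otimes>\<^sub>M ?\<mu>)) = ennreal (1 / ((1 + s)\<^sup>2 - s\<^sup>2 * (cmod \<rho>)\<^sup>2))"
    by simp
  moreover have "1 / ((1 + s)\<^sup>2 - s\<^sup>2 * (cmod \<rho>)\<^sup>2) \<ge> 0"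
    unfolding \<open>(1 + s) * (1 + s') = _\<close>[symmetric] using s s' by simp
  ultimately have "(\<integral>p. F (fst p) (snd p) \<partial>(?\<mu> \<Otimes>\<^sub>M ?\<mu>)) = 1 / ((1 + s)\<^sup>2 - s\<^sup>2 * (cmod \<rho>)\<^sup>2)"
    by (subst integral_eq_nn_integral) (auto simp: F_def)
  then show ?thesis unfolding F_def .
qed

text \<open>
  Since \<open>exp (-s |x|\<^sup>2)\<close> is the average of \<open>exp (\<i> Re (2 sqrt s G x))\<close> over a standard Gaussian \<open>G\<close>, only the
  characteristic function of the pair is needed, not its law.
\<close>

lemma (in prob_space) laplace_gaussian_pair:
  fixes X Y :: "'a \<Rightarrow> complex" and \<rho> :: complex
  assumes [measurable]: "X \<in> borel_measurable M" "Y \<in> borel_measurable M"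
    and char: "\<And>\<alpha> \<beta>. expectation (\<lambda>\<omega>. exp (\<i> * of_real (Re (\<alpha> * X \<omega> + \<beta> * Y \<omega>))))
        = complex_of_real (exp (- ((cmod \<alpha>)\<^sup>2 + (cmod \<beta>)\<^sup>2 + 2 * Re (\<alpha> * cnj \<beta> * \<rho>)) / 4))"
    and s: "s \<ge> 0" and \<rho>: "cmod \<rho> \<le> 1"
  shows "expectation (\<lambda>\<omega>. exp (- s * ((cmod (X \<omega>))\<^sup>2 + (cmod (Y \<omega>))\<^sup>2))) = 1 / ((1 + s)\<^sup>2 - s\<^sup>2 * (cmod \<rho>)\<^sup>2)"
proof -
  let ?\<mu> = std_complex_normal
  interpret \<mu>2: prob_space "?\<mu> \<Otimes>\<^sub>M ?\<mu>" by (rule prob_space_pair) unfold_locales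
  interpret P: pair_prob_space M "?\<mu> \<Otimes>\<^sub>M ?\<mu>" ..
  interpret Q: pair_prob_space ?\<mu> ?\<mu> ..
  define q where "q = complex_of_real (2 * sqrt s)"
  have q: "(cmod (q * z))\<^sup>2 / 4 = s * (cmod z)\<^sup>2" for z
    using s by (simp add: q_def norm_mult power_mult_distrib)
  define E where "E = (\<lambda>u :: complex. exp (\<i> * of_real (Re u)))"
  have E_add: "E (u + v) = E u * E v" for u v by (simp add: E_def distrib_left exp_add)
  have [measurable]: "E \<in> borel_measurable borel" unfolding E_def by measurable
  have norm_E: "norm (E u) = 1" for u by (simp add: E_def)
  have *: "complex_of_real (exp (- s * ((cmod x)\<^sup>2 + (cmod y)\<^sup>2)))
      = (\<integral>p. E (q * fst p * x + q * snd p * y) \<partial>(?\<mu> \<Otimes>\<^sub>M ?\<mu>))" for x y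
  proof -
    have one: "(\<integral>G. E (q * G * z) \<partial>?\<mu>) = complex_of_real (exp (- s * (cmod z)\<^sup>2))" for z
      using char_std_complex_normal[of "q * z"] q[of z] by (simp add: E_def mult_ac)
    have "integrable (?\<mu> \<Otimes>\<^sub>M ?\<mu>) (\<lambda>p. E (q * fst p * x + q * snd p * y))"
      by (rule \<mu>2.integrable_const_bound[of _ 1]) (auto simp: norm_E)
    from Q.integral_fst'[OF this]
    have "(\<integral>p. E (q * fst p * x + q * snd p * y) \<partial>(?\<mu> \<Otimes>\<^sub>M ?\<mu>)) = (\<integral>G. \<integral>H. E (q * G * x) * E (q * H * y) \<partial>?\<mu> \<partial>?\<mu>)"
      by (simp add: E_add)
    also have "\<dots> = complex_of_real (exp (- s * (cmod x)\<^sup>2)) * of_real (exp (- s * (cmod y)\<^sup>2))"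
      by (simp only: integral_mult_right_zero integral_mult_left_zero one)
    finally show ?thesis by (simp add: distrib_left exp_add[symmetric] flip: of_real_mult)
  qed
  have "complex_of_real (expectation (\<lambda>\<omega>. exp (- s * ((cmod (X \<omega>))\<^sup>2 + (cmod (Y \<omega>))\<^sup>2))))
      = (\<integral>\<omega>. \<integral>p. E (q * fst p * X \<omega> + q * snd p * Y \<omega>) \<partial>(?\<mu> \<Otimes>\<^sub>M ?\<mu>) \<partial>M)"
    unfolding integral_complex_of_real[symmetric] * ..
  \<comment> \<open>After the swap the inner integral is the characteristic function of the pair at
    \<open>\<alpha> = q * fst p\<close>, \<open>\<beta> = q * snd p\<close>, and the outer one is
    \<open>gaussian_pair_integral\<close>.\<close>
  also have "\<dots> = (\<integral>p. \<integral>\<omega>. E (q * fst p * X \<omega> + q * snd p * Y \<omega>) \<partial>M \<partial>(?\<mu> \<Otimes>\<^sub>M ?\<mu>))"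
  proof (rule P.Fubini_integral[symmetric])
    show "integrable (M \<Otimes>\<^sub>M (?\<mu> \<Otimes>\<^sub>M ?\<mu>)) (\<lambda>(\<omega>, p). E (q * fst p * X \<omega> + q * snd p * Y \<omega>))"
      by (rule P.integrable_const_bound[of _ 1]) (auto simp: norm_E split_beta')
  qed
  also have "\<dots> = (\<integral>p. complex_of_real (exp (- s * ((cmod (fst p))\<^sup>2 + (cmod (snd p))\<^sup>2 + 2 * Re (fst p * cnj (snd p) * \<rho>))))
      \<partial>(?\<mu> \<Otimes>\<^sub>M ?\<mu>))"
  proof (rule Bochner_Integration.integral_cong[OF refl])
    fix p :: "complex \<times> complex"
    have "q * cnj q = of_real (4 * s)" using s by (simp add: q_def power2_eq_square[symmetric] flip: of_real_mult of_real_power)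
    then have "q * fst p * cnj (q * snd p) * \<rho> = of_real (4 * s) * (fst p * cnj (snd p) * \<rho>)"
      by (simp add: mult_ac)
    then have "Re (q * fst p * cnj (q * snd p) * \<rho>) = 4 * s * Re (fst p * cnj (snd p) * \<rho>)"
      by (simp only: Re_complex_of_real Im_complex_of_real times_complex.sel mult_zero_left diff_zero)
    then show "(\<integral>\<omega>. E (q * fst p * X \<omega> + q * snd p * Y \<omega>) \<partial>M) =
       complex_of_real (exp (- s * ((cmod (fst p))\<^sup>2 + (cmod (snd p))\<^sup>2 + 2 * Re (fst p * cnj (snd p) * \<rho>))))"
      unfolding E_def char[of "q * fst p" "q * snd p"]
      using q[of "fst p"] q[of "snd p"] by (simp add: algebra_simps add_divide_distrib diff_divide_distrib)
  qed
  also have "\<dots> = complex_of_real (1 / ((1 + s)\<^sup>2 - s\<^sup>2 * (cmod \<rho>)\<^sup>2))"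
    unfolding integral_complex_of_real gaussian_pair_integral[OF s \<rho>] ..
  finally show ?thesis by (simp only: of_real_eq_iff)
qed

section \<open>The planar Gaussian analytic function\<close>

locale gaf_process = prob_space M for M :: "'w measure" +
  fixes \<xi> :: "nat \<Rightarrow> 'w \<Rightarrow> complex"
  assumes indep: "indep_vars (\<lambda>_. borel) \<xi> UNIV"
    and distr_density: "\<And>k. distributed M lborel (\<xi> k) (\<lambda>z. ennreal (std_complex_normal_density z))"
begin

lemma measurable_xi [measurable]: "\<xi> k \<in> borel_measurable M"
  using distributed_measurable[OF distr_density] by simp

lemma distr_xi: "distr M borel (\<xi> k) = std_complex_normal"
proof -
  have "distr M borel (\<xi> k) = distr M lborel (\<xi> k)" by (rule distr_cong) auto
  also have "\<dots> = std_complex_normal"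
    using distributed_distr_eq_density[OF distr_density] by (simp add: std_complex_normal_def)
  finally show ?thesis .
qed

text \<open>\<open>cmod z \<le> exp ((cmod z)^2 / 2)\<close>, and the exponential has integral
  \<open>1 / (1 - 1/2) = 2\<close>. What matters is that the bound is uniform in
  \<open>k\<close>.\<close>

lemma nn_integral_norm_xi: "(\<integral>\<^sup>+\<omega>. ennreal (cmod (\<xi> k \<omega>)) \<partial>M) \<le> 2"
proof -
  have "(\<integral>\<^sup>+\<omega>. ennreal (cmod (\<xi> k \<omega>)) \<partial>M) = (\<integral>\<^sup>+z. ennreal (cmod z) \<partial>std_complex_normal)"
    unfolding distr_xi[of k, symmetric] by (subst nn_integral_distr) auto
  also have "\<dots> \<le> (\<integral>\<^sup>+z. ennreal (exp (- (- 1 / 2) * (cmod z)\<^sup>2 + Re (0 * z))) \<partial>std_complex_normal)"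
  proof (intro nn_integral_mono ennreal_leI)
    fix z :: complex
    have "0 \<le> (cmod z - 1)\<^sup>2" by simp
    then have "cmod z \<le> 1 + (cmod z)\<^sup>2 / 2" by (simp add: power2_diff)
    also have "\<dots> \<le> exp ((cmod z)\<^sup>2 / 2)" by (rule exp_ge_add_one_self)
    finally show "cmod z \<le> exp (- (- 1 / 2) * (cmod z)\<^sup>2 + Re (0 * z))" by simp
  qed
  also have "\<dots> = 2" by (subst nn_integral_std_complex_normal_exp) auto
  finally show ?thesis .
qed

text \<open>The sum has finite expectation, hence is finite almost surely.\<close>

lemma AE_summable_xi:
  assumes c: "summable c" "\<And>k. c k \<ge> (0::real)"
  shows "AE \<omega> in M. summable (\<lambda>k. cmod (\<xi> k \<omega>) * c k)"
proof -
  have "(\<integral>\<^sup>+\<omega>. (\<Sum>k. ennreal (cmod (\<xi> k \<omega>) * c k)) \<partial>M) = (\<Sum>k. \<integral>\<^sup>+\<omega>. ennreal (cmod (\<xi> k \<omega>) * c k) \<partial>M)"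
    by (rule nn_integral_suminf) auto
  also have "\<dots> \<le> (\<Sum>k. ennreal (2 * c k))"
  proof (rule suminf_le)
    fix k
    have "(\<integral>\<^sup>+\<omega>. ennreal (cmod (\<xi> k \<omega>) * c k) \<partial>M) = (\<integral>\<^sup>+\<omega>. ennreal (cmod (\<xi> k \<omega>)) \<partial>M) * ennreal (c k)"
      using c by (subst nn_integral_multc[symmetric]) (auto simp: ennreal_mult)
    also have "\<dots> \<le> 2 * ennreal (c k)" by (intro mult_right_mono nn_integral_norm_xi) auto
    finally show "(\<integral>\<^sup>+\<omega>. ennreal (cmod (\<xi> k \<omega>) * c k) \<partial>M) \<le> ennreal (2 * c k)"
      using c by (simp add: ennreal_mult)
  qed auto
  also have "\<dots> < \<infinity>"
    using c by (subst suminf_ennreal_eq[OF _ summable_sums]) (auto intro: summable_mult)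
  finally have "AE \<omega> in M. (\<Sum>k. ennreal (cmod (\<xi> k \<omega>) * c k)) \<noteq> \<infinity>"
    by (intro nn_integral_noteq_infinite) auto
  then show ?thesis
    by eventually_elim (use c in \<open>auto intro!: summable_suminf_not_top\<close>)
qed

text \<open>One event on which \<open>F\<close> is both entire and locally Lipschitz; the factor
  \<open>Suc k\<close> pays for the derivative of \<open>z ^ k\<close>. Radii are restricted to
  natural numbers, so that the event is a countable intersection.\<close>

definition decaying_coeffs :: "'w \<Rightarrow> bool" where
  "decaying_coeffs \<omega> \<longleftrightarrow> (\<forall>n::nat. summable (\<lambda>k. cmod (\<xi> k \<omega>) * (real (Suc k) * real n ^ k / sqrt (fact k))))"

lemma summable_weights: "summable (\<lambda>k. real (Suc k) * real n ^ k / sqrt (fact k))"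
proof (rule summable_ratio_test)
  \<comment> \<open>Beyond \<open>16 * n^2\<close> one has
    \<open>n / sqrt (k + 1) \<le> 1/4\<close>; as \<open>k + 2 \<le> 2 * (k + 1)\<close>, the ratio
    of successive terms is at most 1/2.\<close>
  fix k assume k: "k \<ge> 16 * n\<^sup>2"
  have "real n * 4 \<le> sqrt (Suc k)"
  proof (rule real_le_rsqrt)
    have "16 * n\<^sup>2 \<le> Suc k" using k by simp
    then have "real (16 * n\<^sup>2) \<le> real (Suc k)" by (rule of_nat_mono)
    then show "(real n * 4)\<^sup>2 \<le> real (Suc k)" by (simp add: power_mult_distrib)
  qed
  then have n: "real n / sqrt (Suc k) \<le> 1 / 4" by (simp add: field_simps)
  have "real (Suc (Suc k)) * real n ^ Suc k / sqrt (fact (Suc k))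
     = (real n ^ k / sqrt (fact k)) * (real (Suc (Suc k)) * (real n / sqrt (Suc k)))"
  proof -
    have "sqrt (fact (Suc k)) = sqrt (Suc k) * sqrt (fact k)"
      by (simp only: fact_Suc of_nat_mult real_sqrt_mult)
    then show ?thesis by (simp add: field_simps)
  qed
  also have "\<dots> \<le> (real n ^ k / sqrt (fact k)) * (real (2 * Suc k) * (1 / 4))"
    by (intro mult_left_mono mult_mono n) auto
  also have "\<dots> = 1 / 2 * (real (Suc k) * real n ^ k / sqrt (fact k))" by (simp add: field_simps)
  finally have *: "real (Suc (Suc k)) * real n ^ Suc k / sqrt (fact (Suc k)) \<le> 1 / 2 * (real (Suc k) * real n ^ k / sqrt (fact k))" .
  have nn: "norm (real (Suc j) * real n ^ j / sqrt (fact j)) = real (Suc j) * real n ^ j / sqrt (fact j)" for j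
    by simp
  show "norm (real (Suc (Suc k)) * real n ^ Suc k / sqrt (fact (Suc k)))
      \<le> 1 / 2 * norm (real (Suc k) * real n ^ k / sqrt (fact k))"
    unfolding nn by (rule *)
qed simp

lemma AE_decaying_coeffs: "AE \<omega> in M. decaying_coeffs \<omega>"
  unfolding decaying_coeffs_def AE_all_countable by (intro allI AE_summable_xi summable_weights) auto

abbreviation F :: "'w \<Rightarrow> complex \<Rightarrow> complex" where
  "F \<omega> \<equiv> gaf (\<lambda>k. \<xi> k \<omega>)"

lemma decaying_coeffs_summable:
  assumes "decaying_coeffs \<omega>"
  shows "summable (\<lambda>k. \<xi> k \<omega> / of_real (sqrt (fact k)) * z ^ k)"
proof -
  obtain n :: nat where n: "cmod z \<le> n" using real_arch_simple by blast
  show ?thesis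
  proof (rule summable_comparison_test'[of _ 0])
    show "summable (\<lambda>k. cmod (\<xi> k \<omega>) * (real (Suc k) * real n ^ k / sqrt (fact k)))"
      using assms by (auto simp: decaying_coeffs_def)
    fix k
    have "1 * cmod z ^ k \<le> real (Suc k) * real n ^ k"
      using n by (intro mult_mono power_mono) auto
    then show "cmod (\<xi> k \<omega> / of_real (sqrt (fact k)) * z ^ k)
        \<le> cmod (\<xi> k \<omega>) * (real (Suc k) * real n ^ k / sqrt (fact k))"
      by (simp add: norm_mult norm_divide norm_power divide_right_mono mult_left_mono
          flip: times_divide_eq_right)
        (simp add: divide_right_mono mult_left_mono)
  qed
qed

lemma decaying_coeffs_holomorphic:
  assumes "decaying_coeffs \<omega>" shows "F \<omega> holomorphic_on UNIV"
proof -
  have "(F \<omega> has_field_derivative (\<Sum>k. diffs (\<lambda>k. \<xi> k \<omega> / of_real (sqrt (fact k))) k * z ^ k)) (at z)" for z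
    unfolding gaf_def by (rule termdiffs_strong_converges_everywhere[OF decaying_coeffs_summable[OF assms]])
  then show ?thesis by (auto simp: holomorphic_on_open)
qed

text \<open>Termwise, \<open>z ^ k - w ^ k\<close> is at most
  \<open>k * n ^ (k - 1) * |z - w|\<close> on the disc of radius \<open>n\<close>. The constant is a
  natural number, so that later only countably many exceptional sets occur.\<close>

lemma decaying_coeffs_Lipschitz:
  assumes "decaying_coeffs \<omega>"
  obtains S :: nat where "\<And>z w. cmod z \<le> r \<Longrightarrow> cmod w \<le> r \<Longrightarrow> cmod (F \<omega> z - F \<omega> w) \<le> S * cmod (z - w)"
proof -
  obtain n :: nat where n: "max r 1 \<le> n" using real_arch_simple by blast
  define b where "b = (\<lambda>k. cmod (\<xi> k \<omega>) * (real (Suc k) * real n ^ k / sqrt (fact k)))"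
  have b: "summable b" using assms by (auto simp: decaying_coeffs_def b_def)
  have pow: "cmod (z ^ k - w ^ k) \<le> real (Suc k) * real n ^ k * cmod (z - w)"
    if "cmod z \<le> r" "cmod w \<le> r" for z w k
  proof -
    have "cmod (z ^ k - w ^ k) \<le> k * real n ^ (k - 1) * cmod (z - w)"
    proof -
      have nn: "real n > 0" using n by simp
      \<comment> \<open>Scaling by \<open>n\<close> moves both points into the closed unit disc,
        where the bound for differences of powers applies.\<close>
      have "cmod ((z / n) ^ k - (w / n) ^ k) \<le> k * cmod (z / n - w / n)"
        by (rule norm_power_diff) (use that n in \<open>auto simp: norm_divide field_simps\<close>)
      then have "cmod (z ^ k - w ^ k) / real n ^ k \<le> k * (cmod (z - w) / n)"
        by (simp add: power_divide norm_divide norm_power flip: diff_divide_distrib)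
      then have "cmod (z ^ k - w ^ k) \<le> k * (cmod (z - w) / n) * real n ^ k"
        using nn by (simp add: divide_le_eq)
      also have "\<dots> = k * real n ^ (k - 1) * cmod (z - w)"
        using nn by (cases k) auto
      finally show ?thesis .
    qed
    also have "\<dots> \<le> real (Suc k) * real n ^ k * cmod (z - w)"
      using n by (intro mult_right_mono mult_mono power_increasing) auto
    finally show ?thesis .
  qed
  obtain S :: nat where S: "suminf b \<le> S" using real_arch_simple by blast
  show ?thesis
  proof (rule that[of S])
    fix z w assume zw: "cmod z \<le> r" "cmod w \<le> r"
    let ?t = "\<lambda>k. \<xi> k \<omega> / of_real (sqrt (fact k)) * z ^ k - \<xi> k \<omega> / of_real (sqrt (fact k)) * w ^ k"
    have "F \<omega> z - F \<omega> w = suminf ?t"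
      unfolding gaf_def by (rule suminf_diff[OF decaying_coeffs_summable decaying_coeffs_summable]) (use assms in auto)
    also have "cmod \<dots> \<le> (\<Sum>k. b k * cmod (z - w))"
    proof (rule norm_suminf_le)
      show "summable (\<lambda>k. b k * cmod (z - w))" by (rule summable_mult2[OF b])
      fix k
      have "cmod (?t k) = cmod (\<xi> k \<omega>) / sqrt (fact k) * cmod (z ^ k - w ^ k)"
        unfolding right_diff_distrib[symmetric] by (simp add: norm_mult norm_divide)
      also have "\<dots> \<le> cmod (\<xi> k \<omega>) / sqrt (fact k) * (real (Suc k) * real n ^ k * cmod (z - w))"
        by (intro mult_left_mono pow zw) auto
      finally show "cmod (?t k) \<le> b k * cmod (z - w)" by (simp add: b_def)
    qed
    also have "\<dots> = suminf b * cmod (z - w)" by (rule suminf_mult2[OF b, symmetric])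
    also have "\<dots> \<le> S * cmod (z - w)" by (intro mult_right_mono S) auto
    finally show "cmod (F \<omega> z - F \<omega> w) \<le> S * cmod (z - w)" .
  qed
qed

lemma measurable_F [measurable]:
  assumes [measurable]: "g \<in> borel_measurable N"
  shows "(\<lambda>p. F (fst p) (g (snd p))) \<in> borel_measurable (M \<Otimes>\<^sub>M N)"
  unfolding gaf_def by measurable

lemma measurable_F' [measurable]: "(\<lambda>\<omega>. F \<omega> z) \<in> borel_measurable M"
  unfolding gaf_def by measurable

lemma char_finite_sum:
  "expectation (\<lambda>\<omega>. exp (\<i> * of_real (Re (\<Sum>k<n. u k * \<xi> k \<omega>)))) = complex_of_real (exp (- (\<Sum>k<n. (cmod (u k))\<^sup>2) / 4))"
proof -
  have ind: "indep_vars (\<lambda>_. borel) (\<lambda>k \<omega>. exp (\<i> * of_real (Re (u k * \<xi> k \<omega>)))) {..<n}"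
    by (rule indep_vars_compose2[OF indep_vars_subset[OF indep]]) auto
  have "expectation (\<lambda>\<omega>. exp (\<i> * of_real (Re (\<Sum>k<n. u k * \<xi> k \<omega>))))
     = expectation (\<lambda>\<omega>. \<Prod>k<n. exp (\<i> * of_real (Re (u k * \<xi> k \<omega>))))"
    by (simp only: Re_sum of_real_sum sum_distrib_left exp_sum finite_lessThan)
  also have "\<dots> = (\<Prod>k<n. expectation (\<lambda>\<omega>. exp (\<i> * of_real (Re (u k * \<xi> k \<omega>)))))"
    by (rule indep_vars_lebesgue_integral[OF _ ind]) (auto intro!: integrable_const_bound[of _ 1])
  also have "\<dots> = (\<Prod>k<n. complex_of_real (exp (- (cmod (u k))\<^sup>2 / 4)))"
  proof (intro prod.cong refl)
    fix k
    have "expectation (\<lambda>\<omega>. exp (\<i> * of_real (Re (u k * \<xi> k \<omega>)))) =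
        (\<integral>z. exp (\<i> * of_real (Re (u k * z))) \<partial>distr M borel (\<xi> k))"
      by (subst integral_distr) auto
    then show "expectation (\<lambda>\<omega>. exp (\<i> * of_real (Re (u k * \<xi> k \<omega>)))) = complex_of_real (exp (- (cmod (u k))\<^sup>2 / 4))"
      unfolding distr_xi char_std_complex_normal .
  qed
  also have "\<dots> = complex_of_real (exp (\<Sum>k<n. - (cmod (u k))\<^sup>2 / 4))"
    by (simp add: exp_sum)
  finally show ?thesis by (simp add: sum_negf sum_divide_distrib)
qed

text \<open>The characteristic functions of the partial sums converge by dominated convergence, the
  exponentials having modulus 1. The variances converge through
  \<open>\<Sum> (z * cnj w)^k / k! = exp (z * cnj w)\<close>, the covariance kernel of
  \<open>F\<close>.\<close>

lemma char_F:
  "expectation (\<lambda>\<omega>. exp (\<i> * of_real (Re (\<alpha> * F \<omega> z + \<beta> * F \<omega> w)))) =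
     complex_of_real (exp (- ((cmod \<alpha>)\<^sup>2 * exp ((cmod z)\<^sup>2) + (cmod \<beta>)\<^sup>2 * exp ((cmod w)\<^sup>2)
        + 2 * Re (\<alpha> * cnj \<beta> * exp (z * cnj w))) / 4))" (is "?E = complex_of_real (exp (- ?v / 4))")
proof -
  define u where "u = (\<lambda>k. (\<alpha> * z ^ k + \<beta> * w ^ k) / of_real (sqrt (fact k)))"
  have lim_ae: "AE \<omega> in M. (\<lambda>n. exp (\<i> * of_real (Re (\<Sum>k<n. u k * \<xi> k \<omega>))))
      \<longlonglongrightarrow> exp (\<i> * of_real (Re (\<alpha> * F \<omega> z + \<beta> * F \<omega> w)))"
    using AE_decaying_coeffs
  proof eventually_elim
    fix \<omega> assume g: "decaying_coeffs \<omega>"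
    have "(\<lambda>k. \<alpha> * (\<xi> k \<omega> / of_real (sqrt (fact k)) * z ^ k) + \<beta> * (\<xi> k \<omega> / of_real (sqrt (fact k)) * w ^ k))
        sums (\<alpha> * F \<omega> z + \<beta> * F \<omega> w)"
      unfolding gaf_def by (intro sums_add sums_mult summable_sums decaying_coeffs_summable g)
    also have "(\<lambda>k. \<alpha> * (\<xi> k \<omega> / of_real (sqrt (fact k)) * z ^ k) + \<beta> * (\<xi> k \<omega> / of_real (sqrt (fact k)) * w ^ k))
        = (\<lambda>k. u k * \<xi> k \<omega>)"
      by (simp add: u_def fun_eq_iff add_divide_distrib ring_distribs mult_ac)
    finally show "(\<lambda>n. exp (\<i> * of_real (Re (\<Sum>k<n. u k * \<xi> k \<omega>))))
      \<longlonglongrightarrow> exp (\<i> * of_real (Re (\<alpha> * F \<omega> z + \<beta> * F \<omega> w)))"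
      unfolding sums_def by (intro tendsto_intros)
  qed
  have lim1: "(\<lambda>n. expectation (\<lambda>\<omega>. exp (\<i> * of_real (Re (\<Sum>k<n. u k * \<xi> k \<omega>))))) \<longlonglongrightarrow> ?E"
    by (rule integral_dominated_convergence[where w = "\<lambda>_. 1"]) (use lim_ae in auto)
  have expc: "(\<lambda>k. x ^ k / fact k) sums exp x" for x :: complex
    using exp_converges[of x] by (simp add: scaleR_conv_of_real field_simps)
  have expr: "(\<lambda>k. x ^ k / fact k) sums exp x" for x :: real
    using exp_converges[of x] by (simp add: field_simps)
  have "(\<lambda>k. (cmod \<alpha>)\<^sup>2 * (((cmod z)\<^sup>2) ^ k / fact k) + (cmod \<beta>)\<^sup>2 * (((cmod w)\<^sup>2) ^ k / fact k)
      + 2 * Re (\<alpha> * cnj \<beta> * ((z * cnj w) ^ k / fact k))) sums ?v"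
    by (intro sums_add sums_mult sums_Re expc expr)
  also have "(\<lambda>k. (cmod \<alpha>)\<^sup>2 * (((cmod z)\<^sup>2) ^ k / fact k) + (cmod \<beta>)\<^sup>2 * (((cmod w)\<^sup>2) ^ k / fact k)
      + 2 * Re (\<alpha> * cnj \<beta> * ((z * cnj w) ^ k / fact k))) = (\<lambda>k. (cmod (u k))\<^sup>2)"
  proof
    fix k
    have cm: "(cmod (a + b))\<^sup>2 = (cmod a)\<^sup>2 + (cmod b)\<^sup>2 + 2 * Re (a * cnj b)" for a b
      unfolding cmod_power2 by (simp add: power2_eq_square algebra_simps)
    have "(cmod (u k))\<^sup>2 = (cmod (\<alpha> * z ^ k + \<beta> * w ^ k))\<^sup>2 / fact k"
      by (simp add: u_def norm_divide power_divide)
    also have "\<dots> = ((cmod (\<alpha> * z ^ k))\<^sup>2 + (cmod (\<beta> * w ^ k))\<^sup>2 + 2 * Re ((\<alpha> * z ^ k) * cnj (\<beta> * w ^ k))) / fact k"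
      unfolding cm ..
    also have "(\<alpha> * z ^ k) * cnj (\<beta> * w ^ k) = of_real (fact k) * (\<alpha> * cnj \<beta> * ((z * cnj w) ^ k / fact k))"
      by (simp add: power_mult_distrib)
    finally show "(cmod \<alpha>)\<^sup>2 * (((cmod z)\<^sup>2) ^ k / fact k) + (cmod \<beta>)\<^sup>2 * (((cmod w)\<^sup>2) ^ k / fact k)
      + 2 * Re (\<alpha> * cnj \<beta> * ((z * cnj w) ^ k / fact k)) = (cmod (u k))\<^sup>2"
      by (simp only: Re_complex_of_real Im_complex_of_real times_complex.sel mult_zero_left diff_zero
           add_divide_distrib) (simp add: norm_mult norm_power power_mult_distrib power_mult[symmetric] mult.commute)
  qed
  finally have "(\<lambda>n. complex_of_real (exp (- (\<Sum>k<n. (cmod (u k))\<^sup>2) / 4))) \<longlonglongrightarrow> complex_of_real (exp (- ?v / 4))"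
    unfolding sums_def by (intro tendsto_intros) auto
  with lim1 show ?thesis unfolding char_finite_sum by (rule LIMSEQ_unique)
qed

end

section \<open>Integration over circles\<close>

text \<open>A weak form of \<open>2 * |u| \<le> |sin (pi * u)|\<close>, enough to compare the sine
  with a Gaussian exponent. With \<open>x = pi * |u|\<close>, the bound
  \<open>x / 3 \<le> sin x\<close> and \<open>pi \<ge> 3\<close> give it.\<close>

lemma abs_sin_pi_ge:
  fixes u :: real assumes "\<bar>u\<bar> \<le> 1 / 2" shows "\<bar>u\<bar> \<le> \<bar>sin (pi * u)\<bar>"
proof -
  \<comment> \<open>\<open>8/5\<close> lies just above \<open>pi / 2\<close>; on this range the
    cubic Taylor polynomial with remainder \<open>x^4 / 24\<close> is precise enough.\<close>
  have pos: "x / 3 \<le> sin x" if x: "0 \<le> x" "x \<le> 8 / 5" for x :: real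
  proof -
    have "\<bar>sin x - (\<Sum>m<4. sin_coeff m * x ^ m)\<bar> \<le> inverse (fact 4) * \<bar>x\<bar> ^ 4"
      by (rule Maclaurin_sin_bound)
    moreover have "(\<Sum>m<4. sin_coeff m * x ^ m) = sin_coeff 0 + sin_coeff 1 * x + sin_coeff 2 * x ^ 2 + sin_coeff 3 * x ^ 3"
      by (simp add: eval_nat_numeral)
    moreover have "sin_coeff 0 = 0" "sin_coeff 1 = 1" "sin_coeff 2 = 0" "sin_coeff 3 = - 1 / 6" "fact 4 = (24 :: real)"
      by (simp_all add: sin_coeff_def fact_numeral)
    ultimately have "\<bar>sin x - (x - x ^ 3 / 6)\<bar> \<le> x ^ 4 / 24"
      using x by simp
    then have "sin x \<ge> x - x ^ 3 / 6 - x ^ 4 / 24" by linarith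
    moreover have "x * (x\<^sup>2 / 6 + x ^ 3 / 24) \<le> x * (2 / 3)"
    proof (rule mult_left_mono)
      have "x\<^sup>2 \<le> (8 / 5)\<^sup>2" "x ^ 3 \<le> (8 / 5) ^ 3" using x by (auto intro!: power_mono)
      then show "x\<^sup>2 / 6 + x ^ 3 / 24 \<le> 2 / 3" by (simp add: power2_eq_square power3_eq_cube)
    qed (use x in auto)
    ultimately show ?thesis by (simp add: power2_eq_square power3_eq_cube power4_eq_xxxx algebra_simps)
  qed
  have pi: "3 \<le> pi" "pi \<le> 16 / 5" using pi_approx by auto
  have "\<bar>u\<bar> * 3 \<le> \<bar>u\<bar> * pi" using pi by (intro mult_left_mono) auto
  moreover have "pi * \<bar>u\<bar> \<le> 16 / 5 * (1 / 2)" using assms pi by (intro mult_mono) auto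
  ultimately have "\<bar>u\<bar> \<le> sin (pi * \<bar>u\<bar>)"
    using pos[of "pi * \<bar>u\<bar>"] by (simp add: mult.commute)
  also have "\<dots> \<le> \<bar>sin (pi * \<bar>u\<bar>)\<bar>" by simp
  also have "\<dots> = \<bar>sin (pi * u)\<bar>" by (auto simp: abs_if)
  finally show ?thesis .
qed

text \<open>The law of cosines in half-angle form. It separates the radii from the angle, so that
  \<open>exp (-|z - w|^2)\<close> becomes a product.\<close>

lemma cmod_diff_circles:
  fixes k l :: real
  shows "(cmod (of_real k * cis a - of_real l * cis b))\<^sup>2 = (k - l)\<^sup>2 + 4 * k * l * (sin ((a - b) / 2))\<^sup>2"
proof -
  have "(cmod (of_real k * cis a - of_real l * cis b))\<^sup>2 = k\<^sup>2 + l\<^sup>2 - 2 * k * l * cos (a - b)"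
  proof -
    have "(cmod (of_real k * cis a - of_real l * cis b))\<^sup>2
       = k\<^sup>2 * ((sin a)\<^sup>2 + (cos a)\<^sup>2) + l\<^sup>2 * ((sin b)\<^sup>2 + (cos b)\<^sup>2) - 2 * k * l * cos (a - b)"
      unfolding cmod_power2
      by (simp add: cos_diff power2_eq_square algebra_simps del: sin_cos_squared_add sin_cos_squared_add2 sin_cos_squared_add3)
    then show ?thesis by (simp only: sin_cos_squared_add mult_1_right)
  qed
  moreover have "cos (a - b) = 1 - 2 * (sin ((a - b) / 2))\<^sup>2"
  proof -
    have "2 * ((a - b) / 2) = a - b" by simp
    then show ?thesis using cos_double_sin[of "(a - b) / 2"] by (simp only:)
  qed
  ultimately show ?thesis by (simp add: power2_eq_square algebra_simps)
qed

lemma cmod_cis_diff_le: "cmod (cis a - cis b) \<le> \<bar>a - b\<bar>"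
proof (rule power2_le_imp_le)
  have "(sin ((a - b) / 2))\<^sup>2 \<le> ((a - b) / 2)\<^sup>2"
    using abs_sin_x_le_abs_x[of "(a - b) / 2"] by (simp only: abs_le_square_iff)
  then show "(cmod (cis a - cis b))\<^sup>2 \<le> \<bar>a - b\<bar>\<^sup>2"
    using cmod_diff_circles[of 1 a 1 b] by (simp add: power_divide)
qed simp

text \<open>The law of the circle parameter. As a density on all reals it has space
  \<open>UNIV\<close>, and measurability remains plain Borel measurability.\<close>

definition unit_interval_measure :: "real measure" where
  "unit_interval_measure = density lborel (\<lambda>t. ennreal (indicator {0..1} t))"

lemma sets_unit_interval_measure [simp, measurable_cong]: "sets unit_interval_measure = sets borel"
  by (simp add: unit_interval_measure_def)

lemma space_unit_interval_measure [simp]: "space unit_interval_measure = UNIV"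
  by (simp add: unit_interval_measure_def)

interpretation unit_interval: prob_space unit_interval_measure
  by (rule prob_spaceI) (simp add: unit_interval_measure_def emeasure_density ennreal_indicator)

text \<open>Bridge between the gauge integrals coming from Cauchy's formula and the Lebesgue
  integrals needed for Fubini.\<close>

lemma integral_unit_interval_measure:
  fixes f :: "real \<Rightarrow> real"
  assumes "continuous_on {0..1} f" "f \<in> borel_measurable borel"
  shows "(f has_integral (\<integral>t. f t \<partial>unit_interval_measure)) {0..1}"
proof -
  have "(\<integral>t. f t \<partial>unit_interval_measure) = (LINT t:{0..1}|lborel. f t)"
    unfolding unit_interval_measure_def set_lebesgue_integral_def
    using assms by (subst integral_density) auto
  also have "\<dots> = integral {0..1} f"
    using set_borel_integral_eq_integral(2)[OF borel_integrable_atLeastAtMost'[OF assms(1)]] .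
  finally show ?thesis using assms by (simp add: integrable_integral integrable_continuous_interval)
qed

text \<open>For \<open>s\<close>, \<open>t\<close> in the unit interval, \<open>s - t\<close> is
  within 1/2 of one of -1, 0, 1, where the sine vanishes, and there \<open>abs_sin_pi_ge\<close>
  yields a Gaussian. The factor 3 counts these three Gaussians.\<close>

lemma nn_integral_exp_sin_le:
  fixes \<kappa> :: real assumes \<kappa>: "\<kappa> > 0"
  shows "(\<integral>\<^sup>+s. \<integral>\<^sup>+t. ennreal (exp (- \<kappa> * (sin (pi * (s - t)))\<^sup>2)) \<partial>unit_interval_measure \<partial>unit_interval_measure)
    \<le> ennreal (3 * sqrt (pi / \<kappa>))"
proof -
  have gauss: "(\<integral>\<^sup>+t. ennreal (exp (- \<kappa> * (t - c)\<^sup>2)) \<partial>lborel) = ennreal (sqrt (pi / \<kappa>))" for c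
  proof -
    have "(\<integral>\<^sup>+t. ennreal (exp (- \<kappa> * (t - c)\<^sup>2)) \<partial>lborel) = (\<integral>\<^sup>+t. ennreal (exp (- \<kappa> * t\<^sup>2 + 0 * t)) \<partial>lborel)"
      by (subst nn_integral_real_affine[where c = 1 and t = c]) auto
    then show ?thesis using nn_integral_gaussian[OF \<kappa>, of 0] by simp
  qed
  have le: "exp (- \<kappa> * (sin (pi * (s - t)))\<^sup>2) \<le> exp (- \<kappa> * (t - s)\<^sup>2) + exp (- \<kappa> * (t - (s - 1))\<^sup>2) + exp (- \<kappa> * (t - (s + 1))\<^sup>2)"
    if st: "s \<in> {0..1}" "t \<in> {0..1}" for s t :: real
  proof -
    have *: "exp (- \<kappa> * (sin (pi * (s - t)))\<^sup>2) \<le> exp (- \<kappa> * (t - (s - j))\<^sup>2)"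
      if j: "(sin (pi * (s - t)))\<^sup>2 = (sin (pi * (s - t - j)))\<^sup>2" "\<bar>s - t - j\<bar> \<le> 1 / 2" for j
    proof -
      have "(s - t - j)\<^sup>2 \<le> (sin (pi * (s - t - j)))\<^sup>2"
        using abs_sin_pi_ge[OF j(2)] by (simp add: abs_le_square_iff)
      moreover have "(t - (s - j))\<^sup>2 = (s - t - j)\<^sup>2" by (simp add: power2_eq_square algebra_simps)
      ultimately show ?thesis unfolding j(1) using \<kappa> by simp
    qed
    have per: "(sin (pi * (s - t)))\<^sup>2 = (sin (pi * (s - t - 1)))\<^sup>2" "(sin (pi * (s - t)))\<^sup>2 = (sin (pi * (s - t - - 1)))\<^sup>2"
      by (simp_all add: right_diff_distrib sin_diff sin_add distrib_left power2_commute)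
    consider "\<bar>s - t - 0\<bar> \<le> 1 / 2" | "\<bar>s - t - 1\<bar> \<le> 1 / 2" | "\<bar>s - t - - 1\<bar> \<le> 1 / 2"
    proof -
      have "0 \<le> s" "s \<le> 1" "0 \<le> t" "t \<le> 1" using st by auto
      then have "\<bar>s - t - 0\<bar> \<le> 1 / 2 \<or> \<bar>s - t - 1\<bar> \<le> 1 / 2 \<or> \<bar>s - t - - 1\<bar> \<le> 1 / 2"
        unfolding abs_le_iff by argo
      then show thesis using that by blast
    qed
    then show ?thesis
    proof cases
      case 1
      from *[OF _ this] have "exp (- \<kappa> * (sin (pi * (s - t)))\<^sup>2) \<le> exp (- \<kappa> * (t - s)\<^sup>2)" by simp
      then show ?thesis by (meson add_increasing2 exp_ge_zero order_trans)
    next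
      case 2
      from *[OF per(1) this] show ?thesis
        using exp_ge_zero[of "- \<kappa> * (t - s)\<^sup>2"] exp_ge_zero[of "- \<kappa> * (t - (s + 1))\<^sup>2"] by linarith
    next
      case 3
      from *[OF per(2) this] show ?thesis unfolding diff_minus_eq_add
        using exp_ge_zero[of "- \<kappa> * (t - s)\<^sup>2"] exp_ge_zero[of "- \<kappa> * (t - (s - 1))\<^sup>2"] by linarith
    qed
  qed
  have AE01: "AE t in unit_interval_measure. t \<in> {0..1}"
    unfolding unit_interval_measure_def by (subst AE_density) (auto simp: indicator_def split: if_splits)
  have "(\<integral>\<^sup>+s. \<integral>\<^sup>+t. ennreal (exp (- \<kappa> * (sin (pi * (s - t)))\<^sup>2)) \<partial>unit_interval_measure \<partial>unit_interval_measure)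
     \<le> (\<integral>\<^sup>+s. ennreal (3 * sqrt (pi / \<kappa>)) \<partial>unit_interval_measure)"
  proof (rule nn_integral_mono_AE, use AE01 in eventually_elim)
    fix s :: real assume s: "s \<in> {0..1}"
    have "(\<integral>\<^sup>+t. ennreal (exp (- \<kappa> * (sin (pi * (s - t)))\<^sup>2)) \<partial>unit_interval_measure)
       = (\<integral>\<^sup>+t. ennreal (indicator {0..1} t) * ennreal (exp (- \<kappa> * (sin (pi * (s - t)))\<^sup>2)) \<partial>lborel)"
      unfolding unit_interval_measure_def by (subst nn_integral_density) auto
    also have "\<dots> \<le> (\<integral>\<^sup>+t. ennreal (exp (- \<kappa> * (t - s)\<^sup>2)) + ennreal (exp (- \<kappa> * (t - (s - 1))\<^sup>2)) + ennreal (exp (- \<kappa> * (t - (s + 1))\<^sup>2)) \<partial>lborel)"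
    proof (rule nn_integral_mono)
      fix t :: real
      show "ennreal (indicator {0..1} t) * ennreal (exp (- \<kappa> * (sin (pi * (s - t)))\<^sup>2)) \<le>
        ennreal (exp (- \<kappa> * (t - s)\<^sup>2)) + ennreal (exp (- \<kappa> * (t - (s - 1))\<^sup>2)) + ennreal (exp (- \<kappa> * (t - (s + 1))\<^sup>2))"
        using le[OF s, of t] by (cases "t \<in> {0..1}") (auto simp flip: ennreal_plus)
    qed
    also have "\<dots> = ennreal (sqrt (pi / \<kappa>)) + ennreal (sqrt (pi / \<kappa>)) + ennreal (sqrt (pi / \<kappa>))"
      by (subst nn_integral_add, simp, simp, subst nn_integral_add, simp, simp) (simp only: gauss)
    also have "\<dots> = ennreal (3 * sqrt (pi / \<kappa>))"
      using \<kappa> by (simp flip: ennreal_plus)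
    finally show "(\<integral>\<^sup>+t. ennreal (exp (- \<kappa> * (sin (pi * (s - t)))\<^sup>2)) \<partial>unit_interval_measure) \<le> ennreal (3 * sqrt (pi / \<kappa>))" .
  qed
  then show ?thesis using unit_interval.emeasure_space_1 by simp
qed


text \<open>The quotient is the integral of \<open>exp (- s * u)\<close> over \<open>u\<close> in
  \<open>{a..b}\<close>; by Tonelli the whole is the integral of \<open>1 / u\<close>.\<close>

lemma nn_integral_frullani:
  fixes a b :: real assumes ab: "0 < a" "a \<le> b"
  shows "(\<integral>\<^sup>+s. ennreal ((exp (- s * a) - exp (- s * b)) / s) * indicator {0<..} s \<partial>lborel) = ennreal (ln b - ln a)"
proof -
  have "(\<integral>\<^sup>+s. ennreal ((exp (- s * a) - exp (- s * b)) / s) * indicator {0<..} s \<partial>lborel)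
     = (\<integral>\<^sup>+s. (\<integral>\<^sup>+u. ennreal (exp (- s * u)) * indicator {0<..} s * indicator {a..b} u \<partial>lborel) \<partial>lborel)"
  proof (rule nn_integral_cong)
    fix s :: real
    show "ennreal ((exp (- s * a) - exp (- s * b)) / s) * indicator {0<..} s =
       (\<integral>\<^sup>+u. ennreal (exp (- s * u)) * indicator {0<..} s * indicator {a..b} u \<partial>lborel)"
    proof (cases "s > 0")
      case True
      then have "(\<integral>\<^sup>+u. ennreal (exp (- s * u)) * indicator {a..b} u \<partial>lborel) = ennreal (- exp (- s * b) / s - - exp (- s * a) / s)"
        using ab by (intro nn_integral_FTC_Icc) (auto intro!: derivative_eq_intros)
      with True show ?thesis by (simp add: diff_divide_distrib)
    qed simp
  qed
  also have "\<dots> = (\<integral>\<^sup>+u. (\<integral>\<^sup>+s. ennreal (exp (- s * u)) * indicator {0<..} s * indicator {a..b} u \<partial>lborel) \<partial>lborel)"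
    by (rule lborel_pair.Fubini') simp
  also have "\<dots> = (\<integral>\<^sup>+u. ennreal (1 / u) * indicator {a..b} u \<partial>lborel)"
  proof (rule nn_integral_cong)
    fix u :: real
    show "(\<integral>\<^sup>+s. ennreal (exp (- s * u)) * indicator {0<..} s * indicator {a..b} u \<partial>lborel) = ennreal (1 / u) * indicator {a..b} u"
    proof (cases "u \<in> {a..b}")
      case True
      then have u: "u > 0" using ab by auto
      have "(\<integral>\<^sup>+s. ennreal (exp (- s * u)) * indicator {0<..} s \<partial>lborel) = (\<integral>\<^sup>+s. ennreal (exp (- s * u)) * indicator {0..} s \<partial>lborel)"
        by (intro nn_integral_cong_AE AE_I[of _ _ "{0}"]) (auto split: split_indicator)
      also have "\<dots> = ennreal (0 - - exp (- 0 * u) / u)"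
      proof (rule nn_integral_FTC_atLeast)
        have "LIM s at_top. - s * u :> at_bot"
          using filterlim_tendsto_pos_mult_at_top[OF tendsto_const u filterlim_ident]
          by (simp add: filterlim_uminus_at_bot mult.commute)
        then have "((\<lambda>s. - exp (- s * u) / u) \<longlongrightarrow> - 0 / u) at_top"
          by (intro tendsto_intros filterlim_compose[OF exp_at_bot]) (use u in auto)
        then show "((\<lambda>s. - exp (- s * u) / u) \<longlongrightarrow> 0) at_top" by simp
      qed (use u in \<open>auto intro!: derivative_eq_intros\<close>)
      finally show ?thesis using True by simp
    qed simp
  qed
  also have "\<dots> = ennreal (ln b - ln a)"
    using ab by (intro nn_integral_FTC_Icc) (auto intro!: derivative_eq_intros simp: divide_inverse)
  finally show ?thesis .
qed

lemma has_bochner_integral_frullani: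
  fixes a b :: real assumes "0 < a" "0 < b"
  shows "has_bochner_integral lborel (\<lambda>s. indicator {0<..} s * ((exp (- s * a) - exp (- s * b)) / s)) (ln b - ln a)"
proof -
  have *: "has_bochner_integral lborel (\<lambda>s. indicator {0<..} s * ((exp (- s * a) - exp (- s * b)) / s)) (ln b - ln a)"
    if ab: "0 < a" "a \<le> b" for a b :: real
  proof (rule has_bochner_integral_nn_integral)
    show "AE s in lborel. 0 \<le> indicator {0<..} s * ((exp (- s * a) - exp (- s * b)) / s)"
      using ab by (auto split: split_indicator intro!: divide_nonneg_pos)
    show "(\<integral>\<^sup>+s. ennreal (indicator {0<..} s * ((exp (- s * a) - exp (- s * b)) / s)) \<partial>lborel) = ennreal (ln b - ln a)"
      unfolding nn_integral_frullani[OF ab, symmetric]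
      by (intro nn_integral_cong) (auto split: split_indicator)
  qed (use ab in auto)
  show ?thesis
  proof (cases "a \<le> b")
    case False
    with *[of b a] assms have "has_bochner_integral lborel (\<lambda>s. - (indicator {0<..} s * ((exp (- s * b) - exp (- s * a)) / s))) (- (ln a - ln b))"
      by (intro has_bochner_integral_minus) auto
    then show ?thesis by (simp add: right_diff_distrib diff_divide_distrib)
  qed (use * assms in auto)
qed

section \<open>The normalized function: Laplace transforms, small values, zeros on circles\<close>

context gaf_process begin

text \<open>The factor gives every value second moment 1; then the law of the modulus does not
  depend on the point, and the modulus of the correlation depends only on the distance of two
  points.\<close>

definition normalized :: "'w \<Rightarrow> complex \<Rightarrow> complex" where
  "normalized \<omega> z = of_real (exp (- (cmod z)\<^sup>2 / 2)) * F \<omega> z"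

lemma measurable_normalized [measurable]:
  assumes [measurable]: "g \<in> borel_measurable N"
  shows "(\<lambda>p. normalized (fst p) (g (snd p))) \<in> borel_measurable (M \<Otimes>\<^sub>M N)"
  unfolding normalized_def by measurable

lemma measurable_normalized' [measurable]: "(\<lambda>\<omega>. normalized \<omega> z) \<in> borel_measurable M"
  unfolding normalized_def by measurable

lemma laplace_normalized:
  assumes s: "s \<ge> 0"
  shows "expectation (\<lambda>\<omega>. exp (- s * ((cmod (normalized \<omega> z))\<^sup>2 + (cmod (normalized \<omega> w))\<^sup>2)))
    = 1 / ((1 + s)\<^sup>2 - s\<^sup>2 * exp (- (cmod (z - w))\<^sup>2))"
proof -
  \<comment> \<open>The correlation of the normalized values at \<open>z\<close> and
    \<open>w\<close>: the kernel \<open>exp (z * cnj w)\<close> times both normalizing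
    factors.\<close>
  define \<rho> where "\<rho> = exp (z * cnj w - of_real ((cmod z)\<^sup>2 / 2) - of_real ((cmod w)\<^sup>2 / 2))"
  have \<rho>: "(cmod \<rho>)\<^sup>2 = exp (- (cmod (z - w))\<^sup>2)"
  proof -
    have "(cmod \<rho>)\<^sup>2 = exp (2 * (Re (z * cnj w) - (cmod z)\<^sup>2 / 2 - (cmod w)\<^sup>2 / 2))"
      unfolding \<rho>_def norm_exp_eq_Re by (simp add: power2_eq_square mult_exp_exp)
    also have "2 * (Re (z * cnj w) - (cmod z)\<^sup>2 / 2 - (cmod w)\<^sup>2 / 2) = - (cmod (z - w))\<^sup>2"
      unfolding cmod_power2 by (simp add: power2_eq_square field_simps)
    finally show ?thesis .
  qed
  then have "(cmod \<rho>)\<^sup>2 \<le> 1\<^sup>2" by simp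
  then have le1: "cmod \<rho> \<le> 1" by (rule power2_le_imp_le) simp
  have "expectation (\<lambda>\<omega>. exp (- s * ((cmod (normalized \<omega> z))\<^sup>2 + (cmod (normalized \<omega> w))\<^sup>2)))
    = 1 / ((1 + s)\<^sup>2 - s\<^sup>2 * (cmod \<rho>)\<^sup>2)"
  proof (rule laplace_gaussian_pair[OF _ _ _ s le1])
    fix \<alpha> \<beta> :: complex
    define a where "a = \<alpha> * of_real (exp (- (cmod z)\<^sup>2 / 2))"
    define b where "b = \<beta> * of_real (exp (- (cmod w)\<^sup>2 / 2))"
    have a: "(cmod a)\<^sup>2 * exp ((cmod z)\<^sup>2) = (cmod \<alpha>)\<^sup>2"
      by (simp add: a_def norm_mult power_mult_distrib exp_double[symmetric] mult_exp_exp)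
    have b: "(cmod b)\<^sup>2 * exp ((cmod w)\<^sup>2) = (cmod \<beta>)\<^sup>2"
      by (simp add: b_def norm_mult power_mult_distrib exp_double[symmetric] mult_exp_exp)
    have "\<rho> = exp (z * cnj w) * of_real (exp (- (cmod z)\<^sup>2 / 2)) * of_real (exp (- (cmod w)\<^sup>2 / 2))"
      unfolding \<rho>_def exp_of_real[symmetric] mult_exp_exp by simp
    then have ab: "a * cnj b * exp (z * cnj w) = \<alpha> * cnj \<beta> * \<rho>"
      by (simp add: a_def b_def mult_ac)
    have lin: "\<alpha> * normalized \<omega> z + \<beta> * normalized \<omega> w = a * F \<omega> z + b * F \<omega> w" for \<omega>
      by (simp add: normalized_def a_def b_def mult_ac)
    show "expectation (\<lambda>\<omega>. exp (\<i> * of_real (Re (\<alpha> * normalized \<omega> z + \<beta> * normalized \<omega> w))))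
        = complex_of_real (exp (- ((cmod \<alpha>)\<^sup>2 + (cmod \<beta>)\<^sup>2 + 2 * Re (\<alpha> * cnj \<beta> * \<rho>)) / 4))"
      unfolding lin char_F a b ab ..
  qed auto
  then show ?thesis unfolding \<rho> .
qed

lemma laplace_normalized1:
  assumes s: "s \<ge> 0"
  shows "expectation (\<lambda>\<omega>. exp (- s * (cmod (normalized \<omega> z))\<^sup>2)) = 1 / (1 + s)"
  \<comment> \<open>With \<open>z = w\<close> the two exponents add up, hence \<open>s / 2\<close>,
    and \<open>(1 + s/2)^2 - (s/2)^2 = 1 + s\<close>.\<close>
  using laplace_normalized[of "s / 2" z z] s by (simp add: power2_eq_square field_simps)

text \<open>Exponential Markov inequality with \<open>s = 1 / \<delta>^2\<close>: on the event,
  \<open>exp (1 - s * |X|^2) \<ge> 1\<close> for the normalized value \<open>X\<close>.\<close>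

lemma small_ball:
  assumes d: "\<delta> > 0"
  shows "prob {\<omega> \<in> space M. cmod (normalized \<omega> z) \<le> \<delta>} \<le> exp 1 * \<delta>\<^sup>2"
proof -
  let ?A = "{\<omega> \<in> space M. cmod (normalized \<omega> z) \<le> \<delta>}"
  let ?s = "1 / \<delta>\<^sup>2"
  have "prob ?A = expectation (indicator ?A)" by simp
  also have "\<dots> \<le> expectation (\<lambda>\<omega>. exp 1 * exp (- ?s * (cmod (normalized \<omega> z))\<^sup>2))"
  proof (rule integral_mono)
    show "integrable M (\<lambda>\<omega>. exp 1 * exp (- ?s * (cmod (normalized \<omega> z))\<^sup>2))"
      by (intro integrable_mult_right integrable_const_bound[of _ 1]) auto
    fix \<omega> assume "\<omega> \<in> space M"
    show "indicator ?A \<omega> \<le> exp 1 * exp (- ?s * (cmod (normalized \<omega> z))\<^sup>2)"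
    proof (cases "\<omega> \<in> ?A")
      case True
      then have "(cmod (normalized \<omega> z))\<^sup>2 \<le> \<delta>\<^sup>2" by (auto intro: power_mono)
      then have "1 \<le> exp (1 + - ?s * (cmod (normalized \<omega> z))\<^sup>2)" using d by (simp add: field_simps)
      then show ?thesis using True by (simp add: exp_add exp_diff exp_minus field_simps)
    qed simp
  qed (auto intro!: integrable_const_bound[of _ 1])
  also have "\<dots> = exp 1 * (1 / (1 + ?s))"
    using laplace_normalized1[of ?s z] by simp
  also have "\<dots> \<le> exp 1 * \<delta>\<^sup>2"
  proof (intro mult_left_mono)
    have "1 / (1 + ?s) \<le> 1 / ?s" using d by (intro divide_left_mono) (auto intro!: mult_pos_pos divide_pos_pos add_pos_pos)
    then show "1 / (1 + ?s) \<le> \<delta>\<^sup>2" by simp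
  qed simp
  finally show ?thesis .
qed

text \<open>
  Cut the circle into \<open>N\<close> arcs. By the Lipschitz bound a zero on an arc forces a value of size \<open>O(1/N)\<close>
  at its endpoint, which has probability \<open>O(1/N\<^sup>2)\<close>.
\<close>

lemma AE_nonzero_on_circle:
  assumes r: "r > 0"
  shows "AE \<omega> in M. \<forall>z. cmod z = r \<longrightarrow> F \<omega> z \<noteq> 0"
proof -
  define p where "p = (\<lambda>N j. of_real r * ucirc (real j / real N))"
  \<comment> \<open>One of \<open>N\<close> equidistant points has a small value. The radius
    \<open>2 * pi * r / N\<close> is an arc length, so a zero and Lipschitz constant at most
    \<open>C\<close> put \<open>\<omega>\<close> into \<open>B C N\<close> for every
    \<open>N\<close>.\<close>
  define B where "B = (\<lambda>C N. \<Union>j<N. {\<omega> \<in> space M. cmod (normalized \<omega> (p N j)) \<le> C * (2 * pi * r / real N)})"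
  have B_sets: "B C N \<in> sets M" for C N unfolding B_def by measurable
  have B_prob: "prob (B C N) \<le> exp 1 * (C * (2 * pi * r))\<^sup>2 / N" if "C > 0" "N > 0" for C N
  proof -
    have "prob (B C N) \<le> (\<Sum>j<N. prob {\<omega> \<in> space M. cmod (normalized \<omega> (p N j)) \<le> C * (2 * pi * r / real N)})"
      unfolding B_def by (rule finite_measure_subadditive_finite) auto
    also have "\<dots> \<le> (\<Sum>j<N. exp 1 * (C * (2 * pi * r / real N))\<^sup>2)"
      using that r by (intro sum_mono small_ball) auto
    also have "\<dots> = exp 1 * (C * (2 * pi * r))\<^sup>2 / N"
      using that by (simp add: power2_eq_square field_simps)
    finally show ?thesis .
  qed
  \<comment> \<open>\<open>N\<close> events of probability O(\<open>1/N^2\<close>) each: the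
    probability of \<open>B C N\<close> tends to 0, so lying in all of them is a null event.\<close>
  have null: "AE \<omega> in M. \<exists>N>0. \<omega> \<notin> B C N" if C: "C > 0" for C
  proof (rule AE_I')
    let ?I = "\<Inter>N\<in>{0<..}. B C N"
    have sI: "?I \<in> sets M" using B_sets by (intro sets.countable_INT') auto
    have "prob ?I \<le> exp 1 * (C * (2 * pi * r))\<^sup>2 / real (Suc N)" for N
      using B_prob[OF C, of "Suc N"] finite_measure_mono[OF _ B_sets, of ?I C "Suc N"] by fastforce
    moreover have "(\<lambda>N. exp 1 * (C * (2 * pi * r))\<^sup>2 / real (Suc N)) \<longlonglongrightarrow> 0"
      by real_asymp
    ultimately have "prob ?I \<le> 0" by (intro LIMSEQ_le_const) auto
    then show "?I \<in> null_sets M"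
      using sI by (auto simp: null_sets_def emeasure_eq_measure measure_le_0_iff)
    show "{\<omega> \<in> space M. \<not> (\<exists>N>0. \<omega> \<notin> B C N)} \<subseteq> ?I"
      by (intro subsetI INT_I) (simp only: mem_Collect_eq greaterThan_iff, blast)
  qed
  have "AE \<omega> in M. \<forall>C::nat. C > 0 \<longrightarrow> (\<exists>N>0. \<omega> \<notin> B (real C) N)"
    unfolding AE_all_countable using null by (auto intro!: AE_impI)
  with AE_decaying_coeffs AE_space show ?thesis
  proof eventually_elim
    fix \<omega> assume g: "decaying_coeffs \<omega>" and \<omega>: "\<omega> \<in> space M" and nB: "\<forall>C::nat. C > 0 \<longrightarrow> (\<exists>N>0. \<omega> \<notin> B (real C) N)"
    obtain S :: nat where S: "\<And>z w. cmod z \<le> r \<Longrightarrow> cmod w \<le> r \<Longrightarrow> cmod (F \<omega> z - F \<omega> w) \<le> S * cmod (z - w)"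
      by (rule decaying_coeffs_Lipschitz[OF g, of r]) blast
    \<comment> \<open>\<open>Suc S\<close> instead of \<open>S\<close>, because the null sets were
      formed for positive constants.\<close>
    obtain N where N: "N > 0" "\<omega> \<notin> B (real (Suc S)) N" using nB by blast
    show "\<forall>z. cmod z = r \<longrightarrow> F \<omega> z \<noteq> 0"
    proof (intro allI impI notI)
      fix z assume z: "cmod z = r" and F0: "F \<omega> z = 0"
      define t where "t = Arg2pi z / (2 * pi)"
      have t: "0 \<le> t" "t < 1" using Arg2pi[of z] by (auto simp: t_def)
      have zt: "z = of_real r * ucirc t"
        using Arg2pi[of z] z by (simp add: t_def cis_conv_exp is_Arg_def)
      define j where "j = nat \<lfloor>t * N\<rfloor>"
      have j: "real j \<le> t * N" "t * N < real j + 1" using t by (auto simp: j_def)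
      have jN: "j < N"
      proof -
        have "real j < real N" using j(1) t N by (smt (verit) mult_less_cancel_right2 of_nat_0_less_iff)
        then show ?thesis by simp
      qed
      have "cmod (F \<omega> (p N j)) \<le> S * cmod (p N j - z)"
        using S[of "p N j" z] z r F0 by (simp add: p_def norm_mult)
      also have "cmod (p N j - z) \<le> 2 * pi * r / N"
      proof -
        have "real j / N - t = (real j - t * N) / N" using N by (simp add: field_simps)
        moreover have "\<bar>real j - t * N\<bar> \<le> 1" using j by linarith
        ultimately have "\<bar>real j / N - t\<bar> \<le> 1 / N"
          using N by (simp add: divide_right_mono)
        moreover have "cmod (p N j - z) = r * cmod (ucirc (real j / N) - ucirc t)"
          using r by (simp add: p_def zt norm_mult flip: right_diff_distrib)
        moreover have "cmod (ucirc (real j / N) - ucirc t) \<le> 2 * pi * \<bar>real j / N - t\<bar>"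
          using cmod_cis_diff_le[of "2 * pi * (real j / N)" "2 * pi * t"]
          unfolding right_diff_distrib[symmetric] by (simp add: abs_mult)
        ultimately have "cmod (p N j - z) \<le> r * (2 * pi * (1 / N))"
          using r by (smt (verit) mult_left_mono pi_gt_zero)
        then show ?thesis by (simp add: mult_ac)
      qed
      finally have "cmod (F \<omega> (p N j)) \<le> Suc S * (2 * pi * r / N)"
        using r by (smt (verit, best) divide_nonneg_nonneg mult_left_mono mult_nonneg_nonneg mult_right_mono of_nat_0_le_iff of_nat_Suc pi_ge_zero)
      \<comment> \<open>The normalizing factor is at most 1, so smallness passes from
        \<open>F\<close> to \<open>normalized\<close>.\<close>
      moreover have "cmod (normalized \<omega> (p N j)) \<le> 1 * cmod (F \<omega> (p N j))"
        unfolding normalized_def norm_mult by (intro mult_right_mono) auto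
      ultimately have "\<omega> \<in> B (real (Suc S)) N"
        using \<omega> jN unfolding B_def by (auto intro!: bexI[of _ j])
      with N show False by simp
    qed
  qed
qed

end

section \<open>Second moments of weighted circle means\<close>

text \<open>Frullani with base point 1 writes \<open>ln x\<close> as the integral of
  \<open>(exp (-s) - exp (-s x)) / s\<close>; the part with \<open>exp (-s)\<close> cancels by
  \<open>zero\<close>, either through the coefficients or through the weight. The bounds
  \<open>a\<close>, \<open>b\<close> only provide a majorant for Fubini. They do not enter the
  conclusion and may therefore depend on the outcome.\<close>

lemma log_combination_le_laplace:
  fixes x :: "nat \<Rightarrow> real \<Rightarrow> real" and w :: "real \<Rightarrow> real" and c :: "nat \<Rightarrow> real"
  assumes K: "finite K" and ab: "0 < a" and x: "\<And>k t. k \<in> K \<Longrightarrow> a \<le> x k t \<and> x k t \<le> b"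
    and [measurable]: "\<And>k. x k \<in> borel_measurable borel" "w \<in> borel_measurable borel"
    and w: "\<And>t. \<bar>w t\<bar> \<le> 1"
    and zero: "(\<Sum>k\<in>K. c k) * (\<integral>t. w t \<partial>unit_interval_measure) = 0"
  shows "ennreal \<bar>\<integral>t. w t * (\<Sum>k\<in>K. c k * ln (x k t)) \<partial>unit_interval_measure\<bar>
    \<le> (\<integral>\<^sup>+s. ennreal (\<bar>\<integral>t. w t * (\<Sum>k\<in>K. c k * exp (- s * x k t)) \<partial>unit_interval_measure\<bar> / s) * indicator {0<..} s \<partial>lborel)"
proof -
  let ?U = unit_interval_measure
  \<comment> \<open>The interval from \<open>m\<close> to \<open>m'\<close> contains both the values
    \<open>x k t\<close> and the base point 1, so \<open>h\<close> dominates all the Frullani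
    integrands.\<close>
  define m where "m = min a 1"
  define m' where "m' = max b 1"
  have m: "0 < m" "m \<le> m'" using ab by (auto simp: m_def m'_def)
  define h where "h = (\<lambda>s. indicator {0<..} s * ((exp (- s * m) - exp (- s * m')) / s))"
  define d where "d = (\<lambda>k s t. indicator {0<..} s * ((exp (- s * 1) - exp (- s * x k t)) / s))"
  define g where "g = (\<lambda>t s. w t * (\<Sum>k\<in>K. c k * d k s t))"
  define C where "C = (\<Sum>k\<in>K. \<bar>c k\<bar>)"
  have [measurable]: "(\<lambda>p. d k (snd p) (fst p)) \<in> borel_measurable (?U \<Otimes>\<^sub>M lborel)" for k
    unfolding d_def by measurable
  have gm [measurable]: "(\<lambda>p. g (fst p) (snd p)) \<in> borel_measurable (?U \<Otimes>\<^sub>M lborel)"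
    unfolding g_def by measurable
  have [measurable]: "h \<in> borel_measurable borel" unfolding h_def by measurable
  have h: "has_bochner_integral lborel h (ln m' - ln m)"
    unfolding h_def by (rule has_bochner_integral_frullani) (use m in auto)
  have h0: "0 \<le> h s" for s
    using m by (auto simp: h_def split: split_indicator intro!: divide_nonneg_pos)
  have d_le: "\<bar>d k s t\<bar> \<le> h s" if "k \<in> K" for k s t
  proof (cases "s > 0")
    case True
    have "m \<le> x k t" "x k t \<le> m'" "m \<le> 1" "1 \<le> m'" using x[OF that, of t] by (auto simp: m_def m'_def)
    then have "exp (- s * m') \<le> exp (- s * x k t)" "exp (- s * x k t) \<le> exp (- s * m)"
        "exp (- s * m') \<le> exp (- s * 1)" "exp (- s * 1) \<le> exp (- s * m)"
      using True by auto
    then have "\<bar>exp (- s * 1) - exp (- s * x k t)\<bar> \<le> exp (- s * m) - exp (- s * m')"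
      unfolding abs_le_iff by linarith
    then show ?thesis using True by (simp add: d_def h_def divide_right_mono)
  qed (simp add: d_def h_def)
  have C0: "C \<ge> 0" by (simp add: C_def sum_nonneg)
  have g_le: "\<bar>g t s\<bar> \<le> C * h s" for t s
  proof -
    have "\<bar>g t s\<bar> \<le> 1 * (\<Sum>k\<in>K. \<bar>c k * d k s t\<bar>)"
      unfolding g_def abs_mult[of "w t"] by (intro mult_mono w sum_abs) auto
    also have "\<dots> \<le> (\<Sum>k\<in>K. \<bar>c k\<bar> * h s)"
      by (simp add: abs_mult) (intro sum_mono mult_left_mono d_le, auto)
    finally show ?thesis by (simp add: C_def sum_distrib_right)
  qed
  have int_g: "integrable (?U \<Otimes>\<^sub>M lborel) (\<lambda>(t, s). g t s)"
  proof (rule integrableI_bounded)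
    have "(\<integral>\<^sup>+p. ennreal (norm (case p of (t, s) \<Rightarrow> g t s)) \<partial>(?U \<Otimes>\<^sub>M lborel)) = (\<integral>\<^sup>+t. \<integral>\<^sup>+s. ennreal \<bar>g t s\<bar> \<partial>lborel \<partial>?U)"
      by (subst lborel.nn_integral_fst[symmetric]) (auto simp: split_beta')
    also have "\<dots> \<le> (\<integral>\<^sup>+t. \<integral>\<^sup>+s. ennreal (C * h s) \<partial>lborel \<partial>?U)"
      by (intro nn_integral_mono ennreal_leI g_le)
    also have "\<dots> = (\<integral>\<^sup>+s. ennreal (C * h s) \<partial>lborel)"
      using unit_interval.emeasure_space_1 by simp
    also have "\<dots> < \<infinity>"
    proof -
      have "integrable lborel (\<lambda>s. C * h s)" using h by (auto simp: has_bochner_integral_iff)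
      then show ?thesis
        by (simp only: integrable_iff_bounded real_norm_def abs_of_nonneg[OF mult_nonneg_nonneg[OF C0 h0]])
    qed
    finally show "(\<integral>\<^sup>+p. ennreal (norm (case p of (t, s) \<Rightarrow> g t s)) \<partial>(?U \<Otimes>\<^sub>M lborel)) < \<infinity>" .
  qed (use gm in \<open>simp add: split_beta'\<close>)
  interpret P: pair_sigma_finite ?U lborel ..
  have d_int: "has_bochner_integral lborel (\<lambda>s. d k s t) (ln (x k t))" if "k \<in> K" for k t
    using has_bochner_integral_frullani[of 1 "x k t"] x[OF that, of t] ab unfolding d_def by simp
  have "(\<integral>t. w t * (\<Sum>k\<in>K. c k * ln (x k t)) \<partial>?U) = (\<integral>t. \<integral>s. g t s \<partial>lborel \<partial>?U)"
  proof (rule Bochner_Integration.integral_cong[OF refl])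
    fix t
    have "has_bochner_integral lborel (\<lambda>s. g t s) (w t * (\<Sum>k\<in>K. c k * ln (x k t)))"
      unfolding g_def by (intro has_bochner_integral_mult_right has_bochner_integral_sum d_int)
    then show "w t * (\<Sum>k\<in>K. c k * ln (x k t)) = (\<integral>s. g t s \<partial>lborel)"
      by (simp add: has_bochner_integral_iff)
  qed
  also have "\<dots> = (\<integral>s. \<integral>t. g t s \<partial>?U \<partial>lborel)"
    by (rule P.Fubini_integral[OF int_g, symmetric])
  finally have eq: "(\<integral>t. w t * (\<Sum>k\<in>K. c k * ln (x k t)) \<partial>?U) = (\<integral>s. \<integral>t. g t s \<partial>?U \<partial>lborel)" .
  have inner: "\<bar>\<integral>t. g t s \<partial>?U\<bar> = \<bar>\<integral>t. w t * (\<Sum>k\<in>K. c k * exp (- s * x k t)) \<partial>?U\<bar> / s * indicator {0<..} s" for s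
  proof (cases "s > 0")
    case True
    have i1: "integrable ?U w" by (rule unit_interval.integrable_const_bound[of _ 1]) (use w in auto)
    have i2: "integrable ?U (\<lambda>t. w t * (\<Sum>k\<in>K. c k * exp (- s * x k t)))"
    proof (rule unit_interval.integrable_const_bound[of _ C])
      have "\<bar>w t * (\<Sum>k\<in>K. c k * exp (- s * x k t))\<bar> \<le> 1 * (\<Sum>k\<in>K. \<bar>c k\<bar> * 1)" for t
        unfolding abs_mult
      proof (intro mult_mono w order_trans[OF sum_abs] sum_mono)
        fix k assume "k \<in> K"
        then have "exp (- s * x k t) \<le> 1" using True x[of k t] ab by auto
        then show "\<bar>c k * exp (- s * x k t)\<bar> \<le> \<bar>c k\<bar> * 1" by (simp add: abs_mult mult_left_le)
      qed auto
      then show "AE t in ?U. norm (w t * (\<Sum>k\<in>K. c k * exp (- s * x k t))) \<le> C" by (simp add: C_def)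
    qed simp
    have "(\<integral>t. g t s \<partial>?U) = (\<integral>t. exp (- s) / s * (\<Sum>k\<in>K. c k) * w t - 1 / s * (w t * (\<Sum>k\<in>K. c k * exp (- s * x k t))) \<partial>?U)"
      using True by (intro Bochner_Integration.integral_cong refl)
        (simp add: g_def d_def sum_distrib_left sum_distrib_right diff_divide_distrib right_diff_distrib sum_subtractf sum_divide_distrib mult_ac)
    also have "\<dots> = exp (- s) / s * ((\<Sum>k\<in>K. c k) * (\<integral>t. w t \<partial>?U)) - 1 / s * (\<integral>t. w t * (\<Sum>k\<in>K. c k * exp (- s * x k t)) \<partial>?U)"
      using i1 i2 by (subst Bochner_Integration.integral_diff) auto
    also have "\<dots> = - (1 / s * (\<integral>t. w t * (\<Sum>k\<in>K. c k * exp (- s * x k t)) \<partial>?U))"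
      unfolding zero by simp
    finally show ?thesis using True by (simp add: abs_mult)
  qed (simp add: g_def d_def)
  have "ennreal \<bar>\<integral>t. w t * (\<Sum>k\<in>K. c k * ln (x k t)) \<partial>?U\<bar> \<le> (\<integral>\<^sup>+s. ennreal \<bar>\<integral>t. g t s \<partial>?U\<bar> \<partial>lborel)"
    unfolding eq using integral_norm_bound_ennreal[OF P.integrable_snd[OF int_g]] by simp
  also have "\<dots> = (\<integral>\<^sup>+s. ennreal (\<bar>\<integral>t. w t * (\<Sum>k\<in>K. c k * exp (- s * x k t)) \<partial>?U\<bar> / s) * indicator {0<..} s \<partial>lborel)"
    unfolding inner by (intro nn_integral_cong) (auto split: split_indicator)
  finally show ?thesis .
qed

text \<open>The antiderivative is \<open>- 2 / sqrt (1 + s)\<close>.\<close>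

lemma laplace_weight_integral:
  "(\<integral>\<^sup>+s. ennreal (1 / ((1 + s) * sqrt (1 + s))) * indicator {0<..} s \<partial>lborel) = (2 :: ennreal)"
proof -
  define f where "f = (\<lambda>s :: real. 1 / ((1 + s) * sqrt (1 + s)))"
  have "(\<integral>\<^sup>+s. ennreal (f s) * indicator {0<..} s \<partial>lborel) = (\<integral>\<^sup>+s. ennreal (f s) * indicator {0..} s \<partial>lborel)"
    by (intro nn_integral_cong_AE AE_I[of _ _ "{0}"]) (auto split: split_indicator)
  also have "\<dots> = ennreal (0 - - 2 / sqrt (1 + 0))"
  proof (rule nn_integral_FTC_atLeast)
    fix s :: real assume s: "0 \<le> s"
    then have "sqrt (1 + s) * sqrt (1 + s) = 1 + s" by simp
    then show "((\<lambda>s. - 2 / sqrt (1 + s)) has_real_derivative f s) (at s)"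
      using s unfolding f_def
      by (auto intro!: derivative_eq_intros simp: field_simps)
    show "f s \<ge> 0" using s by (simp add: f_def)
  next
    show "((\<lambda>s. - 2 / sqrt (1 + s)) \<longlongrightarrow> 0) at_top" by real_asymp
  qed (simp add: f_def)
  finally show ?thesis by (simp add: f_def)
qed

text \<open>The radial factor splits off, and the angular part is the sine integral with
  \<open>\<kappa> = 4 * k * l\<close>. Its size \<open>1 / sqrt (k * l)\<close> is the proportion of
  the circles on which the two values interact.\<close>

lemma circle_correlation_le:
  fixes k l :: real assumes kl: "k > 0" "l > 0"
  shows "(\<integral>p. exp (- (cmod (of_real k * cis (2 * pi * fst p) - of_real l * cis (2 * pi * snd p)))\<^sup>2)
     \<partial>(unit_interval_measure \<Otimes>\<^sub>M unit_interval_measure)) \<le> exp (- (k - l)\<^sup>2) * (3 / 2 * sqrt pi / sqrt (k * l))"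
proof -
  let ?U = unit_interval_measure
  define f where "f = (\<lambda>p :: real \<times> real. exp (- (4 * k * l) * (sin (pi * (fst p - snd p)))\<^sup>2))"
  have [measurable]: "f \<in> borel_measurable (?U \<Otimes>\<^sub>M ?U)" unfolding f_def by measurable
  have *: "exp (- (cmod (of_real k * cis (2 * pi * fst p) - of_real l * cis (2 * pi * snd p)))\<^sup>2) = exp (- (k - l)\<^sup>2) * f p" for p
  proof -
    have "(2 * pi * fst p - 2 * pi * snd p) / 2 = pi * (fst p - snd p)" by (simp add: field_simps)
    then show ?thesis unfolding cmod_diff_circles f_def by (simp add: mult_exp_exp)
  qed
  have "(\<integral>\<^sup>+p. ennreal (f p) \<partial>(?U \<Otimes>\<^sub>M ?U)) \<le> ennreal (3 * sqrt (pi / (4 * k * l)))"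
    using nn_integral_exp_sin_le[of "4 * k * l"] kl
    by (subst unit_interval.nn_integral_fst[symmetric]) (auto simp: f_def)
  then have "(\<integral>p. f p \<partial>(?U \<Otimes>\<^sub>M ?U)) \<le> 3 * sqrt (pi / (4 * k * l))"
    using kl by (subst integral_eq_nn_integral) (auto simp: f_def intro!: enn2real_leI)
  also have "\<dots> = 3 / 2 * sqrt pi / sqrt (k * l)"
    by (simp add: real_sqrt_divide real_sqrt_mult)
  finally have "exp (- (k - l)\<^sup>2) * (\<integral>p. f p \<partial>(?U \<Otimes>\<^sub>M ?U)) \<le> exp (- (k - l)\<^sup>2) * (3 / 2 * sqrt pi / sqrt (k * l))"
    by (rule mult_left_mono) simp
  then show ?thesis unfolding * by simp
qed

definition circle_energy :: "nat set \<Rightarrow> (nat \<Rightarrow> real) \<Rightarrow> real" where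
  "circle_energy K c = (\<Sum>k\<in>K. \<Sum>l\<in>K. \<bar>c k\<bar> * \<bar>c l\<bar> * exp (- (real k - real l)\<^sup>2) / sqrt (real k * real l))"

text \<open>The left side is the covariance of two Laplace terms with squared correlation
  \<open>q\<close>. The factor \<open>s^2\<close> absorbs the singularity \<open>1 / s^2\<close>
  that Frullani brings; the remaining \<open>1 / ((1 + s)^2 * (1 + 2 * s))\<close> decays fast
  enough to be integrated against \<open>(1 + s) powr (3/2)\<close>.\<close>

lemma laplace_covariance_le:
  fixes s q :: real assumes s: "s \<ge> 0" and q: "0 \<le> q" "q \<le> 1"
  shows "\<bar>1 / ((1 + s)\<^sup>2 - s\<^sup>2 * q) - 1 / (1 + s)\<^sup>2\<bar> \<le> s\<^sup>2 / ((1 + s)\<^sup>2 * (1 + 2 * s)) * q"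
proof -
  have le: "1 + 2 * s \<le> (1 + s)\<^sup>2 - s\<^sup>2 * q"
    using mult_left_mono[OF q(2), of "s\<^sup>2"] by (simp add: power2_eq_square algebra_simps)
  then have pos: "(1 + s)\<^sup>2 - s\<^sup>2 * q > 0" using s by linarith
  have "1 / ((1 + s)\<^sup>2 - s\<^sup>2 * q) - 1 / (1 + s)\<^sup>2 = (s\<^sup>2 * q) / ((1 + s)\<^sup>2 * ((1 + s)\<^sup>2 - s\<^sup>2 * q))"
    using pos s by (subst diff_frac_eq) (auto simp: mult.commute)
  moreover have "0 \<le> (s\<^sup>2 * q) / ((1 + s)\<^sup>2 * ((1 + s)\<^sup>2 - s\<^sup>2 * q))"
    using pos q by simp
  moreover have "(s\<^sup>2 * q) / ((1 + s)\<^sup>2 * ((1 + s)\<^sup>2 - s\<^sup>2 * q)) \<le> (s\<^sup>2 * q) / ((1 + s)\<^sup>2 * (1 + 2 * s))"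
    using le pos q s by (intro divide_left_mono mult_left_mono mult_pos_pos) auto
  ultimately have "\<bar>1 / ((1 + s)\<^sup>2 - s\<^sup>2 * q) - 1 / (1 + s)\<^sup>2\<bar> \<le> (s\<^sup>2 * q) / ((1 + s)\<^sup>2 * (1 + 2 * s))"
    by linarith
  then show ?thesis by simp
qed

section \<open>Second moments at a fixed Laplace parameter\<close>

context gaf_process begin

text \<open>The weight \<open>w\<close> is 1 for the number of zeros, and cosine or sine of the
  angle for their sum.\<close>

definition circle_laplace :: "nat set \<Rightarrow> (nat \<Rightarrow> real) \<Rightarrow> (real \<Rightarrow> real) \<Rightarrow> 'w \<Rightarrow> real \<Rightarrow> real" where
  "circle_laplace K c w \<omega> s = (\<integral>t. w t * (\<Sum>k\<in>K. c k * exp (- s * (cmod (normalized \<omega> (of_nat k * ucirc t)))\<^sup>2)) \<partial>unit_interval_measure)"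

lemma measurable_ucirc [measurable]: "(\<lambda>t. of_nat k * ucirc t) \<in> borel_measurable borel"
  by (intro borel_measurable_continuous_onI continuous_intros)

lemma measurable_circle_laplace [measurable]:
  assumes [measurable]: "w \<in> borel_measurable borel"
  shows "(\<lambda>p. circle_laplace K c w (fst p) (snd p)) \<in> borel_measurable (M \<Otimes>\<^sub>M lborel)"
proof -
  have [measurable]: "(\<lambda>x. normalized (fst (fst x)) (of_nat k * ucirc (snd x))) \<in> borel_measurable ((M \<Otimes>\<^sub>M lborel) \<Otimes>\<^sub>M unit_interval_measure)" for k
  proof -
    have "(\<lambda>x. (fst (fst x), snd x)) \<in> ((M \<Otimes>\<^sub>M lborel) \<Otimes>\<^sub>M unit_interval_measure) \<rightarrow>\<^sub>M (M \<Otimes>\<^sub>M borel)" by measurable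
    from measurable_compose[OF this measurable_normalized[OF measurable_ucirc[of k]]] show ?thesis by simp
  qed
  show ?thesis unfolding circle_laplace_def
    by (rule unit_interval.borel_measurable_lebesgue_integral) measurable
qed

lemma abs_circle_laplace_le:
  assumes w: "\<And>t. \<bar>w t\<bar> \<le> 1" and s: "s \<ge> 0"
  shows "\<bar>circle_laplace K c w \<omega> s\<bar> \<le> (\<Sum>k\<in>K. \<bar>c k\<bar>)"
proof -
  define f where "f = (\<lambda>t. w t * (\<Sum>k\<in>K. c k * exp (- s * (cmod (normalized \<omega> (of_nat k * ucirc t)))\<^sup>2)))"
  have f: "\<bar>f t\<bar> \<le> (\<Sum>k\<in>K. \<bar>c k\<bar>)" for t
  proof -
    have "\<bar>f t\<bar> \<le> 1 * (\<Sum>k\<in>K. \<bar>c k\<bar> * 1)"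
      unfolding f_def abs_mult[of "w t"]
      by (intro mult_mono w order_trans[OF sum_abs] sum_mono) (use s in \<open>auto simp: abs_mult mult_left_le\<close>)
    then show ?thesis by simp
  qed
  show ?thesis
  proof (cases "integrable unit_interval_measure f")
    case True
    have "\<bar>integral\<^sup>L unit_interval_measure f\<bar> \<le> integral\<^sup>L unit_interval_measure (\<lambda>t. \<bar>f t\<bar>)"
      by (rule integral_abs_bound)
    also have "\<dots> \<le> (\<Sum>k\<in>K. \<bar>c k\<bar>)"
      by (rule unit_interval.integral_le_const) (use f True in auto)
    finally show ?thesis by (simp add: circle_laplace_def f_def)
  next
    case False
    then have "circle_laplace K c w \<omega> s = 0"
      by (simp add: circle_laplace_def f_def not_integrable_integral_eq)
    then show ?thesis by (simp add: sum_nonneg)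
  qed
qed

text \<open>The square is a double integral over pairs of circle points, and Fubini moves the
  expectation inside. The product of the marginal expectations is \<open>1 / (1 + s)^2\<close> for
  every pair; by \<open>zero\<close> it contributes nothing, so only covariances are left.\<close>

lemma second_moment_circle_laplace:
  assumes K: "finite K" "\<And>k. k \<in> K \<Longrightarrow> k > 0" and [measurable]: "w \<in> borel_measurable borel"
    and w: "\<And>t. \<bar>w t\<bar> \<le> 1" and s: "s \<ge> 0"
    and zero: "(\<Sum>k\<in>K. c k) * (\<integral>t. w t \<partial>unit_interval_measure) = 0"
  shows "expectation (\<lambda>\<omega>. (circle_laplace K c w \<omega> s)\<^sup>2)
    \<le> s\<^sup>2 / ((1 + s)\<^sup>2 * (1 + 2 * s)) * (3 / 2 * sqrt pi * circle_energy K c)"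
proof -
  let ?U = unit_interval_measure
  interpret U2: prob_space "?U \<Otimes>\<^sub>M ?U" by (rule prob_space_pair) unfold_locales
  interpret P: pair_prob_space M "?U \<Otimes>\<^sub>M ?U" ..
  interpret Q: pair_prob_space ?U ?U ..
  define z where "z = (\<lambda>k t. of_nat k * ucirc t)"
  define e where "e = (\<lambda>\<omega> k t. exp (- s * (cmod (normalized \<omega> (z k t)))\<^sup>2))"
  define g where "g = (\<lambda>\<omega> t. w t * (\<Sum>k\<in>K. c k * e \<omega> k t))"
  define C where "C = (\<Sum>k\<in>K. \<bar>c k\<bar>)"
  have [measurable]: "z k \<in> borel_measurable borel" for k unfolding z_def by measurable
  have [measurable]: "(\<lambda>\<omega>. e \<omega> k t) \<in> borel_measurable M" for k t unfolding e_def by measurable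
  have nm: "(\<lambda>p. normalized (fst p) (z k (snd p))) \<in> borel_measurable (M \<Otimes>\<^sub>M ?U)" for k by measurable
  have em [measurable]: "(\<lambda>p. e (fst p) k (snd p)) \<in> borel_measurable (M \<Otimes>\<^sub>M ?U)" for k
    unfolding e_def using nm by measurable
  have gm [measurable]: "(\<lambda>p. g (fst p) (snd p)) \<in> borel_measurable (M \<Otimes>\<^sub>M ?U)"
    unfolding g_def by measurable
  have [measurable]: "(\<lambda>p. g (fst p) (fst (snd p))) \<in> borel_measurable (M \<Otimes>\<^sub>M (?U \<Otimes>\<^sub>M ?U))"
    using measurable_compose[of "\<lambda>p. (fst p, fst (snd p))" "M \<Otimes>\<^sub>M (?U \<Otimes>\<^sub>M ?U)" "M \<Otimes>\<^sub>M ?U", OF _ gm] by simp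
  have [measurable]: "(\<lambda>p. g (fst p) (snd (snd p))) \<in> borel_measurable (M \<Otimes>\<^sub>M (?U \<Otimes>\<^sub>M ?U))"
    using measurable_compose[of "\<lambda>p. (fst p, snd (snd p))" "M \<Otimes>\<^sub>M (?U \<Otimes>\<^sub>M ?U)" "M \<Otimes>\<^sub>M ?U", OF _ gm] by simp
  have [measurable]: "g \<omega> \<in> borel_measurable borel" if "\<omega> \<in> space M" for \<omega>
    using measurable_Pair2[OF gm that] by simp
  have e01: "0 \<le> e \<omega> k t" "e \<omega> k t \<le> 1" for \<omega> k t using s by (auto simp: e_def)
  have C0: "0 \<le> C" by (simp add: C_def sum_nonneg)
  have g_le: "\<bar>g \<omega> t\<bar> \<le> C" for \<omega> t
  proof -
    have "\<bar>g \<omega> t\<bar> \<le> 1 * (\<Sum>k\<in>K. \<bar>c k * e \<omega> k t\<bar>)"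
      unfolding g_def abs_mult[of "w t"] by (intro mult_mono w sum_abs) auto
    also have "\<dots> \<le> C"
      using e01 unfolding C_def by (simp add: abs_mult) (intro sum_mono, simp add: mult_left_le)
    finally show ?thesis .
  qed
  have gg_le: "\<bar>g \<omega> t * g \<omega> t'\<bar> \<le> C * C" for \<omega> t t'
    unfolding abs_mult by (intro mult_mono g_le) (use C0 in auto)
  define L where "L = (\<lambda>k l t t'. 1 / ((1 + s)\<^sup>2 - s\<^sup>2 * exp (- (cmod (z k t - z l t'))\<^sup>2)))"
  define R where "R = (\<lambda>p. \<Sum>k\<in>K. \<Sum>l\<in>K. \<bar>c k\<bar> * \<bar>c l\<bar> * exp (- (cmod (z k (fst p) - z l (snd p)))\<^sup>2))"
  have sq: "(circle_laplace K c w \<omega> s)\<^sup>2 = (\<integral>p. g \<omega> (fst p) * g \<omega> (snd p) \<partial>(?U \<Otimes>\<^sub>M ?U))" if "\<omega> \<in> space M" for \<omega>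
  proof -
    note [measurable] = \<open>\<omega> \<in> space M \<Longrightarrow> g \<omega> \<in> borel_measurable borel\<close>[OF that]
    have int: "integrable (?U \<Otimes>\<^sub>M ?U) (\<lambda>p. g \<omega> (fst p) * g \<omega> (snd p))"
      by (rule U2.integrable_const_bound[of _ "C * C"]) (use gg_le in auto)
    have "circle_laplace K c w \<omega> s = (\<integral>t. g \<omega> t \<partial>?U)"
      by (simp add: circle_laplace_def g_def e_def z_def)
    then show ?thesis using Q.integral_fst'[OF int] by (simp add: power2_eq_square)
  qed
  have Eg: "expectation (\<lambda>\<omega>. g \<omega> t * g \<omega> t') = w t * w t' * (\<Sum>k\<in>K. \<Sum>l\<in>K. c k * c l * L k l t t')" for t t'
  proof -
    have int: "integrable M (\<lambda>\<omega>. e \<omega> k t * e \<omega> l t')" for k l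
      by (rule integrable_const_bound[of _ 1]) (use e01 in \<open>auto simp: mult_le_one\<close>)
    have EE: "expectation (\<lambda>\<omega>. e \<omega> k t * e \<omega> l t') = L k l t t'" for k l
      using laplace_normalized[OF s, of "z k t" "z l t'"] by (simp add: e_def L_def mult_exp_exp distrib_left)
    have "expectation (\<lambda>\<omega>. g \<omega> t * g \<omega> t') = expectation (\<lambda>\<omega>. w t * w t' * (\<Sum>k\<in>K. \<Sum>l\<in>K. c k * c l * (e \<omega> k t * e \<omega> l t')))"
      by (intro Bochner_Integration.integral_cong refl) (simp add: g_def sum_product mult_ac sum_distrib_left)
    also have "\<dots> = w t * w t' * (\<Sum>k\<in>K. \<Sum>l\<in>K. c k * c l * expectation (\<lambda>\<omega>. e \<omega> k t * e \<omega> l t'))"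
      using int by (simp add: Bochner_Integration.integral_sum)
    finally show ?thesis unfolding EE .
  qed
  have q01: "0 \<le> exp (- (cmod u)\<^sup>2)" "exp (- (cmod u)\<^sup>2) \<le> 1" for u :: complex by auto
  have L_diff: "\<bar>w t * w t' * (\<Sum>k\<in>K. \<Sum>l\<in>K. c k * c l * L k l t t') - w t * w t' * ((\<Sum>k\<in>K. c k)\<^sup>2 / (1 + s)\<^sup>2)\<bar>
      \<le> s\<^sup>2 / ((1 + s)\<^sup>2 * (1 + 2 * s)) * R (t, t')" for t t'
  proof -
    have "w t * w t' * (\<Sum>k\<in>K. \<Sum>l\<in>K. c k * c l * L k l t t') - w t * w t' * ((\<Sum>k\<in>K. c k)\<^sup>2 / (1 + s)\<^sup>2)
       = (w t * w t') * (\<Sum>k\<in>K. \<Sum>l\<in>K. c k * c l * (L k l t t' - 1 / (1 + s)\<^sup>2))"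
      by (simp add: power2_eq_square sum_product right_diff_distrib sum_subtractf sum_divide_distrib)
    also have "\<bar>\<dots>\<bar> \<le> 1 * (\<Sum>k\<in>K. \<Sum>l\<in>K. \<bar>c k * c l * (L k l t t' - 1 / (1 + s)\<^sup>2)\<bar>)"
      unfolding abs_mult[of "w t * w t'"]
      by (intro mult_mono order_trans[OF sum_abs] sum_mono) (use w in \<open>auto simp: abs_mult mult_le_one\<close>)
    also have "\<dots> \<le> (\<Sum>k\<in>K. \<Sum>l\<in>K. \<bar>c k\<bar> * \<bar>c l\<bar> * (s\<^sup>2 / ((1 + s)\<^sup>2 * (1 + 2 * s)) * exp (- (cmod (z k t - z l t'))\<^sup>2)))"
      unfolding mult_1 abs_mult L_def
      by (intro sum_mono mult_left_mono laplace_covariance_le s q01) auto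
    also have "\<dots> = s\<^sup>2 / ((1 + s)\<^sup>2 * (1 + 2 * s)) * R (t, t')"
      by (simp add: R_def sum_distrib_left mult_ac)
    finally show ?thesis .
  qed
  have Lm [measurable]: "(\<lambda>p. L k l (fst p) (snd p)) \<in> borel_measurable (?U \<Otimes>\<^sub>M ?U)" for k l
    unfolding L_def by measurable
  have Rm [measurable]: "R \<in> borel_measurable (?U \<Otimes>\<^sub>M ?U)" unfolding R_def by measurable
  have "expectation (\<lambda>\<omega>. (circle_laplace K c w \<omega> s)\<^sup>2) = (\<integral>\<omega>. \<integral>p. g \<omega> (fst p) * g \<omega> (snd p) \<partial>(?U \<Otimes>\<^sub>M ?U) \<partial>M)"
    by (intro Bochner_Integration.integral_cong refl sq)
  also have "\<dots> = (\<integral>p. \<integral>\<omega>. g \<omega> (fst p) * g \<omega> (snd p) \<partial>M \<partial>(?U \<Otimes>\<^sub>M ?U))"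
  proof (rule P.Fubini_integral[symmetric])
    show "integrable (M \<Otimes>\<^sub>M (?U \<Otimes>\<^sub>M ?U)) (\<lambda>(\<omega>, p). g \<omega> (fst p) * g \<omega> (snd p))"
      by (rule P.integrable_const_bound[of _ "C * C"]) (use gg_le in \<open>auto simp: split_beta'\<close>)
  qed
  also have "\<dots> = (\<integral>p. w (fst p) * w (snd p) * (\<Sum>k\<in>K. \<Sum>l\<in>K. c k * c l * L k l (fst p) (snd p)) \<partial>(?U \<Otimes>\<^sub>M ?U))"
    unfolding Eg ..
  \<comment> \<open>The subtracted term integrates to
    \<open>((\<Sum> c k) * (integral of w))^2 / (1 + s)^2 = 0\<close>. It turns mixed moments into
    covariances.\<close>
  also have "\<dots> = (\<integral>p. w (fst p) * w (snd p) * (\<Sum>k\<in>K. \<Sum>l\<in>K. c k * c l * L k l (fst p) (snd p)) - w (fst p) * w (snd p) * ((\<Sum>k\<in>K. c k)\<^sup>2 / (1 + s)\<^sup>2) \<partial>(?U \<Otimes>\<^sub>M ?U))"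
  proof -
    have ww: "integrable (?U \<Otimes>\<^sub>M ?U) (\<lambda>p. w (fst p) * w (snd p))"
      by (rule U2.integrable_const_bound[of _ 1]) (use w in \<open>auto simp: abs_mult mult_le_one\<close>)
    have LL: "integrable (?U \<Otimes>\<^sub>M ?U) (\<lambda>p. w (fst p) * w (snd p) * (\<Sum>k\<in>K. \<Sum>l\<in>K. c k * c l * L k l (fst p) (snd p)))"
    proof (rule U2.integrable_const_bound[of _ "C * C"])
      have "\<bar>expectation (\<lambda>\<omega>. g \<omega> t * g \<omega> t')\<bar> \<le> C * C" for t t'
      proof -
        have "integrable M (\<lambda>\<omega>. g \<omega> t * g \<omega> t')"
          by (rule integrable_const_bound[of _ "C * C"]) (use gg_le in \<open>auto simp: g_def\<close>)
        then have "\<bar>expectation (\<lambda>\<omega>. g \<omega> t * g \<omega> t')\<bar> \<le> expectation (\<lambda>\<omega>. C * C)"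
          by (intro order_trans[OF integral_abs_bound] integral_mono) (use gg_le in auto)
        then show ?thesis by (simp add: prob_space)
      qed
      then show "AE p in ?U \<Otimes>\<^sub>M ?U. norm (w (fst p) * w (snd p) * (\<Sum>k\<in>K. \<Sum>l\<in>K. c k * c l * L k l (fst p) (snd p))) \<le> C * C"
        unfolding Eg by simp
    qed simp
    have "(\<integral>p. w (fst p) * w (snd p) * ((\<Sum>k\<in>K. c k)\<^sup>2 / (1 + s)\<^sup>2) \<partial>(?U \<Otimes>\<^sub>M ?U)) = ((\<Sum>k\<in>K. c k) * (\<integral>t. w t \<partial>?U))\<^sup>2 / (1 + s)\<^sup>2"
      using Q.integral_fst'[OF ww] by (simp add: power2_eq_square mult_ac)
    then have "(\<integral>p. w (fst p) * w (snd p) * ((\<Sum>k\<in>K. c k)\<^sup>2 / (1 + s)\<^sup>2) \<partial>(?U \<Otimes>\<^sub>M ?U)) = 0"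
      unfolding zero by simp
    then show ?thesis using LL ww by (subst Bochner_Integration.integral_diff) auto
  qed
  also have "\<dots> \<le> (\<integral>p. s\<^sup>2 / ((1 + s)\<^sup>2 * (1 + 2 * s)) * R p \<partial>(?U \<Otimes>\<^sub>M ?U))"
  proof (rule integral_mono')
    show iR: "integrable (?U \<Otimes>\<^sub>M ?U) (\<lambda>p. s\<^sup>2 / ((1 + s)\<^sup>2 * (1 + 2 * s)) * R p)"
      unfolding R_def by (intro integrable_mult_right Bochner_Integration.integrable_sum U2.integrable_const_bound[of _ 1]) auto
  next
    fix p :: "real \<times> real"
    show "w (fst p) * w (snd p) * (\<Sum>k\<in>K. \<Sum>l\<in>K. c k * c l * L k l (fst p) (snd p)) - w (fst p) * w (snd p) * ((\<Sum>k\<in>K. c k)\<^sup>2 / (1 + s)\<^sup>2)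
       \<le> s\<^sup>2 / ((1 + s)\<^sup>2 * (1 + 2 * s)) * R p"
      using L_diff[of "fst p" "snd p"] by simp
    show "0 \<le> s\<^sup>2 / ((1 + s)\<^sup>2 * (1 + 2 * s)) * R p"
    proof (rule mult_nonneg_nonneg)
      show "0 \<le> R p" unfolding R_def by (intro sum_nonneg mult_nonneg_nonneg) auto
    qed (use s in auto)
  qed
  also have "\<dots> = s\<^sup>2 / ((1 + s)\<^sup>2 * (1 + 2 * s)) * (\<Sum>k\<in>K. \<Sum>l\<in>K. \<bar>c k\<bar> * \<bar>c l\<bar> * (\<integral>p. exp (- (cmod (z k (fst p) - z l (snd p)))\<^sup>2) \<partial>(?U \<Otimes>\<^sub>M ?U)))"
  proof -
    have "integrable (?U \<Otimes>\<^sub>M ?U) (\<lambda>p. exp (- (cmod (z k (fst p) - z l (snd p)))\<^sup>2))" for k l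
      by (rule U2.integrable_const_bound[of _ 1]) auto
    then show ?thesis by (simp add: R_def Bochner_Integration.integral_sum)
  qed
  also have "\<dots> \<le> s\<^sup>2 / ((1 + s)\<^sup>2 * (1 + 2 * s)) * (\<Sum>k\<in>K. \<Sum>l\<in>K. \<bar>c k\<bar> * \<bar>c l\<bar> * (exp (- (real k - real l)\<^sup>2) * (3 / 2 * sqrt pi / sqrt (real k * real l))))"
  proof (intro mult_left_mono sum_mono)
    fix k l assume "k \<in> K" "l \<in> K"
    then show "(\<integral>p. exp (- (cmod (z k (fst p) - z l (snd p)))\<^sup>2) \<partial>(?U \<Otimes>\<^sub>M ?U)) \<le> exp (- (real k - real l)\<^sup>2) * (3 / 2 * sqrt pi / sqrt (real k * real l))"
      using circle_correlation_le[of "real k" "real l"] K(2)[of k] K(2)[of l] by (simp add: z_def)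
  qed (use s in auto)
  also have "(\<Sum>k\<in>K. \<Sum>l\<in>K. \<bar>c k\<bar> * \<bar>c l\<bar> * (exp (- (real k - real l)\<^sup>2) * (3 / 2 * sqrt pi / sqrt (real k * real l))))
     = 3 / 2 * sqrt pi * circle_energy K c"
    by (simp add: circle_energy_def sum_distrib_left mult_ac)
  finally show ?thesis .
qed

end

section \<open>From Laplace terms to the logarithm\<close>

context gaf_process begin

text \<open>The squared modulus is what the exponentials see. On the circle of radius
  \<open>k\<close> the logarithm is \<open>2 * ln |F| - k^2\<close> wherever \<open>F\<close> does
  not vanish.\<close>

definition circle_log :: "nat set \<Rightarrow> (nat \<Rightarrow> real) \<Rightarrow> (real \<Rightarrow> real) \<Rightarrow> 'w \<Rightarrow> real" where
  "circle_log K c w \<omega> = (\<integral>t. w t * (\<Sum>k\<in>K. c k * ln ((cmod (normalized \<omega> (of_nat k * ucirc t)))\<^sup>2)) \<partial>unit_interval_measure)"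

text \<open>On each circle the normalized modulus is continuous and nonzero, so compactness gives
  positive bounds, which may depend on \<open>\<omega>\<close>.\<close>

lemma circle_log_le_circle_laplace:
  assumes K: "finite K" and [measurable]: "w \<in> borel_measurable borel"
    and w: "\<And>t. \<bar>w t\<bar> \<le> 1"
    and zero: "(\<Sum>k\<in>K. c k) * (\<integral>t. w t \<partial>unit_interval_measure) = 0"
    and g: "decaying_coeffs \<omega>" and nz: "\<And>k z. k \<in> K \<Longrightarrow> cmod z = real k \<Longrightarrow> F \<omega> z \<noteq> 0"
  shows "ennreal \<bar>circle_log K c w \<omega>\<bar> \<le> (\<integral>\<^sup>+s. ennreal (\<bar>circle_laplace K c w \<omega> s\<bar> / s) * indicator {0<..} s \<partial>lborel)"
proof -
  define x where "x = (\<lambda>k t. (cmod (normalized \<omega> (of_nat k * ucirc t)))\<^sup>2)"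
  have cF: "continuous_on UNIV (F \<omega>)"
    using decaying_coeffs_holomorphic[OF g] by (rule holomorphic_on_imp_continuous_on)
  have cN: "continuous_on A (\<lambda>z. (cmod (normalized \<omega> z))\<^sup>2)" for A
    unfolding normalized_def by (intro continuous_intros continuous_on_subset[OF cF]) auto
  have cx: "continuous_on UNIV (x k)" for k
    unfolding x_def by (intro continuous_on_compose2[OF cN[of UNIV]] continuous_intros) auto
  have "\<exists>a b. 0 < a \<and> (\<forall>t. a \<le> x k t \<and> x k t \<le> b)" if k: "k \<in> K" for k
  proof -
    let ?S = "sphere (0::complex) (real k)"
    have S: "compact ?S" "?S \<noteq> {}" by auto
    obtain z0 where z0: "z0 \<in> ?S" "\<And>z. z \<in> ?S \<Longrightarrow> (cmod (normalized \<omega> z0))\<^sup>2 \<le> (cmod (normalized \<omega> z))\<^sup>2"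
      using continuous_attains_inf[OF S cN] by blast
    obtain z1 where z1: "z1 \<in> ?S" "\<And>z. z \<in> ?S \<Longrightarrow> (cmod (normalized \<omega> z))\<^sup>2 \<le> (cmod (normalized \<omega> z1))\<^sup>2"
      using continuous_attains_sup[OF S cN] by blast
    have "normalized \<omega> z0 \<noteq> 0" using nz[OF k, of z0] z0(1) by (simp add: normalized_def)
    moreover have "of_nat k * ucirc t \<in> ?S" for t by (simp add: norm_mult)
    ultimately show ?thesis using z0(2) z1(2) unfolding x_def
      by (intro exI[of _ "(cmod (normalized \<omega> z0))\<^sup>2"] exI[of _ "(cmod (normalized \<omega> z1))\<^sup>2"]) auto
  qed
  then obtain a b where ab: "\<And>k. k \<in> K \<Longrightarrow> 0 < a k" "\<And>k t. k \<in> K \<Longrightarrow> a k \<le> x k t \<and> x k t \<le> b k"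
    by metis
  \<comment> \<open>The extra 1 keeps \<open>Min\<close> and \<open>Max\<close> meaningful for empty
    \<open>K\<close>.\<close>
  define a' where "a' = Min (insert 1 (a ` K))"
  define b' where "b' = Max (insert 1 (b ` K))"
  have a': "0 < a'" using K ab(1) by (auto simp: a'_def)
  have ab': "a' \<le> x k t \<and> x k t \<le> b'" if "k \<in> K" for k t
  proof -
    have "a' \<le> a k" "b k \<le> b'" using K that by (auto simp: a'_def b'_def)
    then show ?thesis using ab(2)[OF that, of t] by linarith
  qed
  have xm: "x k \<in> borel_measurable borel" for k
    using cx by (rule borel_measurable_continuous_onI)
  show ?thesis
    using log_combination_le_laplace[OF K a' ab' xm \<open>w \<in> _\<close> w zero]
    unfolding circle_log_def circle_laplace_def x_def .
qed

text \<open>Cauchy--Schwarz in \<open>s\<close> with the weight \<open>(1 + s) powr (-3/2)\<close> turns the bound for each \<open>s\<close> into one for the logarithm.\<close>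

lemma circle_log_second_moment:
  assumes K: "finite K" "\<And>k. k \<in> K \<Longrightarrow> k > 0" and [measurable]: "w \<in> borel_measurable borel"
    and w: "\<And>t. \<bar>w t\<bar> \<le> 1"
    and zero: "(\<Sum>k\<in>K. c k) * (\<integral>t. w t \<partial>unit_interval_measure) = 0"
  obtains T where "T \<in> borel_measurable M"
    "(\<integral>\<^sup>+\<omega>. T \<omega> \<partial>M) \<le> ennreal (6 * sqrt pi * circle_energy K c)"
    "AE \<omega> in M. ennreal ((circle_log K c w \<omega>)\<^sup>2) \<le> T \<omega>"
proof -
  define J where "J = circle_laplace K c w"
  define m where "m = (\<lambda>s :: real. (1 + s) * sqrt (1 + s))"
  define B where "B = 3 / 2 * sqrt pi * circle_energy K c"
  \<comment> \<open>The majorant that Cauchy-Schwarz produces; its factor 2 is the integral of the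
    weight. \<open>T\<close> is measurable by construction, so measurability of
    \<open>circle_log\<close> never has to be discussed.\<close>
  define T where "T = (\<lambda>\<omega>. 2 * (\<integral>\<^sup>+s. ennreal ((J \<omega> s)\<^sup>2 / s\<^sup>2 * m s) * indicator {0<..} s \<partial>lborel))"
  have J [measurable]: "(\<lambda>p. J (fst p) (snd p)) \<in> borel_measurable (M \<Otimes>\<^sub>M lborel)"
    unfolding J_def by measurable
  have J2: "(\<lambda>\<omega>. J \<omega> s) \<in> borel_measurable M" for s
    using measurable_Pair1[OF J, of s] by simp
  have m_pos: "m s > 0" if "s > 0" for s using that by (simp add: m_def)
  have B0: "B \<ge> 0" by (auto simp: B_def circle_energy_def intro!: mult_nonneg_nonneg sum_nonneg divide_nonneg_nonneg)
  have Jm: "(\<lambda>(\<omega>, s). ennreal ((J \<omega> s)\<^sup>2 / s\<^sup>2 * m s) * indicator {0<..} s) \<in> borel_measurable (M \<Otimes>\<^sub>M lborel)"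
    unfolding m_def split_beta' by measurable
  note Tm = lborel.borel_measurable_nn_integral[OF Jm]
  have T_meas: "T \<in> borel_measurable M"
    unfolding T_def using Tm by simp
  have "(\<integral>\<^sup>+\<omega>. T \<omega> \<partial>M) = 2 * (\<integral>\<^sup>+\<omega>. \<integral>\<^sup>+s. ennreal ((J \<omega> s)\<^sup>2 / s\<^sup>2 * m s) * indicator {0<..} s \<partial>lborel \<partial>M)"
    unfolding T_def by (rule nn_integral_cmult[OF Tm])
  also have "(\<integral>\<^sup>+\<omega>. \<integral>\<^sup>+s. ennreal ((J \<omega> s)\<^sup>2 / s\<^sup>2 * m s) * indicator {0<..} s \<partial>lborel \<partial>M)
      = (\<integral>\<^sup>+s. \<integral>\<^sup>+\<omega>. ennreal ((J \<omega> s)\<^sup>2 / s\<^sup>2 * m s) * indicator {0<..} s \<partial>M \<partial>lborel)"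
  proof -
    interpret P: pair_sigma_finite M lborel ..
    from P.Fubini'[OF Jm] show ?thesis by simp
  qed
  also have "\<dots> \<le> (\<integral>\<^sup>+s. ennreal B * (ennreal (1 / m s) * indicator {0<..} s) \<partial>lborel)"
  proof (rule nn_integral_mono)
    fix s :: real
    show "(\<integral>\<^sup>+\<omega>. ennreal ((J \<omega> s)\<^sup>2 / s\<^sup>2 * m s) * indicator {0<..} s \<partial>M) \<le> ennreal B * (ennreal (1 / m s) * indicator {0<..} s)"
    proof (cases "s > 0")
      case True
      have "(J \<omega> s)\<^sup>2 \<le> (\<Sum>k\<in>K. \<bar>c k\<bar>)\<^sup>2" for \<omega>
        using abs_circle_laplace_le[where w = w and s = s and K = K and c = c and \<omega> = \<omega>, OF w] True
        by (subst abs_le_square_iff[symmetric]) (simp add: J_def sum_nonneg)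
      then have int: "integrable M (\<lambda>\<omega>. (J \<omega> s)\<^sup>2)"
        using J2 by (intro integrable_const_bound[of _ "(\<Sum>k\<in>K. \<bar>c k\<bar>)\<^sup>2"]) auto
      have "(\<integral>\<^sup>+\<omega>. ennreal ((J \<omega> s)\<^sup>2 / s\<^sup>2 * m s) \<partial>M) = (\<integral>\<^sup>+\<omega>. ennreal (m s / s\<^sup>2) * ennreal ((J \<omega> s)\<^sup>2) \<partial>M)"
        using m_pos[OF True] by (intro nn_integral_cong) (simp add: ennreal_mult[symmetric] mult.commute)
      also have "\<dots> = ennreal (m s / s\<^sup>2) * ennreal (expectation (\<lambda>\<omega>. (J \<omega> s)\<^sup>2))"
        using J2 int by (subst nn_integral_cmult) (auto simp: nn_integral_eq_integral)
      also have "\<dots> = ennreal (m s / s\<^sup>2 * expectation (\<lambda>\<omega>. (J \<omega> s)\<^sup>2))"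
        using m_pos[OF True] by (simp add: ennreal_mult[symmetric])
      also have "\<dots> \<le> ennreal (B * (1 / m s))"
      proof (rule ennreal_leI)
        have "m s / s\<^sup>2 * expectation (\<lambda>\<omega>. (J \<omega> s)\<^sup>2) \<le> m s / s\<^sup>2 * (s\<^sup>2 / ((1 + s)\<^sup>2 * (1 + 2 * s)) * B)"
          using second_moment_circle_laplace[OF K \<open>w \<in> _\<close> w _ zero, where s = s] True m_pos[OF True]
          unfolding J_def B_def by (intro mult_left_mono) auto
        also have "\<dots> = B * (m s / ((1 + s)\<^sup>2 * (1 + 2 * s)))" using True by (simp add: field_simps)
        also have "\<dots> \<le> B * (1 / m s)"
        proof (intro mult_left_mono B0)
          have "m s * m s = (1 + s)\<^sup>2 * (1 + s)" using True by (simp add: m_def power2_eq_square)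
          also have "\<dots> \<le> (1 + s)\<^sup>2 * (1 + 2 * s)" using True by (intro mult_left_mono) auto
          finally show "m s / ((1 + s)\<^sup>2 * (1 + 2 * s)) \<le> 1 / m s"
            using m_pos[OF True] True by (simp add: divide_simps mult.commute)
        qed
        finally show "m s / s\<^sup>2 * expectation (\<lambda>\<omega>. (J \<omega> s)\<^sup>2) \<le> B * (1 / m s)" .
      qed
      finally show ?thesis using True B0 m_pos[OF True] by (simp add: ennreal_mult[symmetric])
    qed simp
  qed
  also have "\<dots> = ennreal B * 2"
    unfolding m_def by (subst nn_integral_cmult) (auto simp: laplace_weight_integral)
  \<comment> \<open>\<open>6 = 2 * 2 * (3/2)\<close>: one 2 from Cauchy-Schwarz, one from
    integrating the weight again, and 3/2 from the circle correlation.\<close>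
  finally have "(\<integral>\<^sup>+\<omega>. T \<omega> \<partial>M) \<le> 2 * (ennreal B * 2)"
    by (simp add: mult_left_mono)
  also have "\<dots> = ennreal (6 * sqrt pi * circle_energy K c)"
    using B0 by (simp add: B_def ennreal_mult'[symmetric] mult_ac flip: ennreal_numeral)
  finally have ET: "(\<integral>\<^sup>+\<omega>. T \<omega> \<partial>M) \<le> ennreal (6 * sqrt pi * circle_energy K c)" .
  have nz: "AE \<omega> in M. \<forall>k\<in>K. \<forall>z. cmod z = real k \<longrightarrow> F \<omega> z \<noteq> 0"
    using K AE_nonzero_on_circle by (intro AE_finite_allI) auto
  have "AE \<omega> in M. ennreal ((circle_log K c w \<omega>)\<^sup>2) \<le> T \<omega>"
    using AE_decaying_coeffs nz AE_space
  proof eventually_elim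
    fix \<omega> assume g: "decaying_coeffs \<omega>" and nz: "\<forall>k\<in>K. \<forall>z. cmod z = real k \<longrightarrow> F \<omega> z \<noteq> 0" and sp: "\<omega> \<in> space M"
    have [measurable]: "J \<omega> \<in> borel_measurable borel"
      using measurable_Pair2[OF J sp] by simp
    define f where "f = (\<lambda>s. ennreal (\<bar>J \<omega> s\<bar> / s * sqrt (m s)) * indicator {0<..} s)"
    define h where "h = (\<lambda>s. ennreal (1 / sqrt (m s)) * indicator {0<..} s)"
    have fm [measurable]: "f \<in> borel_measurable lborel" "h \<in> borel_measurable lborel" unfolding f_def h_def m_def by auto
    have "ennreal ((circle_log K c w \<omega>)\<^sup>2) = (ennreal \<bar>circle_log K c w \<omega>\<bar>)\<^sup>2"
      by (simp add: ennreal_power)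
    also have "\<dots> \<le> (\<integral>\<^sup>+s. ennreal (\<bar>J \<omega> s\<bar> / s) * indicator {0<..} s \<partial>lborel)\<^sup>2"
      unfolding J_def using nz
      by (intro power_mono circle_log_le_circle_laplace[OF K(1) \<open>w \<in> _\<close> w zero g]) auto
    also have "(\<integral>\<^sup>+s. ennreal (\<bar>J \<omega> s\<bar> / s) * indicator {0<..} s \<partial>lborel) = (\<integral>\<^sup>+s. f s * h s \<partial>lborel)"
    proof (rule nn_integral_cong)
      fix s show "ennreal (\<bar>J \<omega> s\<bar> / s) * indicator {0<..} s = f s * h s"
        using m_pos[of s] by (auto simp: f_def h_def ennreal_mult[symmetric] split: split_indicator)
    qed
    also have "\<dots>\<^sup>2 \<le> (\<integral>\<^sup>+s. (f s)\<^sup>2 \<partial>lborel) * (\<integral>\<^sup>+s. (h s)\<^sup>2 \<partial>lborel)"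
      by (rule Cauchy_Schwarz_nn_integral) (use fm in auto)
    also have "(\<integral>\<^sup>+s. (f s)\<^sup>2 \<partial>lborel) = (\<integral>\<^sup>+s. ennreal ((J \<omega> s)\<^sup>2 / s\<^sup>2 * m s) * indicator {0<..} s \<partial>lborel)"
    proof (rule nn_integral_cong)
      fix s show "(f s)\<^sup>2 = ennreal ((J \<omega> s)\<^sup>2 / s\<^sup>2 * m s) * indicator {0<..} s"
        using m_pos[of s] by (auto simp: f_def ennreal_power power_mult_distrib power_divide split: split_indicator)
    qed
    also have "(\<integral>\<^sup>+s. (h s)\<^sup>2 \<partial>lborel) = (\<integral>\<^sup>+s. ennreal (1 / m s) * indicator {0<..} s \<partial>lborel)"
    proof (rule nn_integral_cong)
      fix s show "(h s)\<^sup>2 = ennreal (1 / m s) * indicator {0<..} s"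
        using m_pos[of s] by (auto simp: h_def ennreal_power power_divide split: split_indicator)
    qed
    also have "\<dots> = 2" unfolding m_def by (rule laplace_weight_integral)
    finally show "ennreal ((circle_log K c w \<omega>)\<^sup>2) \<le> T \<omega>"
      unfolding T_def by (simp add: mult.commute)
  qed
  then show ?thesis using that[OF T_meas ET] by blast
qed

end

section \<open>Coefficients of small energy\<close>

lemma harmonic_block:
  assumes m: "m > (0::nat)"
  shows "1 / 2 \<le> (\<Sum>k=m..<2 * m. 1 / real k)" "(\<Sum>k=m..<2 * m. 1 / real k) \<le> 1"
proof -
  have "(\<Sum>k=m..<2 * m. 1 / real (2 * m)) \<le> (\<Sum>k=m..<2 * m. 1 / real k)"
    using m by (intro sum_mono divide_left_mono) auto
  then show "1 / 2 \<le> (\<Sum>k=m..<2 * m. 1 / real k)" using m by simp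
  have "(\<Sum>k=m..<2 * m. 1 / real k) \<le> (\<Sum>k=m..<2 * m. 1 / real m)"
    using m by (intro sum_mono divide_left_mono) auto
  then show "(\<Sum>k=m..<2 * m. 1 / real k) \<le> 1" using m by simp
qed

lemma harmonic_dyadic:
  assumes n: "n > (0::nat)"
  shows "real q / 2 \<le> (\<Sum>k=n..<n * 2 ^ q. 1 / real k) \<and> (\<Sum>k=n..<n * 2 ^ q. 1 / real k) \<le> real q"
proof (induction q)
  case (Suc q)
  have "(\<Sum>k=n..<n * 2 ^ Suc q. 1 / real k) = (\<Sum>k=n..<n * 2 ^ q. 1 / real k) + (\<Sum>k=n * 2 ^ q..<2 * (n * 2 ^ q). 1 / real k)"
    by (subst sum.atLeastLessThan_concat) (auto simp: mult_ac)
  then show ?case using Suc harmonic_block[of "n * 2 ^ q"] n by simp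
qed simp

lemma sum_half_power_le: "(\<Sum>i\<in>A. (1 / 2 :: real) ^ i) \<le> 2" if "finite A"
proof -
  have "(\<Sum>i\<in>A. (1 / 2 :: real) ^ i) \<le> (\<Sum>i. (1 / 2) ^ i)"
    by (rule sum_le_suminf) (use that in auto)
  also have "\<dots> = 2" by (subst suminf_geometric) auto
  finally show ?thesis .
qed

text \<open>With \<open>d = |k - l|\<close>, \<open>exp (-d^2) \<le> exp (-d) \<le> 2^-d\<close>;
  each side of \<open>k\<close> contributes at most a geometric series of sum 2.\<close>

lemma sum_exp_square_diff_le:
  assumes K: "finite K"
  shows "(\<Sum>l\<in>K. exp (- (real k - real l)\<^sup>2)) \<le> 4"
proof -
  have le: "exp (- (real k - real l)\<^sup>2) \<le> (1 / 2) ^ (if l < k then k - l else l - k)" for l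
  proof -
    define d where "d = (if l < k then k - l else l - k)"
    have "(real k - real l)\<^sup>2 = (real d)\<^sup>2"
      by (auto simp: d_def of_nat_diff power2_commute)
    moreover have "real d \<le> (real d)\<^sup>2"
      by (cases d) (auto simp: power2_eq_square)
    ultimately have "exp (- (real k - real l)\<^sup>2) \<le> exp (- real d)" by simp
    also have "\<dots> = exp (- 1) ^ d" by (simp add: exp_of_nat_mult[symmetric])
    also have "\<dots> \<le> (1 / 2) ^ d"
    proof (rule power_mono)
      have "(2 :: real) \<le> exp 1" using exp_ge_add_one_self[of 1] by simp
      then show "exp (- 1) \<le> (1 / 2 :: real)" by (simp add: exp_minus field_simps)
    qed simp
    finally show ?thesis by (simp add: d_def)
  qed
  have "(\<Sum>l\<in>K. exp (- (real k - real l)\<^sup>2)) \<le> (\<Sum>l\<in>K. (1 / 2) ^ (if l < k then k - l else l - k))"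
    by (intro sum_mono le)
  also have "\<dots> = (\<Sum>l\<in>(K \<inter> {l. l < k}). (1 / 2) ^ (k - l)) + (\<Sum>l\<in>(K \<inter> - {l. l < k}). (1 / 2) ^ (l - k))"
    unfolding if_distrib[of "\<lambda>d. (1 / 2) ^ d"] by (rule sum.If_cases[OF K])
  also have "(\<Sum>l\<in>(K \<inter> {l. l < k}). (1 / 2 :: real) ^ (k - l)) = (\<Sum>i\<in>(\<lambda>l. k - l) ` (K \<inter> {l. l < k}). (1 / 2) ^ i)"
    by (subst sum.reindex) (auto simp: inj_on_def)
  also have "\<dots> \<le> 2" by (rule sum_half_power_le) (use K in auto)
  also have "(\<Sum>l\<in>(K \<inter> - {l. l < k}). (1 / 2 :: real) ^ (l - k)) = (\<Sum>i\<in>(\<lambda>l. l - k) ` (K \<inter> - {l. l < k}). (1 / 2) ^ i)"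
    by (subst sum.reindex) (auto simp: inj_on_def)
  also have "\<dots> \<le> 2" by (rule sum_half_power_le) (use K in auto)
  finally show ?thesis by simp
qed

text \<open>A Schur test: \<open>1 / sqrt (k * l)\<close> is at most the mean of \<open>1/k\<close>
  and \<open>1/l\<close>, and the symmetric kernel \<open>E\<close> has row sums at most 4.\<close>

lemma circle_energy_le:
  assumes K: "finite K" "\<And>k. k \<in> K \<Longrightarrow> k > 0" and c: "\<And>k. k \<in> K \<Longrightarrow> \<bar>c k\<bar> \<le> 1"
  shows "circle_energy K c \<le> 4 * (\<Sum>k\<in>K. 1 / real k)"
proof -
  define E where "E = (\<lambda>k l. exp (- (real k - real l)\<^sup>2))"
  have "circle_energy K c \<le> (\<Sum>k\<in>K. \<Sum>l\<in>K. E k l * (1 / real k / 2) + E k l * (1 / real l / 2))"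
    unfolding circle_energy_def
  proof (intro sum_mono)
    fix k l assume kl: "k \<in> K" "l \<in> K"
    then have pos: "real k > 0" "real l > 0" using K(2) by auto
    have "1 / sqrt (real k * real l) = sqrt (1 / real k * (1 / real l))"
      by (simp add: real_sqrt_divide)
    also have "\<dots> \<le> (1 / real k + 1 / real l) / 2"
      using arith_geo_mean_sqrt[of "1 / real k" "1 / real l"] by simp
    finally have 1: "1 / sqrt (real k * real l) \<le> (1 / real k + 1 / real l) / 2" .
    have "\<bar>c k\<bar> * \<bar>c l\<bar> * exp (- (real k - real l)\<^sup>2) / sqrt (real k * real l)
        = (\<bar>c k\<bar> * \<bar>c l\<bar>) * (E k l * (1 / sqrt (real k * real l)))" by (simp add: E_def)
    also have "\<dots> \<le> 1 * (E k l * ((1 / real k + 1 / real l) / 2))"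
      by (intro mult_mono 1 mult_le_one c kl) (auto simp: E_def)
    finally show "\<bar>c k\<bar> * \<bar>c l\<bar> * exp (- (real k - real l)\<^sup>2) / sqrt (real k * real l)
        \<le> E k l * (1 / real k / 2) + E k l * (1 / real l / 2)"
      by (simp add: distrib_left add_divide_distrib)
  qed
  also have "\<dots> = (\<Sum>k\<in>K. \<Sum>l\<in>K. E k l * (1 / real k / 2)) + (\<Sum>k\<in>K. \<Sum>l\<in>K. E l k * (1 / real k / 2))"
    unfolding sum.distrib by (subst (2) sum.swap) simp
  also have "\<dots> = (\<Sum>k\<in>K. 1 / real k * (\<Sum>l\<in>K. E k l))"
    by (simp add: E_def power2_commute sum_distrib_left sum.distrib[symmetric] mult.commute)
  also have "\<dots> \<le> (\<Sum>k\<in>K. 1 / real k * 4)"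
    unfolding E_def by (intro sum_mono mult_left_mono sum_exp_square_diff_le K) auto
  finally show ?thesis by (simp add: sum_distrib_left mult.commute)
qed

lemma circle_energy_scale: "circle_energy K (\<lambda>k. c k / P) = circle_energy K c / P\<^sup>2"
proof -
  have "\<bar>c k / P\<bar> * \<bar>c l / P\<bar> = \<bar>c k\<bar> * \<bar>c l\<bar> / P\<^sup>2" for k l
    by (simp add: abs_divide power2_eq_square[of P, symmetric] flip: abs_mult_self_eq[of P])
  then show ?thesis by (simp add: circle_energy_def power2_eq_square[of P] sum_divide_distrib mult.commute)
qed

text \<open>Coefficients \<open>-1 / ln 2\<close> and \<open>1 / ln 2\<close> at the radii
  \<open>m\<close> and \<open>2 * m\<close>. Since \<open>ln (2 * m) - ln m = ln 2\<close> for all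
  \<open>m\<close>, they stay bounded while the energy is O(\<open>1/m\<close>).\<close>

lemma count_coefficients:
  fixes \<delta> :: real assumes \<delta>: "\<delta> > 0"
  obtains K c where "finite K" "\<And>k. k \<in> K \<Longrightarrow> k > n" "(\<Sum>k\<in>K. c k) = 0" "(\<Sum>k\<in>K. c k * ln (real k)) = 1"
    "circle_energy K c \<le> \<delta>"
proof -
  have "eventually (\<lambda>m::nat. 8 / (ln 2)\<^sup>2 / real m \<le> \<delta>) sequentially"
    using \<delta> by real_asymp
  from eventually_happens'[OF sequentially_bot eventually_conj[OF eventually_gt_at_top[of n] this]]
  obtain m :: nat where m: "m > n" "8 / (ln 2)\<^sup>2 / real m \<le> \<delta>" by auto
  define c where "c = (\<lambda>k. if k = m then - 1 else 1 :: real)"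
  have m0: "m > 0" "m \<noteq> 2 * m" using m by auto
  have "circle_energy {m, 2 * m} c \<le> 4 * (\<Sum>k\<in>{m, 2 * m}. 1 / real k)"
    by (rule circle_energy_le) (use m0 in \<open>auto simp: c_def\<close>)
  also have "\<dots> \<le> 8 / real m" using m0 by (simp add: field_simps)
  finally have e: "circle_energy {m, 2 * m} c \<le> 8 / real m" .
  show ?thesis
  proof (rule that[of "{m, 2 * m}" "\<lambda>k. c k / ln 2"])
    have "circle_energy {m, 2 * m} (\<lambda>k. c k / ln 2) \<le> 8 / real m / (ln 2)\<^sup>2"
      unfolding circle_energy_scale by (intro divide_right_mono e) auto
    also have "\<dots> = 8 / (ln 2)\<^sup>2 / real m" by (simp add: field_simps)
    finally show "circle_energy {m, 2 * m} (\<lambda>k. c k / ln 2) \<le> \<delta>" using m(2) by linarith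
    show "(\<Sum>k\<in>{m, 2 * m}. c k / ln 2) = 0" using m0 by (simp add: c_def)
    have "(\<Sum>k\<in>{m, 2 * m}. c k / ln 2 * ln (real k)) = (ln (2 * real m) - ln (real m)) / ln 2"
      using m0 by (simp add: c_def diff_divide_distrib)
    also have "ln (2 * real m) = ln 2 + ln (real m)" using m0 by (simp add: ln_mult)
    finally show "(\<Sum>k\<in>{m, 2 * m}. c k / ln 2 * ln (real k)) = 1" by simp
  qed (use m in auto)
qed

text \<open>Before scaling, the coefficient is 1 over \<open>q\<close> dyadic blocks and
  \<open>-b\<close> on one further block, which restores \<open>\<Sum> c k * k = 0\<close>. The sum
  \<open>P\<close> of \<open>c k / k\<close> loses at most 1 by this and stays of order
  \<open>q\<close>; dividing by \<open>P\<close> turns the energy bound \<open>4 * (q + 1)\<close>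
  into O(\<open>1/q\<close>).\<close>

lemma moment_coefficients:
  fixes \<delta> :: real assumes \<delta>: "\<delta> > 0"
  obtains K c where "finite K" "\<And>k. k \<in> K \<Longrightarrow> k > n" "(\<Sum>k\<in>K. c k * real k) = 0" "(\<Sum>k\<in>K. c k / real k) = 1"
    "circle_energy K c \<le> \<delta>"
proof -
  have "eventually (\<lambda>q::nat. 4 * (real q + 1) / (real q / 2 - 1)\<^sup>2 \<le> \<delta>) sequentially"
    using \<delta> by real_asymp
  from eventually_happens'[OF sequentially_bot eventually_conj[OF eventually_gt_at_top[of 2] this]]
  obtain q :: nat where q: "q > 2" "4 * (real q + 1) / (real q / 2 - 1)\<^sup>2 \<le> \<delta>" by auto
  define m where "m = Suc n"
  define L where "L = m * 2 ^ q"
  define b where "b = (\<Sum>k=m..<L. real k) / (\<Sum>k=L..<2 * L. real k)"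
  define c where "c = (\<lambda>k. if k < L then 1 else - b)"
  define K where "K = {m..<2 * L}"
  have mL: "0 < m" "m \<le> L" "L \<le> 2 * L" "0 < L" by (simp_all add: m_def L_def del: mult_Suc)
  have split: "(\<Sum>k\<in>K. c k * g k) = (\<Sum>k=m..<L. g k) - b * (\<Sum>k=L..<2 * L. g k)" for g :: "nat \<Rightarrow> real"
  proof -
    have "(\<Sum>k\<in>K. c k * g k) = (\<Sum>k=m..<L. c k * g k) + (\<Sum>k=L..<2 * L. c k * g k)"
      unfolding K_def by (rule sum.atLeastLessThan_concat[OF mL(2,3), symmetric])
    also have "(\<Sum>k=m..<L. c k * g k) = (\<Sum>k=m..<L. g k)" by (rule sum.cong) (auto simp: c_def)
    also have "(\<Sum>k=L..<2 * L. c k * g k) = - b * (\<Sum>k=L..<2 * L. g k)"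
      unfolding sum_distrib_left by (rule sum.cong) (auto simp: c_def)
    finally show ?thesis by simp
  qed
  have Spos: "(\<Sum>k=L..<2 * L. real k) > 0"
    by (rule sum_pos) (use mL in auto)
  have b0: "b \<ge> 0" unfolding b_def by (intro divide_nonneg_nonneg sum_nonneg) auto
  \<comment> \<open>Shifting \<open>{0..<L}\<close> by \<open>L\<close> gives the last block, so
    that block alone outweighs all smaller radii; hence \<open>b \<le> 1\<close>, as
    \<open>circle_energy_le\<close> requires.\<close>
  have "(\<Sum>k=m..<L. real k) \<le> (\<Sum>k=0..<L. real k)" by (rule sum_mono2) auto
  also have "\<dots> \<le> (\<Sum>k=0..<L. real (k + L))" by (rule sum_mono) auto
  also have "\<dots> = (\<Sum>k=L..<2 * L. real k)"
    using sum.shift_bounds_nat_ivl[of real 0 L L] by (simp add: mult_2)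
  finally have b1: "b \<le> 1" using Spos by (simp add: b_def)
  define P where "P = (\<Sum>k\<in>K. c k * (1 / real k))"
  have P: "P \<ge> real q / 2 - 1"
  proof -
    have "b * (\<Sum>k=L..<2 * L. 1 / real k) \<le> 1 * 1"
      using harmonic_block[OF mL(4)] b0 b1 by (intro mult_mono) auto
    then show ?thesis unfolding P_def split using harmonic_dyadic[OF mL(1), of q] by (simp add: L_def)
  qed
  then have P0: "P > 0" using q(1) by linarith
  have "circle_energy K c \<le> 4 * (\<Sum>k\<in>K. 1 / real k)"
    by (rule circle_energy_le) (use mL b0 b1 in \<open>auto simp: K_def c_def\<close>)
  also have "(\<Sum>k\<in>K. 1 / real k) \<le> real (Suc q)"
    using harmonic_dyadic[OF mL(1), of "Suc q"] by (simp add: K_def L_def mult_ac)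
  finally have e: "circle_energy K c \<le> 4 * (real q + 1)" by simp
  show ?thesis
  proof (rule that[of K "\<lambda>k. c k / P"])
    show "k > n" if "k \<in> K" for k using that by (auto simp: K_def m_def)
    show "finite K" by (simp add: K_def)
    have "(\<Sum>k\<in>K. c k * real k) = 0" unfolding split using Spos by (simp add: b_def)
    then show "(\<Sum>k\<in>K. c k / P * real k) = 0" by (simp add: sum_divide_distrib[symmetric])
    have "(\<Sum>k\<in>K. c k / P / real k) = P / P"
      unfolding P_def sum_divide_distrib by (rule sum.cong) (auto simp: mult.commute)
    then show "(\<Sum>k\<in>K. c k / P / real k) = 1" using P0 by simp
    have "circle_energy K (\<lambda>k. c k / P) \<le> 4 * (real q + 1) / P\<^sup>2"
      unfolding circle_energy_scale by (intro divide_right_mono e) auto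
    also have "\<dots> \<le> 4 * (real q + 1) / (real q / 2 - 1)\<^sup>2"
      using P q(1) by (intro divide_left_mono power_mono mult_pos_pos) auto
    finally show "circle_energy K (\<lambda>k. c k / P) \<le> \<delta>" using q(2) by linarith
  qed
qed

section \<open>Almost sure limits, and circle averages as sums over zeros\<close>

context gaf_process begin

text \<open>The bounds on the second moments are summable, so the majorants have an almost surely
  finite sum; the squares of the averages are then summable and tend to 0.\<close>

lemma AE_circle_log_tendsto_0:
  assumes K: "\<And>j. finite (K j)" "\<And>j k. k \<in> K j \<Longrightarrow> k > 0" and wm: "w \<in> borel_measurable borel"
    and w: "\<And>t. \<bar>w t\<bar> \<le> 1"
    and zero: "\<And>j. (\<Sum>k\<in>K j. c j k) * (\<integral>t. w t \<partial>unit_interval_measure) = 0"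
    and energy: "\<And>j. circle_energy (K j) (c j) \<le> (1 / 2) ^ j"
  shows "AE \<omega> in M. (\<lambda>j. circle_log (K j) (c j) w \<omega>) \<longlonglongrightarrow> 0"
proof -
  have "\<exists>T. T \<in> borel_measurable M \<and> (\<integral>\<^sup>+\<omega>. T \<omega> \<partial>M) \<le> ennreal (6 * sqrt pi * circle_energy (K j) (c j)) \<and>
    (AE \<omega> in M. ennreal ((circle_log (K j) (c j) w \<omega>)\<^sup>2) \<le> T \<omega>)" for j
  proof -
    obtain T where "T \<in> borel_measurable M" "(\<integral>\<^sup>+\<omega>. T \<omega> \<partial>M) \<le> ennreal (6 * sqrt pi * circle_energy (K j) (c j))"
      "AE \<omega> in M. ennreal ((circle_log (K j) (c j) w \<omega>)\<^sup>2) \<le> T \<omega>"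
      by (rule circle_log_second_moment[OF K(1) K(2) wm w zero])
    then show ?thesis by blast
  qed
  then obtain T where T [measurable]: "\<And>j. T j \<in> borel_measurable M"
    and ET: "\<And>j. (\<integral>\<^sup>+\<omega>. T j \<omega> \<partial>M) \<le> ennreal (6 * sqrt pi * circle_energy (K j) (c j))"
    and le: "\<And>j. AE \<omega> in M. ennreal ((circle_log (K j) (c j) w \<omega>)\<^sup>2) \<le> T j \<omega>"
    by metis
  have "(\<integral>\<^sup>+\<omega>. (\<Sum>j. T j \<omega>) \<partial>M) = (\<Sum>j. \<integral>\<^sup>+\<omega>. T j \<omega> \<partial>M)"
    by (rule nn_integral_suminf) simp
  also have "\<dots> \<le> (\<Sum>j. ennreal (6 * sqrt pi * (1 / 2) ^ j))"
    using energy by (intro suminf_le order_trans[OF ET] ennreal_leI mult_left_mono) auto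
  also have "\<dots> < \<infinity>"
    by (subst suminf_ennreal_eq[OF _ summable_sums]) (auto intro!: summable_mult summable_geometric)
  finally have "AE \<omega> in M. (\<Sum>j. T j \<omega>) \<noteq> \<infinity>"
    by (intro nn_integral_noteq_infinite) auto
  moreover have "AE \<omega> in M. \<forall>j. ennreal ((circle_log (K j) (c j) w \<omega>)\<^sup>2) \<le> T j \<omega>"
    unfolding AE_all_countable using le by blast
  ultimately show ?thesis
  proof eventually_elim
    fix \<omega> assume fin: "(\<Sum>j. T j \<omega>) \<noteq> \<infinity>" and le: "\<forall>j. ennreal ((circle_log (K j) (c j) w \<omega>)\<^sup>2) \<le> T j \<omega>"
    have "(\<Sum>j. ennreal ((circle_log (K j) (c j) w \<omega>)\<^sup>2)) \<le> (\<Sum>j. T j \<omega>)"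
      by (intro suminf_le) (use le in auto)
    then have "(\<Sum>j. ennreal ((circle_log (K j) (c j) w \<omega>)\<^sup>2)) \<noteq> top"
      using fin by (auto simp: top_unique)
    then have "summable (\<lambda>j. (circle_log (K j) (c j) w \<omega>)\<^sup>2)"
      by (intro summable_suminf_not_top) auto
    then have "(\<lambda>j. (circle_log (K j) (c j) w \<omega>)\<^sup>2) \<longlonglongrightarrow> 0" by (rule summable_LIMSEQ_zero)
    then have "(\<lambda>j. sqrt ((circle_log (K j) (c j) w \<omega>)\<^sup>2)) \<longlonglongrightarrow> sqrt 0" by (rule tendsto_real_sqrt)
    then show "(\<lambda>j. circle_log (K j) (c j) w \<omega>) \<longlonglongrightarrow> 0" by (simp add: tendsto_rabs_zero_iff)
  qed
qed

text \<open>On circles without zeros the integrand is continuous, so the Lebesgue integral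
  \<open>circle_log\<close> is the gauge integral to which Jensen's formula applies. The
  \<open>k^2\<close> comes from the normalizing factor.\<close>

lemma has_integral_circle_log:
  assumes g: "decaying_coeffs \<omega>" and nz: "\<And>k z. k \<in> K \<Longrightarrow> cmod z = real k \<Longrightarrow> F \<omega> z \<noteq> 0"
    and w: "continuous_on UNIV w"
  shows "((\<lambda>t. 2 * (w t * (\<Sum>k\<in>K. c k * ln (cmod (F \<omega> (of_nat k * ucirc t))))) - w t * (\<Sum>k\<in>K. c k * (real k)\<^sup>2))
    has_integral circle_log K c w \<omega>) {0..1}"
proof -
  let ?g = "\<lambda>t. w t * (\<Sum>k\<in>K. c k * ln ((cmod (normalized \<omega> (of_nat k * ucirc t)))\<^sup>2))"
  have nzt: "F \<omega> (of_nat k * ucirc t) \<noteq> 0" if "k \<in> K" for k t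
    using nz[OF that, of "of_nat k * ucirc t"] by (simp add: norm_mult)
  have cF: "continuous_on UNIV (F \<omega>)"
    using decaying_coeffs_holomorphic[OF g] by (rule holomorphic_on_imp_continuous_on)
  have "continuous_on UNIV (\<lambda>t. F \<omega> (of_nat k * ucirc t))" for k
    by (intro continuous_on_compose2[OF cF] continuous_intros) auto
  then have "continuous_on UNIV ?g"
    unfolding normalized_def by (intro continuous_intros w) (use nzt in auto)
  then have "(?g has_integral circle_log K c w \<omega>) {0..1}"
    unfolding circle_log_def
    by (intro integral_unit_interval_measure) (auto intro: continuous_on_subset borel_measurable_continuous_onI)
  moreover have "?g t = 2 * (w t * (\<Sum>k\<in>K. c k * ln (cmod (F \<omega> (of_nat k * ucirc t))))) - w t * (\<Sum>k\<in>K. c k * (real k)\<^sup>2)" for t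
  proof -
    have lnN: "ln ((cmod (normalized \<omega> (of_nat k * ucirc t)))\<^sup>2) = 2 * ln (cmod (F \<omega> (of_nat k * ucirc t))) - (real k)\<^sup>2"
      if "k \<in> K" for k
    proof -
      have "ln ((cmod (normalized \<omega> (of_nat k * ucirc t)))\<^sup>2) = 2 * ln (exp (- (real k)\<^sup>2 / 2) * cmod (F \<omega> (of_nat k * ucirc t)))"
        using nzt[OF that, of t] by (simp add: normalized_def norm_mult ln_realpow)
      also have "\<dots> = 2 * (- (real k)\<^sup>2 / 2 + ln (cmod (F \<omega> (of_nat k * ucirc t))))"
        using nzt[OF that, of t] by (subst ln_mult) auto
      finally show ?thesis by simp
    qed
    have "?g t = w t * (\<Sum>k\<in>K. c k * (2 * ln (cmod (F \<omega> (of_nat k * ucirc t))) - (real k)\<^sup>2))"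
      by (intro arg_cong[where f = "\<lambda>x. w t * x"] sum.cong refl) (simp only: lnN)
    also have "\<dots> = 2 * (w t * (\<Sum>k\<in>K. c k * ln (cmod (F \<omega> (of_nat k * ucirc t))))) - w t * (\<Sum>k\<in>K. c k * (real k)\<^sup>2)"
      by (simp add: right_diff_distrib sum_subtractf sum_distrib_left mult_ac)
    finally show ?thesis .
  qed
  ultimately show ?thesis by simp
qed

text \<open>Jensen's formula and \<open>has_integral_circle_log\<close> evaluate the same integral.
  The normalizing factor leaves only the deterministic term with \<open>k^2\<close>.\<close>

lemma zero_sum_count:
  assumes g: "decaying_coeffs \<omega>" and nz: "\<And>k z. k \<in> K \<Longrightarrow> cmod z = real k \<Longrightarrow> F \<omega> z \<noteq> 0" and nz0: "F \<omega> z0 \<noteq> 0"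
    and K: "finite K" "K \<subseteq> {0<..L}" and c: "(\<Sum>k\<in>K. c k) = 0"
  shows "(\<Sum>a\<in>{a \<in> ball 0 (real L + 1). F \<omega> a = 0}. real (zero_config (F \<omega>) a) * (\<Sum>k\<in>K. c k * ln (max (real k) (cmod a))))
    = (circle_log K c (\<lambda>_. 1) \<omega> + (\<Sum>k\<in>K. c k * (real k)\<^sup>2)) / 2" (is "?S = _")
proof -
  have h: "((\<lambda>t. \<Sum>k\<in>K. c k * ln (cmod (F \<omega> (of_nat k * ucirc t)))) has_integral ?S) {0..1}"
    by (rule circle_mean_log_combination(1)[OF decaying_coeffs_holomorphic[OF g] nz0 K _ c]) (rule nz)
  have "((\<lambda>t. \<Sum>k\<in>K. c k * (real k)\<^sup>2) has_integral (\<Sum>k\<in>K. c k * (real k)\<^sup>2)) {0..1::real}"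
    using has_integral_const_real[of "\<Sum>k\<in>K. c k * (real k)\<^sup>2" 0 1] by simp
  from has_integral_diff[OF has_integral_mult_right[OF h, where c = 2] this]
  have "((\<lambda>t. 2 * (\<Sum>k\<in>K. c k * ln (cmod (F \<omega> (of_nat k * ucirc t)))) - (\<Sum>k\<in>K. c k * (real k)\<^sup>2))
      has_integral 2 * ?S - (\<Sum>k\<in>K. c k * (real k)\<^sup>2)) {0..1}" .
  moreover have "((\<lambda>t. 2 * (\<Sum>k\<in>K. c k * ln (cmod (F \<omega> (of_nat k * ucirc t)))) - (\<Sum>k\<in>K. c k * (real k)\<^sup>2))
      has_integral circle_log K c (\<lambda>_. 1) \<omega>) {0..1}"
    using has_integral_circle_log[where K = K and w = "\<lambda>_. 1" and c = c, OF g] nz by simp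
  ultimately have "2 * ?S - (\<Sum>k\<in>K. c k * (real k)\<^sup>2) = circle_log K c (\<lambda>_. 1) \<omega>"
    by (rule has_integral_unique)
  then show ?thesis by simp
qed

text \<open>Cosine and sine weights are the real and imaginary part of \<open>ucirc\<close>. The
  \<open>k^2\<close> terms disappear because \<open>ucirc\<close> has mean zero, and the 2 of the
  squared modulus cancels the 1/2 of the Fourier coefficient.\<close>

lemma zero_sum_moment:
  assumes g: "decaying_coeffs \<omega>" and nz: "\<And>k z. k \<in> K \<Longrightarrow> cmod z = real k \<Longrightarrow> F \<omega> z \<noteq> 0" and nz0: "F \<omega> z0 \<noteq> 0"
    and K: "finite K" "K \<subseteq> {0<..L}" and c: "(\<Sum>k\<in>K. c k * real k) = 0"
  shows "(\<Sum>a\<in>{a \<in> ball 0 (real L + 1). F \<omega> a = 0}. of_nat (zero_config (F \<omega>) a) * (a * of_real (\<Sum>k\<in>K. c k * k / (max (real k) (cmod a))\<^sup>2)))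
    = - Complex (circle_log K c (\<lambda>t. cos (2 * pi * t)) \<omega>) (circle_log K c (\<lambda>t. sin (2 * pi * t)) \<omega>)" (is "?S = _")
proof -
  note h = circle_mean_log_combination(2)[OF decaying_coeffs_holomorphic[OF g] nz0 K nz c]
  define q where "q = (\<Sum>k\<in>K. c k * (real k)\<^sup>2)"
  have "((\<lambda>t. 2 * ((\<Sum>k\<in>K. of_real (c k * ln (cmod (F \<omega> (of_nat k * ucirc t))))) * ucirc t) - of_real q * ucirc t) has_integral
    2 * (- ?S / 2) - of_real q * 0) {0..1}"
    by (intro has_integral_diff has_integral_mult_right has_integral_ucirc h)
  then have h2: "((\<lambda>t. 2 * ((\<Sum>k\<in>K. of_real (c k * ln (cmod (F \<omega> (of_nat k * ucirc t))))) * ucirc t) - of_real q * ucirc t) has_integral - ?S) {0..1}"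
    by simp
  have "((\<lambda>t. 2 * (cos (2 * pi * t) * (\<Sum>k\<in>K. c k * ln (cmod (F \<omega> (of_nat k * ucirc t))))) - cos (2 * pi * t) * q) has_integral Re (- ?S)) {0..1}"
    by (rule has_integral_eq[OF _ has_integral_linear[OF h2 bounded_linear_Re]])
       (simp add: mult.commute flip: of_real_sum of_real_mult)
  moreover have "((\<lambda>t. 2 * (cos (2 * pi * t) * (\<Sum>k\<in>K. c k * ln (cmod (F \<omega> (of_nat k * ucirc t))))) - cos (2 * pi * t) * q) has_integral
      circle_log K c (\<lambda>t. cos (2 * pi * t)) \<omega>) {0..1}"
    unfolding q_def by (rule has_integral_circle_log[OF g nz]) (auto intro!: continuous_intros)
  ultimately have "circle_log K c (\<lambda>t. cos (2 * pi * t)) \<omega> = Re (- ?S)"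
    by (rule has_integral_unique[symmetric])
  moreover have "((\<lambda>t. 2 * (sin (2 * pi * t) * (\<Sum>k\<in>K. c k * ln (cmod (F \<omega> (of_nat k * ucirc t))))) - sin (2 * pi * t) * q) has_integral Im (- ?S)) {0..1}"
    by (rule has_integral_eq[OF _ has_integral_linear[OF h2 bounded_linear_Im]])
       (simp add: mult.commute flip: of_real_sum of_real_mult)
  moreover have "((\<lambda>t. 2 * (sin (2 * pi * t) * (\<Sum>k\<in>K. c k * ln (cmod (F \<omega> (of_nat k * ucirc t))))) - sin (2 * pi * t) * q) has_integral
      circle_log K c (\<lambda>t. sin (2 * pi * t)) \<omega>) {0..1}"
    unfolding q_def by (rule has_integral_circle_log[OF g nz]) (auto intro!: continuous_intros)
  ultimately have "circle_log K c (\<lambda>t. cos (2 * pi * t)) \<omega> = Re (- ?S)" "circle_log K c (\<lambda>t. sin (2 * pi * t)) \<omega> = Im (- ?S)"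
    using has_integral_unique by blast+
  then show ?thesis by (simp add: complex_eq_iff)
qed

end

section \<open>Rigidity of the zeros\<close>

text \<open>Preimages of open sets are the very sets that generate the topology.\<close>

lemma measurable_integral_test_function:
  assumes "\<phi> \<in> test_functions A"
  shows "(\<lambda>c. \<integral>z. \<phi> z \<partial>counting_measure c) \<in> borel_measurable (borel_of (weak_topology A))"
proof (rule borel_measurableI)
  fix U :: "real set" assume U: "open U"
  have sub: "{V. openin (weak_topology A) V} \<subseteq> Pow (topspace (weak_topology A))"
    using openin_subset by auto
  have "openin (weak_topology A) {c \<in> configs A. (\<integral>z. \<phi> z \<partial>counting_measure c) \<in> U}"
    unfolding weak_topology_def using assms U by (intro topology_generated_by_Basis) blast
  moreover have "(\<lambda>c. \<integral>z. \<phi> z \<partial>counting_measure c) -` U \<inter> space (borel_of (weak_topology A))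
      = {c \<in> configs A. (\<integral>z. \<phi> z \<partial>counting_measure c) \<in> U}"
    unfolding borel_of_def using sub by (auto simp: space_measure_of topspace_weak_topology)
  ultimately show "(\<lambda>c. \<integral>z. \<phi> z \<partial>counting_measure c) -` U \<inter> space (borel_of (weak_topology A)) \<in> sets (borel_of (weak_topology A))"
    unfolding borel_of_def sets_measure_of[OF sub] by auto
qed

text \<open>A test function vanishing beyond \<open>R\<close> reduces the integral over the outer
  configuration to a finite sum over the zeros in the ball that lie outside
  \<open>D\<close>.\<close>

lemma zeros_restrict_split:
  assumes f: "f holomorphic_on UNIV" and nz: "f z0 \<noteq> 0" and D: "open D" "D \<subseteq> ball 0 R"
  defines "Z \<equiv> {a \<in> ball 0 R. f a = 0}"
  shows "num_points (restrict_config (zero_config f) D) = (\<Sum>a\<in>Z \<inter> D. zero_config f a)"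
    and "sum_points (restrict_config (zero_config f) D) = (\<Sum>a\<in>Z \<inter> D. of_nat (zero_config f a) * a)"
    and "\<And>\<psi>. \<psi> \<in> test_functions (- D) \<Longrightarrow> (\<And>a. R \<le> cmod a \<Longrightarrow> \<psi> a = 0) \<Longrightarrow>
      (\<Sum>a\<in>Z. real (zero_config f a) * \<psi> a) = (\<Sum>a\<in>Z \<inter> D. real (zero_config f a) * \<psi> a)
        + (\<integral>z. \<psi> z \<partial>counting_measure (restrict_config (zero_config f) (- D)))"
proof -
  have finZ: "finite Z" unfolding Z_def by (rule finite_zeros_entire[OF f nz bounded_ball])
  have c0: "f a = 0" if "zero_config f a \<noteq> 0" for a
    using that by (auto simp: zero_config_def split: if_splits)
  have sub: "{z. restrict_config (zero_config f) D z \<noteq> 0} \<subseteq> Z \<inter> D"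
    using c0 D by (auto simp: restrict_config_def Z_def split: if_splits)
  show "num_points (restrict_config (zero_config f) D) = (\<Sum>a\<in>Z \<inter> D. zero_config f a)"
    unfolding num_points_def
    by (rule sum.mono_neutral_cong_left) (use finZ sub in \<open>auto simp: restrict_config_def\<close>)
  show "sum_points (restrict_config (zero_config f) D) = (\<Sum>a\<in>Z \<inter> D. of_nat (zero_config f a) * a)"
    unfolding sum_points_def
    by (rule sum.mono_neutral_cong_left) (use finZ sub in \<open>auto simp: restrict_config_def\<close>)
  fix \<psi> :: "complex \<Rightarrow> real"
  assume \<psi>: "\<psi> \<in> test_functions (- D)" and \<psi>0: "\<And>a. R \<le> cmod a \<Longrightarrow> \<psi> a = 0"
  have conf: "restrict_config (zero_config f) (- D) \<in> configs (- D)"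
  proof -
    have "finite {z \<in> K. restrict_config (zero_config f) (- D) z \<noteq> 0}" if "compact K" for K
      by (rule finite_subset[OF _ finite_zeros_entire[OF f nz compact_imp_bounded[OF that]]])
         (use c0 in \<open>auto simp: restrict_config_def split: if_splits\<close>)
    then show ?thesis by (auto simp: configs_def restrict_config_def)
  qed
  have "(\<integral>z. \<psi> z \<partial>counting_measure (restrict_config (zero_config f) (- D))) = (\<Sum>a\<in>Z - D. real (zero_config f a) * \<psi> a)"
    unfolding integral_counting_measure[OF conf \<psi>]
  proof (rule sum.mono_neutral_cong_left)
    show "{z. restrict_config (zero_config f) (- D) z \<noteq> 0 \<and> \<psi> z \<noteq> 0} \<subseteq> Z - D"
    proof -
      have "cmod z < R" if "\<psi> z \<noteq> 0" for z using \<psi>0[of z] that by (meson not_le)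
      then show ?thesis using c0 by (auto simp: restrict_config_def Z_def split: if_splits)
    qed
  qed (use finZ in \<open>auto simp: restrict_config_def\<close>)
  moreover have "(\<Sum>a\<in>Z. real (zero_config f a) * \<psi> a) = (\<Sum>a\<in>Z \<inter> D. real (zero_config f a) * \<psi> a) + (\<Sum>a\<in>Z - D. real (zero_config f a) * \<psi> a)"
    by (rule sum.Int_Diff[OF finZ])
  ultimately show "(\<Sum>a\<in>Z. real (zero_config f a) * \<psi> a) = (\<Sum>a\<in>Z \<inter> D. real (zero_config f a) * \<psi> a)
        + (\<integral>z. \<psi> z \<partial>counting_measure (restrict_config (zero_config f) (- D)))" by simp
qed

text \<open>\<open>- D\<close> is closed, so its part in a closed disc is compact. The function may
  thus be 1 on the boundary of \<open>D\<close>.\<close>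

lemma test_functionsI:
  assumes D: "open D" and \<phi>: "continuous_on UNIV \<phi>" "\<And>a. R \<le> cmod a \<Longrightarrow> \<phi> a = 0"
  shows "\<phi> \<in> test_functions (- D)"
  unfolding test_functions_def
proof (intro CollectI conjI exI[of _ "cball 0 R \<inter> - D"])
  show "continuous_on (- D) \<phi>" using \<phi>(1) by (rule continuous_on_subset) auto
  show "compact (cball 0 R \<inter> - D)" using D by (intro compact_Int_closed) auto
  show "\<forall>z\<in>- D - (cball 0 R \<inter> - D). \<phi> z = 0"
  proof
    fix z assume "z \<in> - D - (cball 0 R \<inter> - D)"
    then have "R \<le> cmod z" by auto
    then show "\<phi> z = 0" by (rule \<phi>(2))
  qed
qed auto

definition count_test :: "nat set \<Rightarrow> (nat \<Rightarrow> real) \<Rightarrow> complex \<Rightarrow> real" where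
  "count_test K c a = (\<Sum>k\<in>K. c k * ln (max (real k) (cmod a)))"

definition moment_test :: "nat set \<Rightarrow> (nat \<Rightarrow> real) \<Rightarrow> complex \<Rightarrow> real" where
  "moment_test K c a = (\<Sum>k\<in>K. c k * real k / (max (real k) (cmod a))\<^sup>2)"

text \<open>Below all radii each maximum is \<open>k\<close>, and the second condition gives 1;
  beyond all radii it is \<open>cmod a\<close>, and \<open>\<Sum> c k = 0\<close> gives 0. The
  condition that removes the unknown constant in Jensen's formula thus also makes the support
  compact.\<close>

lemma count_test:
  assumes K: "\<And>k. k \<in> K \<Longrightarrow> r < k" and c: "(\<Sum>k\<in>K. c k) = 0" "(\<Sum>k\<in>K. c k * ln (real k)) = 1"
  shows "continuous_on UNIV (count_test K c)"
    and "cmod a \<le> real r \<Longrightarrow> count_test K c a = 1"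
    and "(\<And>k. k \<in> K \<Longrightarrow> real k \<le> cmod a) \<Longrightarrow> count_test K c a = 0"
proof -
  have "max (real k) (cmod a) \<noteq> 0" if "k \<in> K" for k a using K[OF that] by (auto simp: max_def)
  then show "continuous_on UNIV (count_test K c)"
    unfolding count_test_def by (intro continuous_intros) auto
  show "count_test K c a = 1" if "cmod a \<le> real r"
  proof -
    have "count_test K c a = (\<Sum>k\<in>K. c k * ln (real k))"
      unfolding count_test_def
      by (rule sum.cong) (use K that in \<open>force simp: max_def\<close>)+
    then show ?thesis using c by simp
  qed
  show "count_test K c a = 0" if "\<And>k. k \<in> K \<Longrightarrow> real k \<le> cmod a"
  proof -
    have "count_test K c a = (\<Sum>k\<in>K. c k * ln (cmod a))"
      unfolding count_test_def by (rule sum.cong) (use that in \<open>auto simp: max_absorb2\<close>)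
    then show ?thesis using c by (simp add: sum_distrib_right[symmetric])
  qed
qed

text \<open>As for \<open>count_test\<close>; here \<open>\<Sum> c k * k = 0\<close> both removes
  \<open>v\<close> and makes the support compact.\<close>

lemma moment_test:
  assumes K: "\<And>k. k \<in> K \<Longrightarrow> r < k" and c: "(\<Sum>k\<in>K. c k * real k) = 0" "(\<Sum>k\<in>K. c k / real k) = 1"
  shows "continuous_on UNIV (moment_test K c)"
    and "cmod a \<le> real r \<Longrightarrow> moment_test K c a = 1"
    and "(\<And>k. k \<in> K \<Longrightarrow> real k \<le> cmod a) \<Longrightarrow> moment_test K c a = 0"
proof -
  have "max (real k) (cmod a) \<noteq> 0" if "k \<in> K" for k a using K[OF that] by (auto simp: max_def)
  then show "continuous_on UNIV (moment_test K c)"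
    unfolding moment_test_def by (intro continuous_intros) auto
  show "moment_test K c a = 1" if "cmod a \<le> real r"
  proof -
    have "moment_test K c a = (\<Sum>k\<in>K. c k / real k)"
      unfolding moment_test_def
    proof (rule sum.cong[OF refl])
      fix k assume "k \<in> K"
      then have "max (real k) (cmod a) = real k" using K[of k] that by auto
      then show "c k * real k / (max (real k) (cmod a))\<^sup>2 = c k / real k" by (simp add: power2_eq_square)
    qed
    then show ?thesis using c by simp
  qed
  show "moment_test K c a = 0" if "\<And>k. k \<in> K \<Longrightarrow> real k \<le> cmod a"
  proof -
    have "moment_test K c a = (\<Sum>k\<in>K. c k * real k / (cmod a)\<^sup>2)"
      unfolding moment_test_def by (rule sum.cong) (use that in \<open>auto simp: max_absorb2\<close>)
    then show ?thesis using c by (simp add: sum_divide_distrib[symmetric])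
  qed
qed

section \<open>The number and the sum of the zeros in \<open>D\<close> as limits of outer
  statistics\<close>

context gaf_process begin

abbreviation zeros :: "'w \<Rightarrow> config" where
  "zeros \<omega> \<equiv> zero_config (F \<omega>)"

lemma AE_nonzero_on_circles:
  fixes K :: "nat \<Rightarrow> nat set"
  assumes "\<And>j. finite (K j)" "\<And>j k. k \<in> K j \<Longrightarrow> k > 0"
  shows "AE \<omega> in M. \<forall>j. \<forall>k\<in>K j. \<forall>z. cmod z = real k \<longrightarrow> F \<omega> z \<noteq> 0"
  unfolding AE_all_countable using assms AE_nonzero_on_circle by (intro allI AE_finite_allI) auto

lemma count_rigidity:
  assumes D: "open D" "bounded D"
  shows "\<exists>N \<in> measurable (borel_of (weak_topology (- D))) (count_space (UNIV :: nat set)).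
    AE \<omega> in M. num_points (restrict_config (zeros \<omega>) D) = N (restrict_config (zeros \<omega>) (- D))"
proof -
  obtain B where B: "\<And>a. a \<in> D \<Longrightarrow> cmod a \<le> B" using D(2) by (auto simp: bounded_iff)
  obtain r :: nat where "B \<le> real r" using real_arch_simple by blast
  with B have r: "cmod a \<le> real r" if "a \<in> D" for a using that by force
  have "\<exists>K c. finite K \<and> (\<forall>k\<in>K. r < k) \<and> (\<Sum>k\<in>K. c k) = 0 \<and> (\<Sum>k\<in>K. c k * ln (real k)) = 1 \<and> circle_energy K c \<le> (1 / 2) ^ j" for j :: nat
  proof -
    have "(1 / 2 :: real) ^ j > 0" by simp
    then obtain K c where "finite K" "\<And>k. k \<in> K \<Longrightarrow> k > r" "(\<Sum>k\<in>K. c k) = 0" "(\<Sum>k\<in>K. c k * ln (real k)) = 1" "circle_energy K c \<le> (1 / 2) ^ j"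
      by (rule count_coefficients[where n = r]) blast
    then show ?thesis by blast
  qed
  then obtain K c where K: "\<And>j. finite (K j)" "\<And>j k. k \<in> K j \<Longrightarrow> r < k"
    and c: "\<And>j. (\<Sum>k\<in>K j. c j k) = 0" "\<And>j. (\<Sum>k\<in>K j. c j k * ln (real k)) = 1"
    and energy: "\<And>j :: nat. circle_energy (K j) (c j) \<le> (1 / 2) ^ j"
    by metis
  have K0: "k > 0" if "k \<in> K j" for j k using K(2)[OF that] by simp
  define L where "L = (\<lambda>j. Max (K j))"
  have L: "K j \<subseteq> {0<..L j}" for j using K K0 by (auto simp: L_def)
  have Lr: "r < L j" for j
  proof -
    have "K j \<noteq> {}" using c(2)[of j] by auto
    then have "L j \<in> K j" unfolding L_def by (intro Max_in K)
    then show ?thesis by (rule K(2))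
  qed
  have ct: "continuous_on UNIV (count_test (K j) (c j))" "\<And>a. cmod a \<le> real r \<Longrightarrow> count_test (K j) (c j) a = 1"
    "\<And>a. (\<And>k. k \<in> K j \<Longrightarrow> real k \<le> cmod a) \<Longrightarrow> count_test (K j) (c j) a = 0" for j
    using count_test[of "K j" r "c j"] K(2)[of _ j] c[of j] by blast+
  have out: "count_test (K j) (c j) a = 0" if "real (L j) + 1 \<le> cmod a" for j a
  proof (rule ct(3))
    fix k assume "k \<in> K j"
    then have "real k \<le> real (L j)" using L[of j] by auto
    then show "real k \<le> cmod a" using that by linarith
  qed
  have test: "count_test (K j) (c j) \<in> test_functions (- D)" for j
    by (rule test_functionsI[OF D(1) ct(1)]) (rule out)
  \<comment> \<open>The deterministic part of the linear statistic, left by the normalizing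
    factor.\<close>
  define e where "e = (\<lambda>j. (\<Sum>k\<in>K j. c j k * (real k)\<^sup>2) / 2)"
  \<comment> \<open>Computed from the outer configuration alone; on zeros of \<open>F\<close> it
    will equal the number of points in \<open>D\<close> minus half of
    \<open>circle_log\<close>.\<close>
  define I where "I = (\<lambda>j x. e j - (\<integral>z. count_test (K j) (c j) z \<partial>counting_measure x))"
  \<comment> \<open>\<open>lim\<close> and rounding are total, so \<open>N\<close> is defined and
    measurable on all outer configurations; the limit is known to be a natural number only almost
    surely.\<close>
  define N where "N = (\<lambda>x. nat \<lfloor>lim (\<lambda>j. I j x) + 1 / 2\<rfloor>)"
  let ?B = "borel_of (weak_topology (- D))"
  have "I j \<in> borel_measurable ?B" for j
    unfolding I_def by (intro borel_measurable_diff borel_measurable_const measurable_integral_test_function test)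
  then have "(\<lambda>x. lim (\<lambda>j. I j x) + 1 / 2) \<in> borel_measurable ?B"
    by (intro borel_measurable_add borel_measurable_const borel_measurable_lim_metric)
  then have "(\<lambda>x. \<lfloor>lim (\<lambda>j. I j x) + 1 / 2\<rfloor>) \<in> measurable ?B (count_space UNIV)"
    by (rule measurable_compose[OF _ measurable_real_floor])
  then have "N \<in> measurable ?B (count_space UNIV)"
    unfolding N_def by (rule measurable_compose) simp
  moreover have "AE \<omega> in M. num_points (restrict_config (zeros \<omega>) D) = N (restrict_config (zeros \<omega>) (- D))"
  proof -
    have "AE \<omega> in M. (\<lambda>j. circle_log (K j) (c j) (\<lambda>_. 1) \<omega>) \<longlonglongrightarrow> 0"
      by (rule AE_circle_log_tendsto_0) (use K(1) K0 c energy in auto)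
    moreover have "AE \<omega> in M. \<forall>j. \<forall>k\<in>K j. \<forall>z. cmod z = real k \<longrightarrow> F \<omega> z \<noteq> 0"
      by (rule AE_nonzero_on_circles) (use K(1) K0 in auto)
    ultimately show ?thesis using AE_decaying_coeffs
    proof eventually_elim
      fix \<omega> assume g: "decaying_coeffs \<omega>" and nz: "\<forall>j. \<forall>k\<in>K j. \<forall>z. cmod z = real k \<longrightarrow> F \<omega> z \<noteq> 0"
        and lim0: "(\<lambda>j. circle_log (K j) (c j) (\<lambda>_. 1) \<omega>) \<longlonglongrightarrow> 0"
      let ?n = "num_points (restrict_config (zeros \<omega>) D)" and ?x = "restrict_config (zeros \<omega>) (- D)"
      have I: "I j ?x = real ?n - circle_log (K j) (c j) (\<lambda>_. 1) \<omega> / 2" for j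
      proof -
        \<comment> \<open>Some circle exists, and \<open>F\<close> has no zero on it; this supplies
          the point where \<open>F\<close> is nonzero.\<close>
        have "K j \<noteq> {}" using c(2)[of j] by auto
        then obtain z0 where z0: "F \<omega> z0 \<noteq> 0" using nz by (metis ex_in_conv norm_of_nat)
        have DL: "D \<subseteq> ball 0 (real (L j) + 1)" using r Lr[of j] by fastforce
        let ?Z = "{a \<in> ball 0 (real (L j) + 1). F \<omega> a = 0}"
        note split = zeros_restrict_split[OF decaying_coeffs_holomorphic[OF g] z0 D(1) DL]
        have "(\<Sum>a\<in>?Z \<inter> D. real (zeros \<omega> a) * count_test (K j) (c j) a) = (\<Sum>a\<in>?Z \<inter> D. real (zeros \<omega> a))"
          by (rule sum.cong) (use ct(2) r in auto)
        also have "\<dots> = real ?n" unfolding split(1) by simp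
        finally have "(\<Sum>a\<in>?Z. real (zeros \<omega> a) * count_test (K j) (c j) a) = real ?n + (\<integral>z. count_test (K j) (c j) z \<partial>counting_measure ?x)"
          using split(3)[OF test out] by simp
        moreover have "(\<Sum>a\<in>?Z. real (zeros \<omega> a) * count_test (K j) (c j) a) = (circle_log (K j) (c j) (\<lambda>_. 1) \<omega> + (\<Sum>k\<in>K j. c j k * (real k)\<^sup>2)) / 2"
          unfolding count_test_def
          by (rule zero_sum_count[OF g _ z0 K(1) L c(1)]) (use nz in auto)
        ultimately show ?thesis by (simp add: I_def e_def add_divide_distrib)
      qed
      have "(\<lambda>j. I j ?x) \<longlonglongrightarrow> real ?n - 0 / 2"
        unfolding I by (intro tendsto_intros lim0) simp
      then have "lim (\<lambda>j. I j ?x) = real ?n" by (simp add: limI)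
      then show "?n = N ?x" by (simp add: N_def)
    qed
  qed
  ultimately show ?thesis by blast
qed

lemma moment_rigidity:
  assumes D: "open D" "bounded D"
  shows "\<exists>S \<in> measurable (borel_of (weak_topology (- D))) (borel :: complex measure).
    AE \<omega> in M. sum_points (restrict_config (zeros \<omega>) D) = S (restrict_config (zeros \<omega>) (- D))"
proof -
  obtain B where B: "\<And>a. a \<in> D \<Longrightarrow> cmod a \<le> B" using D(2) by (auto simp: bounded_iff)
  obtain r :: nat where "B \<le> real r" using real_arch_simple by blast
  with B have r: "cmod a \<le> real r" if "a \<in> D" for a using that by force
  have "\<exists>K c. finite K \<and> (\<forall>k\<in>K. r < k) \<and> (\<Sum>k\<in>K. c k * real k) = 0 \<and> (\<Sum>k\<in>K. c k / real k) = 1 \<and> circle_energy K c \<le> (1 / 2) ^ j" for j :: nat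
  proof -
    have "(1 / 2 :: real) ^ j > 0" by simp
    then obtain K c where "finite K" "\<And>k. k \<in> K \<Longrightarrow> k > r" "(\<Sum>k\<in>K. c k * real k) = 0" "(\<Sum>k\<in>K. c k / real k) = 1" "circle_energy K c \<le> (1 / 2) ^ j"
      by (rule moment_coefficients[where n = r]) blast
    then show ?thesis by blast
  qed
  then obtain K c where K: "\<And>j. finite (K j)" "\<And>j k. k \<in> K j \<Longrightarrow> r < k"
    and c: "\<And>j. (\<Sum>k\<in>K j. c j k * real k) = 0" "\<And>j. (\<Sum>k\<in>K j. c j k / real k) = 1"
    and energy: "\<And>j :: nat. circle_energy (K j) (c j) \<le> (1 / 2) ^ j"
    by metis
  have K0: "k > 0" if "k \<in> K j" for j k using K(2)[OF that] by simp
  define L where "L = (\<lambda>j. Max (K j))"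
  have L: "K j \<subseteq> {0<..L j}" for j using K K0 by (auto simp: L_def)
  have Lr: "r < L j" for j
  proof -
    have "K j \<noteq> {}" using c(2)[of j] by auto
    then have "L j \<in> K j" unfolding L_def by (intro Max_in K)
    then show ?thesis by (rule K(2))
  qed
  have mt: "continuous_on UNIV (moment_test (K j) (c j))" "\<And>a. cmod a \<le> real r \<Longrightarrow> moment_test (K j) (c j) a = 1"
    "\<And>a. (\<And>k. k \<in> K j \<Longrightarrow> real k \<le> cmod a) \<Longrightarrow> moment_test (K j) (c j) a = 0" for j
    using moment_test[of "K j" r "c j"] K(2)[of _ j] c[of j] by blast+
  have out: "moment_test (K j) (c j) a = 0" if "real (L j) + 1 \<le> cmod a" for j a
  proof (rule mt(3))
    fix k assume "k \<in> K j"
    then have "real k \<le> real (L j)" using L[of j] by auto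
    then show "real k \<le> cmod a" using that by linarith
  qed
  \<comment> \<open>Test functions are real, so the complex function \<open>a * moment_test\<close>
    is split into its parts \<open>h = Re\<close> and \<open>h = Im\<close>.\<close>
  define \<phi> where "\<phi> = (\<lambda>h j a. h a * moment_test (K j) (c j) a)"
  have \<phi>_out: "\<phi> h j a = 0" if "real (L j) + 1 \<le> cmod a" for h j a
    using out[OF that] by (simp add: \<phi>_def)
  have test: "\<phi> h j \<in> test_functions (- D)" if "continuous_on UNIV h" for h j
    by (rule test_functionsI[OF D(1) _ \<phi>_out]) (auto simp: \<phi>_def intro!: continuous_intros that mt(1))
  have tests: "\<phi> Re j \<in> test_functions (- D)" "\<phi> Im j \<in> test_functions (- D)" for j
    by (auto intro!: test continuous_intros)
  \<comment> \<open>No compensating constant as in the count: the normalizing factor is radial and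
    has no first Fourier coefficient.\<close>
  define I where "I = (\<lambda>h j x. - (\<integral>z. \<phi> h j z \<partial>counting_measure x))"
  define S where "S = (\<lambda>x. of_real (lim (\<lambda>j. I Re j x)) + \<i> * of_real (lim (\<lambda>j. I Im j x)))"
  let ?B = "borel_of (weak_topology (- D))"
  have "I Re j \<in> borel_measurable ?B" "I Im j \<in> borel_measurable ?B" for j
    unfolding I_def by (intro borel_measurable_uminus measurable_integral_test_function tests)+
  then have "(\<lambda>x. lim (\<lambda>j. I Re j x)) \<in> borel_measurable ?B" "(\<lambda>x. lim (\<lambda>j. I Im j x)) \<in> borel_measurable ?B"
    by (auto intro: borel_measurable_lim_metric)
  then have "S \<in> borel_measurable ?B" unfolding S_def by measurable
  moreover have "AE \<omega> in M. sum_points (restrict_config (zeros \<omega>) D) = S (restrict_config (zeros \<omega>) (- D))"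
  proof -
    \<comment> \<open>Here \<open>\<Sum> c k\<close> need not vanish; the mean-zero weight supplies
      the condition of \<open>AE_circle_log_tendsto_0\<close>.\<close>
    have cos0: "(\<integral>t. cos (2 * pi * t) \<partial>unit_interval_measure) = 0"
    proof -
      have "((\<lambda>t. cos (2 * pi * t)) has_integral 0) {0..1}"
        using has_integral_linear[OF has_integral_ucirc bounded_linear_Re] by (simp add: o_def)
      moreover have "((\<lambda>t. cos (2 * pi * t)) has_integral (\<integral>t. cos (2 * pi * t) \<partial>unit_interval_measure)) {0..1}"
        by (rule integral_unit_interval_measure) (auto intro!: continuous_intros)
      ultimately show ?thesis using has_integral_unique by blast
    qed
    have sin0: "(\<integral>t. sin (2 * pi * t) \<partial>unit_interval_measure) = 0"
    proof -
      have "((\<lambda>t. sin (2 * pi * t)) has_integral 0) {0..1}"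
        using has_integral_linear[OF has_integral_ucirc bounded_linear_Im] by (simp add: o_def)
      moreover have "((\<lambda>t. sin (2 * pi * t)) has_integral (\<integral>t. sin (2 * pi * t) \<partial>unit_interval_measure)) {0..1}"
        by (rule integral_unit_interval_measure) (auto intro!: continuous_intros)
      ultimately show ?thesis using has_integral_unique by blast
    qed
    have "AE \<omega> in M. (\<lambda>j. circle_log (K j) (c j) (\<lambda>t. cos (2 * pi * t)) \<omega>) \<longlonglongrightarrow> 0"
      by (rule AE_circle_log_tendsto_0) (use K(1) K0 energy cos0 in auto)
    moreover have "AE \<omega> in M. (\<lambda>j. circle_log (K j) (c j) (\<lambda>t. sin (2 * pi * t)) \<omega>) \<longlonglongrightarrow> 0"
      by (rule AE_circle_log_tendsto_0) (use K(1) K0 energy sin0 in auto)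
    moreover have "AE \<omega> in M. \<forall>j. \<forall>k\<in>K j. \<forall>z. cmod z = real k \<longrightarrow> F \<omega> z \<noteq> 0"
      by (rule AE_nonzero_on_circles) (use K(1) K0 in auto)
    ultimately show ?thesis using AE_decaying_coeffs
    proof eventually_elim
      fix \<omega> assume g: "decaying_coeffs \<omega>" and nz: "\<forall>j. \<forall>k\<in>K j. \<forall>z. cmod z = real k \<longrightarrow> F \<omega> z \<noteq> 0"
        and lim0: "(\<lambda>j. circle_log (K j) (c j) (\<lambda>t. cos (2 * pi * t)) \<omega>) \<longlonglongrightarrow> 0"
          "(\<lambda>j. circle_log (K j) (c j) (\<lambda>t. sin (2 * pi * t)) \<omega>) \<longlonglongrightarrow> 0"
      let ?s = "sum_points (restrict_config (zeros \<omega>) D)" and ?x = "restrict_config (zeros \<omega>) (- D)"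
      have I: "I Re j ?x = Re ?s + circle_log (K j) (c j) (\<lambda>t. cos (2 * pi * t)) \<omega> \<and>
           I Im j ?x = Im ?s + circle_log (K j) (c j) (\<lambda>t. sin (2 * pi * t)) \<omega>" for j
      proof -
        have "K j \<noteq> {}" using c(2)[of j] by auto
        then obtain z0 where z0: "F \<omega> z0 \<noteq> 0" using nz by (metis ex_in_conv norm_of_nat)
        have DL: "D \<subseteq> ball 0 (real (L j) + 1)" using r Lr[of j] by fastforce
        let ?Z = "{a \<in> ball 0 (real (L j) + 1). F \<omega> a = 0}"
        note split = zeros_restrict_split[OF decaying_coeffs_holomorphic[OF g] z0 D(1) DL]
        have "(\<Sum>a\<in>?Z. of_nat (zeros \<omega> a) * (a * of_real (moment_test (K j) (c j) a)))
          = - Complex (circle_log (K j) (c j) (\<lambda>t. cos (2 * pi * t)) \<omega>) (circle_log (K j) (c j) (\<lambda>t. sin (2 * pi * t)) \<omega>)" (is "?T = _")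
          unfolding moment_test_def
          by (rule zero_sum_moment[OF g _ z0 K(1) L c(1)]) (use nz in auto)
        then have "Re ?T = - circle_log (K j) (c j) (\<lambda>t. cos (2 * pi * t)) \<omega>" "Im ?T = - circle_log (K j) (c j) (\<lambda>t. sin (2 * pi * t)) \<omega>"
          by simp_all
        then have T: "(\<Sum>a\<in>?Z. real (zeros \<omega> a) * \<phi> Re j a) = - circle_log (K j) (c j) (\<lambda>t. cos (2 * pi * t)) \<omega>"
          "(\<Sum>a\<in>?Z. real (zeros \<omega> a) * \<phi> Im j a) = - circle_log (K j) (c j) (\<lambda>t. sin (2 * pi * t)) \<omega>"
          by (simp_all add: \<phi>_def)
        have one: "moment_test (K j) (c j) a = 1" if "a \<in> D" for a using mt(2) r that by auto
        have "(\<Sum>a\<in>?Z \<inter> D. real (zeros \<omega> a) * \<phi> Re j a) = (\<Sum>a\<in>?Z \<inter> D. real (zeros \<omega> a) * Re a)"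
          by (rule sum.cong) (auto simp: \<phi>_def one)
        then have 1: "(\<Sum>a\<in>?Z \<inter> D. real (zeros \<omega> a) * \<phi> Re j a) = Re ?s" unfolding split(2) by simp
        have "(\<Sum>a\<in>?Z \<inter> D. real (zeros \<omega> a) * \<phi> Im j a) = (\<Sum>a\<in>?Z \<inter> D. real (zeros \<omega> a) * Im a)"
          by (rule sum.cong) (auto simp: \<phi>_def one)
        then have 2: "(\<Sum>a\<in>?Z \<inter> D. real (zeros \<omega> a) * \<phi> Im j a) = Im ?s" unfolding split(2) by simp
        have "(\<Sum>a\<in>?Z. real (zeros \<omega> a) * \<phi> h j a) = (\<Sum>a\<in>?Z \<inter> D. real (zeros \<omega> a) * \<phi> h j a)
            + (\<integral>z. \<phi> h j z \<partial>counting_measure ?x)" if "continuous_on UNIV h" for h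
          by (rule split(3)[OF test[OF that]]) (rule \<phi>_out)
        from this[of Re] this[of Im] show ?thesis
          unfolding T 1 2 I_def by (simp add: continuous_intros)
      qed
      have "(\<lambda>j. I Re j ?x) \<longlonglongrightarrow> Re ?s + 0" "(\<lambda>j. I Im j ?x) \<longlonglongrightarrow> Im ?s + 0"
        using I by (auto intro!: tendsto_add lim0 simp del: add_0_right)
      then have "lim (\<lambda>j. I Re j ?x) = Re ?s" "lim (\<lambda>j. I Im j ?x) = Im ?s" by (simp_all add: limI)
      then show "?s = S ?x" by (simp add: S_def complex_eq_iff)
    qed
  qed
  ultimately show ?thesis by blast
qed

end

theorem theorem1p3:
  fixes M :: "'w measure" and \<xi> :: "nat \<Rightarrow> 'w \<Rightarrow> complex" and D :: "complex set"
    and Z :: "'w \<Rightarrow> config"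
  assumes "prob_space M"
    and "prob_space.indep_vars M (\<lambda>_. borel) \<xi> UNIV"
    and "\<And>k. distributed M lborel (\<xi> k) (\<lambda>z. ennreal (std_complex_normal_density z))"
    and "bounded D" and "open D"
  defines "Z \<equiv> \<lambda>\<omega>. zero_config (gaf (\<lambda>k. \<xi> k \<omega>))"
  shows "(\<exists>N \<in> measurable (borel_of (weak_topology (- D))) (count_space (UNIV :: nat set)).
            AE \<omega> in M. num_points (restrict_config (Z \<omega>) D) = N (restrict_config (Z \<omega>) (- D))) \<and>
         (\<exists>S \<in> measurable (borel_of (weak_topology (- D))) (borel :: complex measure).
            AE \<omega> in M. sum_points (restrict_config (Z \<omega>) D) = S (restrict_config (Z \<omega>) (- D)))"
proof -
  interpret gaf_process M \<xi>
    using assms(1-3) by (simp add: gaf_process_def gaf_process_axioms_def)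
  show ?thesis
    unfolding Z_def using count_rigidity moment_rigidity assms(4,5) by blast
qed

end
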